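(* In the setting of the context (generic case): (1) For $1\le i\le p-1$, $1\le k\le r_i$, $1\le h\le\ell_{i,k}$ one has, for $x\in\mathcal S_i^+\cup\mathcal S_{i+1}^-$, $$U_{t_i,k,h}(x)=\sum_{\tilde k=1}^{r_{i+1}}\sum_{\tilde h=1}^{\ell_{i+1,\tilde k}}C_{t_{i+1},\tilde k,\tilde h;t_i,k,h}\,U_{t_{i+1},\tilde k,\tilde h}(x)+\mathrm{hol}(x-t_{i+1}),$$ $$C_{t_{i+1},\tilde k,\tilde h;t_i,k,h}=\frac{e^{\pi\sqrt{-1}\lambda_{i,k}}(t_i-t_{p+1})^{2\lambda_{i,k}-\rho_1-\rho_2}}{e^{\pi\sqrt{-1}\lambda_{i+1,\tilde k}}(t_{i+1}-t_{p+1})^{2\lambda_{i+1,\tilde k}-\rho_1-\rho_2}}\,c_{t'_{i+1},\tilde k,\tilde h;t'_i,k,h}.$$ (2) For $2\le i\le p$, $1\le k\le r_i$, $1\le h\le\ell_{i,k}$ one has, for $x\in\mathcal S_i^-\cup\mathcal S_{i-1}^+$, $$U_{t_i,k,h}(x)=\sum_{\tilde k=1}^{r_{i-1}}\sum_{\tilde h=1}^{\ell_{i-1,\tilde k}}C_{t_{i-1},\tilde k,\tilde h;t_i,k,h}\,U_{t_{i-1},\tilde k,\tilde h}(x)+\mathrm{hol}(x-t_{i-1}),$$ $$C_{t_{i-1},\tilde k,\tilde h;t_i,k,h}=\frac{e^{\pi\sqrt{-1}\lambda_{i,k}}(t_i-t_{p+1})^{2\lambda_{i,k}-\rho_1-\rho_2}}{e^{\pi\sqrt{-1}\lambda_{i-1,\tilde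 k}}(t_{i-1}-t_{p+1})^{2\lambda_{i-1,\tilde k}-\rho_1-\rho_2}}\,c_{t'_{i-1},\tilde k,\tilde h;t'_i,k,h}.$$
   Context: **System.** Let $t_1,\dots,t_{p+1}\in\mathbb C$ be distinct, no three on a straight line; $T=\mathrm{diag}(t_1I_{n_1},\dots,t_pI_{n_p})$, $n=n_1+\dots+n_p$. Let $A\in M(n;\mathbb C)$, partitioned in blocks $A_{ij}$ like $T$, have diagonal blocks $A_{ii}=\mathrm{diag}(\lambda_{i,1}I_{\ell_{i,1}},\dots,\lambda_{i,r_i}I_{\ell_{i,r_i}})$ ($\lambda_{i,k}$ distinct for fixed $i$), and let $P\in GL(n;\mathbb C)$ be such that $A'=P^{-1}AP=\mathrm{diag}(\mu_1I_{m_1},\dots,\mu_qI_{m_q})$ ($\mu_k$ distinct). Let $\rho_1,\rho_2\in\mathbb C$. The rank $2n$ system is $$(xI_{2n}-\mathcal T)\frac{dU}{dx}=\mathcal A_PU,\quad \mathcal T=\begin{pmatrix}T&\\&t_{p+1}I_n\end{pmatrix},\quad \mathcal A_P=\begin{pmatrix}A&P\\-(A'-\rho_1I_n)(A'-\rho_2I_n)P^{-1}&(\rho_1+\rho_2)I_n-A'\end{pmatrix}.$$ **Assumptions.** None of the following is an integer: $\lambda_{i,k}$; $\lambda_{i,k}-\lambda_{i,h}$ ($k\ne h$); $\mu_k$; $\mu_k-\mu_h$ ($k\neq h$); $\lambda_{i,k}-\mu_h$; $\rho_j$; $\rho_1-\rho_2$; $\rho_j-\lambda_{i,k}$; $\rho_j-\mu_k$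 (all admissible indices). **Sectors.** Arguments $\theta_i=\arg(t_i-t_{p+1})$ are fixed with $\theta_1<\dots<\theta_p<\theta_1+2\pi$, and $\theta_{p+1}$ is a fixed real number with $\theta_p<\theta_{p+1}<\theta_1+2\pi$; $\theta_0=\theta_{p+1}-2\pi$. With $\delta>0$ fixed and sufficiently small, $\mathcal S_i^+=\{\theta_i<\arg(x-t_{p+1})<\min(\theta_{i+1}-\delta,\theta_i+\pi)\}$, $\mathcal S_i^-=\{\max(\theta_{i-1}+\delta,\theta_i-\pi)<\arg(x-t_{p+1})<\theta_i\}$ ($1\le i\le p$). $\arg(x-t_i)\in(\theta_i,\theta_i+\pi)$ in $\mathcal S_i^+$ and $\in(\theta_i-\pi,\theta_i)$ in $\mathcal S_i^-$. Powers of $t_i-t_{p+1}$ use $\arg=\theta_i$. In (1) $U_{t_i,k,h}$ is taken with its branch on $\mathcal S_i^+$ and $U_{t_{i+1},\tilde k,\tilde h}$ with its branch on $\mathcal S_{i+1}^-$, both continued analytically in the (connected) sector $\mathcal S_i^+\cup\mathcal S_{i+1}^-$; similarly in (2). **Local solutions.** $\varepsilon_m(k)$ is the $k$-th unit $m$-vector. $U_{t_i,k,h}$ ($1\le i\le p$) is the unique solution of the system of the form $U_{t_i,k,h}(x)=(x-t_i)^{\lambda_{i,k}}\{\varepsilon_{2n}(n_1+\dots+n_{i-1}+\ell_{i,1}+\dots+\ell_{i,k-1}+h)+\sum_{m\ge1}G(m)(x-t_i)^m\}$ (convergent near $t_i$). $\mathrm{hol}(x-a)$ denotes a vector function holomorphic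 in a neighbourhood of $x=a$. **Underlying system.** Fix $\eta_0\in\mathbb C$; $t'_i=\eta_0+\frac1{t_i-t_{p+1}}$, $T'=\mathrm{diag}(t'_1I_{n_1},\dots,t'_pI_{n_p})$, $\theta'_i=\arg(t'_i-\eta_0)=-\theta_i$. The underlying system is $(\zeta I_n-T')\frac{dw}{d\zeta}=(\rho I_n+A)w$. For $\rho=0$ it has the unique solutions $w_{t'_i,k,h}(0;\zeta)=(\zeta-t'_i)^{\lambda_{i,k}}\{\varepsilon_n(n_1+\dots+n_{i-1}+\ell_{i,1}+\dots+\ell_{i,k-1}+h)+O(\zeta-t'_i)\}$ near $t'_i$ ($O$-term a convergent power series). Let $\mathcal P'=\mathbb C\setminus\bigcup_i\{\eta_0+(t'_i-\eta_0)s: s\ge1\}$; in $\mathcal P'$ the branch of $w_{t'_i,k,h}$ is fixed by $\arg(\zeta-t'_i)\in(\theta'_i-2\pi,\theta'_i)$. The constants $c_{t'_\nu,\tilde k,\tilde h;t'_i,k,h}$ ($\nu\ne i$) are the connection coefficients of the underlying system with $\rho=0$, defined in $\mathcal P'$ by $$w_{t'_i,k,h}(0;\zeta)=\sum_{\tilde k=1}^{r_\nu}\sum_{\tilde h=1}^{\ell_{\nu,\tilde k}}c_{t'_\nu,\tilde k,\tilde h;t'_i,k,h}\,w_{t'_\nu,\tilde k,\tilde h}(0;\zeta)+\mathrm{hol}(\zeta-t'_\nu).$$ *)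

theory Defs
  imports
    "HOL-Complex_Analysis.Complex_Analysis"
    "Jordan_Normal_Form.Matrix"
begin

(* Vectors and matrices of varying size are those of Jordan_Normal_Form; the other
   meanings of the index notation are switched off. *)
no_notation Finite_Cartesian_Product.vec_nth (infixl "$" 90)
no_notation Formal_Power_Series.fps_nth (infixl "$" 75)

text \<open>
  The power \<open>z ^ a\<close> computed with the value \<open>\<phi>\<close> of the argument of \<open>z\<close>; it is only meant to be
  used when \<open>is_Arg z \<phi>\<close> and \<open>z \<noteq> 0\<close>.
\<close>
definition pow_arg :: "real \<Rightarrow> complex \<Rightarrow> complex \<Rightarrow> complex" where
  "pow_arg \<phi> z a = exp (a * Complex (ln (norm z)) \<phi>)"

text \<open>\<open>diag(c\<^sub>1 I\<^bsub>d\<^sub>1\<^esub>, \<dots>, c\<^sub>s I\<^bsub>d\<^sub>s\<^esub>)\<close>\<close>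
definition scalar_blocks :: "nat \<Rightarrow> (nat \<Rightarrow> complex) \<Rightarrow> (nat \<Rightarrow> nat) \<Rightarrow> complex mat" where
  "scalar_blocks s c d = diag_block_mat (map (\<lambda>k. c k \<cdot>\<^sub>m 1\<^sub>m (d k)) [1..<Suc s])"

text \<open>The diagonal block of \<open>M\<close> of size \<open>d\<close> whose top left entry sits at \<open>(s, s)\<close>, counted from \<open>0\<close>.\<close>
definition diag_submat :: "complex mat \<Rightarrow> nat \<Rightarrow> nat \<Rightarrow> complex mat" where
  "diag_submat M s d = mat d d (\<lambda>(a, b). M $$ (s + a, s + b))"

text \<open>
  The position \<open>n\<^sub>1 + \<dots> + n\<^bsub>i-1\<^esub> + \<ell>\<^bsub>i,1\<^esub> + \<dots> + \<ell>\<^bsub>i,k-1\<^esub> + h\<close>, shifted by one because the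
  library counts vector entries from \<open>0\<close>; \<open>i\<close>, \<open>k\<close>, \<open>h\<close> themselves count from \<open>1\<close>.
\<close>
definition pos :: "(nat \<Rightarrow> nat) \<Rightarrow> (nat \<Rightarrow> nat \<Rightarrow> nat) \<Rightarrow> nat \<Rightarrow> nat \<Rightarrow> nat \<Rightarrow> nat" where
  "pos n l i k h = (\<Sum>i'=1..<i. n i') + (\<Sum>k'=1..<k. l i k') + (h - 1)"

definition ext_T :: "nat \<Rightarrow> complex mat \<Rightarrow> complex \<Rightarrow> complex mat" where
  "ext_T N T s = four_block_mat T (0\<^sub>m N N) (0\<^sub>m N N) (s \<cdot>\<^sub>m 1\<^sub>m N)"

text \<open>The argument \<open>Q\<close> stands for the inverse of \<open>P\<close>, and \<open>A'\<close> for \<open>Q * A * P\<close>.\<close>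
definition ext_A :: "nat \<Rightarrow> complex mat \<Rightarrow> complex mat \<Rightarrow> complex mat \<Rightarrow> complex mat \<Rightarrow>
    complex \<Rightarrow> complex \<Rightarrow> complex mat" where
  "ext_A N A P Q A' \<rho>\<^sub>1 \<rho>\<^sub>2 = four_block_mat
     A P
     (- ((A' - \<rho>\<^sub>1 \<cdot>\<^sub>m 1\<^sub>m N) * (A' - \<rho>\<^sub>2 \<cdot>\<^sub>m 1\<^sub>m N) * Q)) ((\<rho>\<^sub>1 + \<rho>\<^sub>2) \<cdot>\<^sub>m 1\<^sub>m N - A')"

definition underlying_A :: "nat \<Rightarrow> complex mat \<Rightarrow> complex \<Rightarrow> complex mat" where
  "underlying_A N A \<rho> = \<rho> \<cdot>\<^sub>m 1\<^sub>m N + A"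

text \<open>\<open>f\<close> is a holomorphic solution of \<open>(x I - S) f' = M f\<close> on \<open>D\<close>.\<close>
definition solves_on ::
    "nat \<Rightarrow> complex mat \<Rightarrow> complex mat \<Rightarrow> complex set \<Rightarrow> (complex \<Rightarrow> complex Matrix.vec) \<Rightarrow> bool" where
  "solves_on N S M D f \<longleftrightarrow>
     (\<forall>x\<in>D. f x \<in> carrier_vec N) \<and>
     (\<forall>j<N. (\<lambda>x. f x $ j) holomorphic_on D) \<and>
     (\<forall>x\<in>D. (x \<cdot>\<^sub>m 1\<^sub>m N - S) *\<^sub>v Matrix.vec N (\<lambda>j. deriv (\<lambda>y. f y $ j) x) = M *\<^sub>v f x)"

text \<open>
  \<open>f\<close> solves the system on \<open>D\<close>, and on the part of \<open>B \<subseteq> D\<close> close to \<open>a\<close> it is the branch of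
  \<open>(x - a)\<^bsup>\<alpha>\<^esup> (e + \<Sum>\<^bsub>m\<ge>1\<^esub> G(m) (x - a)\<^bsup>m\<^esup>)\<close> with \<open>arg (x - a) \<in> I\<close>, the series being convergent
  near \<open>a\<close> and \<open>e\<close> being the unit vector with the entry \<open>1\<close> at position \<open>j\<^sub>0\<close>. If \<open>D\<close> is open and
  connected and \<open>B\<close> contains points of a punctured neighbourhood of \<open>a\<close>, then \<open>f\<close> is the analytic
  continuation of this branch to \<open>D\<close>.
\<close>
definition local_solution ::
    "nat \<Rightarrow> complex mat \<Rightarrow> complex mat \<Rightarrow> complex \<Rightarrow> complex \<Rightarrow> nat \<Rightarrow> real set \<Rightarrow>
     complex set \<Rightarrow> complex set \<Rightarrow> (complex \<Rightarrow> complex Matrix.vec) \<Rightarrow> bool" where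
  "local_solution N S M a \<alpha> j\<^sub>0 I B D f \<longleftrightarrow>
     solves_on N S M D f \<and>
     (\<exists>\<epsilon>>0. \<exists>G :: nat \<Rightarrow> complex Matrix.vec.
        (\<forall>m. G m \<in> carrier_vec N) \<and> G 0 = unit_vec N j\<^sub>0 \<and>
        (\<forall>j<N. \<forall>z\<in>ball 0 \<epsilon>. summable (\<lambda>m. G m $ j * z ^ m)) \<and>
        (\<forall>x\<in>B \<inter> ball a \<epsilon> - {a}. \<forall>\<phi>\<in>I. is_Arg (x - a) \<phi> \<longrightarrow>
           (\<forall>j<N. f x $ j = pow_arg \<phi> (x - a) \<alpha> * (\<Sum>m. G m $ j * (x - a) ^ m))))"

text \<open>
  \<open>f = \<Sum>\<^sub>k \<Sum>\<^sub>h C\<^bsub>k,h\<^esub> F\<^bsub>k,h\<^esub> + hol(x - b)\<close> on \<open>D\<close>, where \<open>1 \<le> k \<le> s\<close> and \<open>1 \<le> h \<le> d k\<close>. The last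
  term is holomorphic on \<open>D\<close> and on a full neighbourhood \<open>V\<close> of \<open>b\<close>, which is in general only a
  boundary point of \<open>D\<close>.
\<close>
definition connection_relation ::
    "nat \<Rightarrow> complex set \<Rightarrow> complex \<Rightarrow> nat \<Rightarrow> (nat \<Rightarrow> nat) \<Rightarrow> (nat \<Rightarrow> nat \<Rightarrow> complex) \<Rightarrow>
     (nat \<Rightarrow> nat \<Rightarrow> complex \<Rightarrow> complex Matrix.vec) \<Rightarrow> (complex \<Rightarrow> complex Matrix.vec) \<Rightarrow> bool" where
  "connection_relation N D b s d C F f \<longleftrightarrow>
     (\<exists>V g. open V \<and> b \<in> V \<and> (\<forall>j<N. (\<lambda>x. g x $ j) holomorphic_on (D \<union> V)) \<and>
        (\<forall>x\<in>D. \<forall>j<N. f x $ j = (\<Sum>k=1..s. \<Sum>h=1..d k. C k h * F k h x $ j) + g x $ j))"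

definition sector :: "complex \<Rightarrow> real \<Rightarrow> real \<Rightarrow> complex set" where
  "sector a \<alpha> \<beta> = {x. x \<noteq> a \<and> (\<exists>\<phi>. is_Arg (x - a) \<phi> \<and> \<alpha> < \<phi> \<and> \<phi> < \<beta>)}"

definition sector_plus :: "complex \<Rightarrow> (nat \<Rightarrow> real) \<Rightarrow> real \<Rightarrow> nat \<Rightarrow> complex set" where
  "sector_plus a \<theta> \<delta> i = sector a (\<theta> i) (min (\<theta> (i + 1) - \<delta>) (\<theta> i + pi))"

definition sector_minus :: "complex \<Rightarrow> (nat \<Rightarrow> real) \<Rightarrow> real \<Rightarrow> nat \<Rightarrow> complex set" where
  "sector_minus a \<theta> \<delta> i = sector a (max (\<theta> (i - 1) + \<delta>) (\<theta> i - pi)) (\<theta> i)"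

text \<open>The plane slit along the rays from \<open>t' i\<close> to infinity that point away from \<open>\<eta>\<^sub>0\<close>.\<close>
definition slit_plane :: "nat \<Rightarrow> complex \<Rightarrow> (nat \<Rightarrow> complex) \<Rightarrow> complex set" where
  "slit_plane p \<eta>\<^sub>0 t' =
     UNIV - (\<Union>i\<in>{1..p}. {\<eta>\<^sub>0 + (t' i - \<eta>\<^sub>0) * of_real s | s. s \<ge> 1})"

end

theory Submission
  imports Defs "Jordan_Normal_Form.Determinant"
begin

text \<open>
  In the coordinate \<open>y = - log (x - t\<^sub>0)\<close> both systems live on the same strip between the logarithms
  of two neighbouring singular points, since \<open>\<zeta> - \<eta>\<^sub>0 = 1 / (x - t\<^sub>0)\<close>. A solution \<open>\<omega>\<close> of the
  underlying system with exponent \<open>\<alpha>\<close> at one of these points yields, up to an exponential factor, the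
  upper half \<open>\<omega> + \<kappa> * \<omega>\<close> of a solution of the rank \<open>2N\<close> system, where \<open>*\<close> is the Volterra
  convolution from that point and the kernel \<open>\<kappa>\<close> is holomorphic at \<open>0\<close>. The kernel does not depend on \<open>\<omega>\<close>, and changing the base point of the
  convolution only adds a holomorphic term, so the operation carries connection relations to
  connection relations with the same coefficients. It needs \<open>Re \<alpha>\<close> large, which is arranged by
  differentiating solutions. Since \<open>\<alpha>\<close> differs from the other exponents by non-integers, a solution
  with exponent \<open>\<alpha>\<close> is determined by its leading coefficient; comparing leading coefficients in \<open>x\<close>,
  \<open>\<zeta>\<close> and \<open>y\<close> yields the factors \<open>exp (pi \<i> \<alpha>) (t\<^sub>i - t\<^sub>0) powr (2 \<alpha> - \<rho>\<^sub>1 - \<rho>\<^sub>2)\<close>.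
\<close>

section \<open>Branches with a power singularity\<close>

text \<open>Eliminating the lower half of the rank 2N system leaves a second-order system for the
  upper half. A convolution can link it to the underlying first-order system because
  \<open>exp y\<close> multiplies a convolution by multiplying both of its factors, so that the
  variable coefficient passes under the integral. When w + k * w is inserted, the terms outside the
  convolutions agree if k(0) = (rho1 + 1)(rho2 + 1), and the terms under them agree if k solves one
  scalar second-order equation, which does not involve the matrix A. That equation is singular only
  where exp t = 1; its solution regular at 0 therefore lives on |Im t| < 2 pi. The strip between two
  neighbouring logarithms has height below 2 pi, hence every difference y - s that occurs lies in
  the domain of k. The second obstacle is that w may be unbounded at its singular point. Replacing
  (A, rho1, rho2) by (A + 1, rho1 + 1, rho2 + 1) adds the identity to the matrices of both systems
  and raises all exponents by one; d/dzeta and d/dx lead back.\<close>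

definition side_domain :: "complex set \<Rightarrow> complex \<Rightarrow> bool" where
  "side_domain Y a \<longleftrightarrow> open Y \<and> a \<in> closure Y \<and> (\<forall>y\<in>Y. Im y \<noteq> Im a)"

text \<open>The singular points lie on the boundary of the strip, so a branch is given on one side
  only. There \<open>y - a\<close> avoids the cut of \<open>Ln\<close>, since the imaginary parts of
  \<open>y\<close> and \<open>a\<close> differ, and the principal power is holomorphic on all of
  \<open>Y\<close>. The factor \<open>H\<close> is nevertheless required to be holomorphic on a full
  ball.\<close>

definition has_branch ::
    "complex set \<Rightarrow> complex \<Rightarrow> complex \<Rightarrow> (complex \<Rightarrow> complex) \<Rightarrow> (complex \<Rightarrow> complex) \<Rightarrow> bool" where
  "has_branch Y a \<alpha> f H \<longleftrightarrow> (\<exists>\<epsilon>>0. H holomorphic_on ball a \<epsilon> \<and>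
     (\<forall>y\<in>Y \<inter> ball a \<epsilon>. f y = exp (\<alpha> * Ln (y - a)) * H y))"

lemma side_domain_notin_nonpos: "side_domain Y a \<Longrightarrow> y \<in> Y \<Longrightarrow> y - a \<notin> \<real>\<^sub>\<le>\<^sub>0"
  by (auto simp: side_domain_def complex_nonpos_Reals_iff)

lemma side_domain_meets_ball:
  "side_domain Y a \<Longrightarrow> 0 < \<epsilon> \<Longrightarrow> Y \<inter> ball a \<epsilon> \<noteq> {} \<and> open (Y \<inter> ball a \<epsilon>)"
  using open_Int_closure_eq_empty[of "ball a \<epsilon>" Y] centre_in_ball[of a \<epsilon>]
  unfolding side_domain_def by (metis Int_commute disjoint_iff open_Int open_ball)

lemma has_branchE:
  assumes "has_branch Y a \<alpha> f H"
  obtains \<epsilon> where "0 < \<epsilon>" "H holomorphic_on ball a \<epsilon>"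
    "\<And>y. y \<in> Y \<Longrightarrow> y \<in> ball a \<epsilon> \<Longrightarrow> f y = exp (\<alpha> * Ln (y - a)) * H y"
  using assms by (auto simp: has_branch_def)

lemma has_branchI:
  assumes "0 < \<epsilon>" "H holomorphic_on ball a \<epsilon>"
    "\<And>y. y \<in> Y \<Longrightarrow> y \<in> ball a \<epsilon> \<Longrightarrow> f y = exp (\<alpha> * Ln (y - a)) * H y"
  shows "has_branch Y a \<alpha> f H"
  using assms by (auto simp: has_branch_def)

lemma has_branch_cong:
  "(\<And>y. y \<in> Y \<Longrightarrow> f y = g y) \<Longrightarrow> has_branch Y a \<alpha> f H = has_branch Y a \<alpha> g H"
  unfolding has_branch_def by (intro ex_cong conj_cong ball_cong refl) auto

lemma has_branch_mult:
  assumes "has_branch Y a \<alpha> f H" "open W" "a \<in> W" "g holomorphic_on W"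
  shows "has_branch Y a \<alpha> (\<lambda>y. g y * f y) (\<lambda>y. g y * H y)"
proof -
  obtain \<epsilon> where e: "0 < \<epsilon>" "H holomorphic_on ball a \<epsilon>"
    "\<And>y. y \<in> Y \<Longrightarrow> y \<in> ball a \<epsilon> \<Longrightarrow> f y = exp (\<alpha> * Ln (y - a)) * H y"
    using assms(1) by (rule has_branchE) blast
  obtain d where d: "0 < d" "ball a d \<subseteq> W"
    using assms(2,3) open_contains_ball_eq by blast
  show ?thesis
  proof (rule has_branchI[of "min \<epsilon> d"])
    show "(\<lambda>y. g y * H y) holomorphic_on ball a (min \<epsilon> d)"
      by (intro holomorphic_intros holomorphic_on_subset[OF assms(4)] holomorphic_on_subset[OF e(2)])
        (use d in auto)
  qed (use e d in auto)
qed

lemma has_branch_const_mult: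
  "has_branch Y a \<alpha> f H \<Longrightarrow> has_branch Y a \<alpha> (\<lambda>y. c * f y) (\<lambda>y. c * H y)"
  by (rule has_branch_mult[where W = UNIV and g = "\<lambda>_. c"]) auto

lemma has_branch_add:
  assumes "has_branch Y a \<alpha> f H" "has_branch Y a \<alpha> g K"
  shows "has_branch Y a \<alpha> (\<lambda>y. f y + g y) (\<lambda>y. H y + K y)"
proof -
  obtain \<epsilon> where e: "0 < \<epsilon>" "H holomorphic_on ball a \<epsilon>"
    "\<And>y. y \<in> Y \<Longrightarrow> y \<in> ball a \<epsilon> \<Longrightarrow> f y = exp (\<alpha> * Ln (y - a)) * H y"
    using assms(1) by (rule has_branchE) blast
  obtain d where d: "0 < d" "K holomorphic_on ball a d"
    "\<And>y. y \<in> Y \<Longrightarrow> y \<in> ball a d \<Longrightarrow> g y = exp (\<alpha> * Ln (y - a)) * K y"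
    using assms(2) by (rule has_branchE) blast
  show ?thesis
    by (rule has_branchI[of "min \<epsilon> d"])
      (use e d in \<open>auto intro!: holomorphic_intros simp: algebra_simps
        intro: holomorphic_on_subset[OF d(2)] holomorphic_on_subset[OF e(2)]\<close>)
qed

lemma has_branch_zero: "has_branch Y a \<alpha> (\<lambda>_. 0) (\<lambda>_. 0)"
  by (rule has_branchI[of 1]) auto

lemma has_branch_sum:
  "(\<And>i. i \<in> I \<Longrightarrow> has_branch Y a \<alpha> (f i) (H i)) \<Longrightarrow>
    has_branch Y a \<alpha> (\<lambda>y. \<Sum>i\<in>I. f i y) (\<lambda>y. \<Sum>i\<in>I. H i y)"
  by (induction I rule: infinite_finite_induct) (auto intro: has_branch_zero has_branch_add)

text \<open>Trading one unit of the exponent for a zero of the regular factor makes branches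
  comparable whose exponents differ by an integer.\<close>

lemma has_branch_raise:
  assumes "side_domain Y a" "has_branch Y a (\<alpha> + 1) f H"
  shows "has_branch Y a \<alpha> f (\<lambda>y. (y - a) * H y)"
proof -
  obtain \<epsilon> where e: "0 < \<epsilon>" "H holomorphic_on ball a \<epsilon>"
    "\<And>y. y \<in> Y \<Longrightarrow> y \<in> ball a \<epsilon> \<Longrightarrow> f y = exp ((\<alpha> + 1) * Ln (y - a)) * H y"
    using assms(2) by (rule has_branchE) blast
  have "y \<noteq> a" if "y \<in> Y" for y
    using assms(1) that by (auto simp: side_domain_def)
  then show ?thesis
    by (intro has_branchI[of \<epsilon>])
      (use e in \<open>auto intro!: holomorphic_intros simp: ring_distribs exp_add\<close>)
qed

lemma has_branch_deriv:
  assumes Y: "side_domain Y a" and f: "has_branch Y a \<alpha> f H"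
  shows "has_branch Y a (\<alpha> - 1) (deriv f) (\<lambda>y. \<alpha> * H y + (y - a) * deriv H y)"
proof -
  obtain \<epsilon> where e: "0 < \<epsilon>" "H holomorphic_on ball a \<epsilon>"
    "\<And>y. y \<in> Y \<Longrightarrow> y \<in> ball a \<epsilon> \<Longrightarrow> f y = exp (\<alpha> * Ln (y - a)) * H y"
    using f by (rule has_branchE) blast
  show ?thesis
  proof (rule has_branchI[OF e(1)])
    show "(\<lambda>y. \<alpha> * H y + (y - a) * deriv H y) holomorphic_on ball a \<epsilon>"
      using e(2) by (auto intro!: holomorphic_intros)
    fix y assume y: "y \<in> Y" "y \<in> ball a \<epsilon>"
    note s = side_domain_notin_nonpos[OF Y y(1)]
    then have ne: "y - a \<noteq> 0" by auto
    have H: "(H has_field_derivative deriv H y) (at y)"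
      using e(2) y(2) by (auto intro: holomorphic_derivI)
    have "((\<lambda>y. exp (\<alpha> * Ln (y - a)) * H y) has_field_derivative
        exp (\<alpha> * Ln (y - a)) * (\<alpha> * inverse (y - a)) * H y + deriv H y * exp (\<alpha> * Ln (y - a))) (at y)"
      by (rule derivative_eq_intros refl H s)+ (use s in auto)
    moreover have "eventually (\<lambda>z. z \<in> Y \<inter> ball a \<epsilon>) (nhds y)"
      using y Y by (intro eventually_nhds_in_open) (auto simp: side_domain_def)
    then have "eventually (\<lambda>z. exp (\<alpha> * Ln (z - a)) * H z = f z) (nhds y)"
      by eventually_elim (use e(3) in auto)
    ultimately have "(f has_field_derivative
        exp (\<alpha> * Ln (y - a)) * (\<alpha> * inverse (y - a)) * H y + deriv H y * exp (\<alpha> * Ln (y - a))) (at y)"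
      by (subst (asm) DERIV_cong_ev[OF refl _ refl]) auto
    then have "deriv f y = exp (\<alpha> * Ln (y - a)) * (\<alpha> * inverse (y - a)) * H y + deriv H y * exp (\<alpha> * Ln (y - a))"
      by (rule DERIV_imp_deriv)
    also have "\<dots> = exp ((\<alpha> - 1) * Ln (y - a)) * (\<alpha> * H y + (y - a) * deriv H y)"
    proof -
      have *: "exp ((\<alpha> - 1) * Ln (y - a)) = exp (\<alpha> * Ln (y - a)) / (y - a)"
        using ne by (simp add: left_diff_distrib exp_diff)
      have "E * (\<alpha> * inverse d) * h + k * E = E / d * (\<alpha> * h + d * k)" if "d \<noteq> 0" for E d h k :: complex
        using that by (simp add: field_simps)
      from this[OF ne] show ?thesis unfolding * .
    qed
    finally show "deriv f y = exp ((\<alpha> - 1) * Ln (y - a)) * (\<alpha> * H y + (y - a) * deriv H y)" .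
  qed
qed

text \<open>The power never vanishes and \<open>Y\<close> meets every ball around \<open>a\<close>
  in a nonempty open set. So the regular factors agree on that set and, by the identity theorem, on
  the whole ball.\<close>

lemma has_branch_unique:
  assumes Y: "side_domain Y a" and H: "has_branch Y a \<alpha> f H" and K: "has_branch Y a \<alpha> f K"
  obtains \<epsilon> where "0 < \<epsilon>" "H holomorphic_on ball a \<epsilon>" "K holomorphic_on ball a \<epsilon>"
    "\<And>y. y \<in> ball a \<epsilon> \<Longrightarrow> H y = K y"
proof -
  obtain \<epsilon> where e: "0 < \<epsilon>" "H holomorphic_on ball a \<epsilon>"
    "\<And>y. y \<in> Y \<Longrightarrow> y \<in> ball a \<epsilon> \<Longrightarrow> f y = exp (\<alpha> * Ln (y - a)) * H y"
    using H by (rule has_branchE) blast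
  obtain d where d: "0 < d" "K holomorphic_on ball a d"
    "\<And>y. y \<in> Y \<Longrightarrow> y \<in> ball a d \<Longrightarrow> f y = exp (\<alpha> * Ln (y - a)) * K y"
    using K by (rule has_branchE) blast
  define \<eta> where "\<eta> = min \<epsilon> d"
  have \<eta>: "0 < \<eta>" "H holomorphic_on ball a \<eta>" "K holomorphic_on ball a \<eta>"
    using e d by (auto simp: \<eta>_def intro: holomorphic_on_subset)
  note m = side_domain_meets_ball[OF Y \<eta>(1)]
  have "H y = K y" if "y \<in> ball a \<eta>" for y
  proof (rule analytic_continuation_open[of "Y \<inter> ball a \<eta>" "ball a \<eta>" H K])
    fix z assume "z \<in> Y \<inter> ball a \<eta>"
    then show "H z = K z" using e(3)[of z] d(3)[of z] by (auto simp: \<eta>_def)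
  qed (use m \<eta> that in auto)
  then show ?thesis using \<eta> that by blast
qed

lemma holomorphic_factor_root:
  assumes "H holomorphic_on ball a \<epsilon>" "0 < \<epsilon>" "H a = (0::complex)"
  obtains G where "G holomorphic_on ball a \<epsilon>" "\<And>y. y \<in> ball a \<epsilon> \<Longrightarrow> H y = (y - a) * G y"
    "G a = deriv H a"
proof
  let ?G = "\<lambda>y. if y = a then deriv H a else (H y - H a) / (y - a)"
  show "?G holomorphic_on ball a \<epsilon>"
    by (rule pole_theorem_open_0[where a = a and g = "\<lambda>y. H y"])
       (use assms in auto)
  show "H y = (y - a) * ?G y" if "y \<in> ball a \<epsilon>" for y using assms(3) by auto
  show "?G a = deriv H a" by simp
qed

text \<open>Comparing the regular factors of the derivative gives
  \<open>\<alpha> * H y + (y - a) * deriv H y = (y - a) * K y\<close>, which forces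
  \<open>H a = 0\<close>. Dividing out this zero raises the exponent, and the divided equation at
  \<open>a\<close> yields the leading coefficient. No constant of integration interferes because
  \<open>f\<close> itself is known to carry the exponent.\<close>

lemma has_branch_integrate:
  assumes Y: "side_domain Y a" and H: "has_branch Y a \<alpha> f H" and K: "has_branch Y a \<alpha> (deriv f) K"
    and \<alpha>: "\<alpha> \<noteq> 0"
  obtains G where "has_branch Y a (\<alpha> + 1) f G" "(\<alpha> + 1) * G a = K a"
proof -
  have K': "has_branch Y a (\<alpha> - 1) (deriv f) (\<lambda>y. (y - a) * K y)"
    using K by (intro has_branch_raise[OF Y]) simp
  obtain \<epsilon> where e: "0 < \<epsilon>"
    and eq: "\<And>y. y \<in> ball a \<epsilon> \<Longrightarrow> \<alpha> * H y + (y - a) * deriv H y = (y - a) * K y"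
    using has_branch_unique[OF Y has_branch_deriv[OF Y H] K'] by metis
  obtain d where d: "0 < d" "H holomorphic_on ball a d"
    "\<And>y. y \<in> Y \<Longrightarrow> y \<in> ball a d \<Longrightarrow> f y = exp (\<alpha> * Ln (y - a)) * H y"
    using H by (rule has_branchE) blast
  obtain d' where d': "0 < d'" "K holomorphic_on ball a d'"
    using K by (rule has_branchE) blast
  have H0: "H a = 0" using eq[of a] e \<alpha> by simp
  obtain G where G: "G holomorphic_on ball a d" "\<And>y. y \<in> ball a d \<Longrightarrow> H y = (y - a) * G y"
    "G a = deriv H a"
    using holomorphic_factor_root[OF d(2,1) H0] by metis
  have "has_branch Y a (\<alpha> + 1) f G"
  proof (rule has_branchI[OF d(1) G(1)])
    fix y assume y: "y \<in> Y" "y \<in> ball a d"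
    then have "y - a \<noteq> 0" using side_domain_notin_nonpos[OF Y y(1)] by auto
    then show "f y = exp ((\<alpha> + 1) * Ln (y - a)) * G y"
      using d(3)[OF y] G(2)[OF y(2)] by (simp add: ring_distribs exp_add)
  qed
  moreover have "(\<alpha> + 1) * G a = K a"
  proof -
    have hd: "deriv H holomorphic_on ball a d" using d by (auto intro: holomorphic_intros)
    define \<eta> where "\<eta> = min \<epsilon> (min d d')"
    have \<eta>: "0 < \<eta>" using e d d' by (auto simp: \<eta>_def)
    have 1: "(\<lambda>y. \<alpha> * G y + deriv H y - K y) holomorphic_on ball a \<eta>"
      by (intro holomorphic_intros) (auto simp: \<eta>_def intro: holomorphic_on_subset[OF G(1)]
         holomorphic_on_subset[OF d(2)] holomorphic_on_subset[OF d'(2)])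
    have 2: "\<alpha> * G y + deriv H y - K y = 0" if "y \<in> ball a \<eta>" "y \<noteq> a" for y
    proof -
      have "(y - a) * (\<alpha> * G y + deriv H y - K y) = 0"
      proof -
        have "\<alpha> * ((y - a) * G y) + (y - a) * deriv H y = (y - a) * K y"
          using eq[of y] G(2)[of y] that by (simp add: \<eta>_def)
        then show ?thesis by (simp add: algebra_simps)
      qed
      then show ?thesis using that by simp
    qed
    have cont: "isCont (\<lambda>y. \<alpha> * G y + deriv H y - K y) a"
      using holomorphic_on_imp_continuous_on[OF 1] \<eta> by (simp add: continuous_on_eq_continuous_at)
    \<comment> \<open>The factor \<open>y - a\<close> can be cancelled only away from
      \<open>a\<close>; continuity carries the identity to \<open>a\<close>.\<close>
    have "\<alpha> * G a + deriv H a - K a = 0"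
    proof (rule LIM_unique[where a = a])
      show "(\<lambda>y. \<alpha> * G y + deriv H y - K y) \<midarrow>a\<rightarrow> \<alpha> * G a + deriv H a - K a"
        using cont by (simp add: isCont_def)
      show "(\<lambda>y. \<alpha> * G y + deriv H y - K y) \<midarrow>a\<rightarrow> 0"
        by (rule Lim_transform_eventually[where f = "\<lambda>_. 0"], simp)
           (use \<eta> 2 in \<open>auto simp: eventually_at dist_commute intro!: exI[of _ \<eta>]\<close>)
    qed
    then show ?thesis using G(3) by (simp add: algebra_simps)
  qed
  ultimately show ?thesis using that by blast
qed

section \<open>Singular Volterra equations\<close>

text \<open>This is tau^(-2) times the integral of s F(s) from 0 to tau; the substitution s = r tau
  removes the singularity at 0. It is the solution R of 2 R + tau R' = F that is regular at
  0.\<close>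

definition radial_mean :: "(complex \<Rightarrow> complex) \<Rightarrow> complex \<Rightarrow> complex" where
  "radial_mean F \<tau> = integral {0..1} (\<lambda>r. of_real r * F (of_real r * \<tau>))"

lemma closed_segment_0_iff:
  "closed_segment 0 (z::complex) = (\<lambda>r. of_real r * z) ` {0..1}"
  by (auto simp: closed_segment_def scaleR_conv_of_real)

lemma star_scaled_mem:
  "closed_segment 0 z \<subseteq> S \<Longrightarrow> 0 \<le> r \<Longrightarrow> r \<le> 1 \<Longrightarrow> of_real r * (z::complex) \<in> S"
  unfolding closed_segment_0_iff by (meson atLeastAtMost_iff image_subset_iff)

lemma radial_mean_integrable:
  fixes F :: "complex \<Rightarrow> complex"
  assumes "continuous_on (closed_segment 0 z) F"
  shows "(\<lambda>r. of_real r * F (of_real r * z)) integrable_on {0..1::real}"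
  by (rule integrable_continuous_interval)
    (auto intro!: continuous_intros continuous_on_compose2[OF assms] star_scaled_mem[OF order_refl])

lemma radial_mean_has_derivative:
  assumes S: "open S" "\<And>z. z \<in> S \<Longrightarrow> closed_segment 0 z \<subseteq> S" and F: "F holomorphic_on S" and z: "z \<in> S"
  obtains D where "(radial_mean F has_field_derivative D) (at z)" "2 * radial_mean F z + z * D = F z"
proof -
  obtain e where e: "0 < e" "ball z e \<subseteq> S" using S(1) z openE by blast
  have mem: "of_real r * u \<in> S" if "u \<in> S" "0 \<le> r" "r \<le> 1" for u r
    using star_scaled_mem[OF S(2)] that by blast
  have F': "(F has_field_derivative deriv F u) (at u)" if "u \<in> S" for u
    using F S that by (auto intro: holomorphic_derivI)
  have cF: "continuous_on S F" "continuous_on S (deriv F)"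
    using F S by (auto intro!: holomorphic_on_imp_continuous_on holomorphic_intros)
  have "((\<lambda>u. integral (cbox 0 1) (\<lambda>r. of_real r * F (of_real r * u))) has_field_derivative
      integral (cbox 0 1) (\<lambda>r. of_real r * (of_real r * deriv F (of_real r * z)))) (at z within ball z e)"
  proof (rule leibniz_rule_field_derivative[where U = "ball z e"
      and fx = "\<lambda>u r. of_real r * (of_real r * deriv F (of_real r * u))"])
    fix u and r :: real assume u: "u \<in> ball z e" "r \<in> cbox 0 1"
    then have "of_real r * u \<in> S" using mem e by auto
    have d: "((\<lambda>u. F (of_real r * u)) has_field_derivative deriv F (of_real r * u) * of_real r) (at u)"
      by (rule DERIV_chain2[where f = F and g = "\<lambda>u. of_real r * u", OF F'[OF \<open>of_real r * u \<in> S\<close>]]) (auto intro!: derivative_eq_intros)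
    show "((\<lambda>u. of_real r * F (of_real r * u)) has_field_derivative
           of_real r * (of_real r * deriv F (of_real r * u))) (at u within ball z e)"
      by (rule has_field_derivative_at_within) (auto intro!: derivative_eq_intros d)
  next
    fix u assume "u \<in> ball z e"
    then show "(\<lambda>r. of_real r * F (of_real r * u)) integrable_on cbox 0 1"
      using radial_mean_integrable[of u F] continuous_on_subset[OF cF(1) S(2)] e by auto
  next
    show "continuous_on (ball z e \<times> cbox 0 1)
        (\<lambda>(u, r). of_real r * (of_real r * deriv F (of_real r * u)))"
      unfolding split_beta
      by (intro continuous_intros continuous_on_compose2[OF cF(2)]) (use mem e in auto)
  qed (use e in auto)
  then have D: "(radial_mean F has_field_derivative
      integral {0..1} (\<lambda>r. of_real r * (of_real r * deriv F (of_real r * z)))) (at z)"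
    using e by (simp add: radial_mean_def[abs_def] at_within_open[of z "ball z e"])
  \<comment> \<open>The integrand is the derivative of r^2 F(r z) in r, so its integral over the
    unit interval is F z; this is the differential equation of the mean.\<close>
  have "((\<lambda>r. 2 * (of_real r * F (of_real r * z)) + z * (of_real r * (of_real r * deriv F (of_real r * z))))
      has_integral (of_real 1)^2 * F (of_real 1 * z) - (of_real 0)^2 * F (of_real 0 * z)) {0..1::real}"
  proof (rule fundamental_theorem_of_calculus)
    fix r :: real assume r: "r \<in> {0..1}"
    then have m: "of_real r * z \<in> S" using mem z by auto
    have d: "((\<lambda>r. F (r * z)) has_field_derivative deriv F (of_real r * z) * z) (at (of_real r))"
      by (rule DERIV_chain2[where f = F and g = "\<lambda>r. r * z", OF F'[OF m]]) (auto intro!: derivative_eq_intros)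
    have 1: "((\<lambda>r::complex. r^2 * F (r * z)) has_field_derivative
        2 * (of_real r * F (of_real r * z)) + z * (of_real r * (of_real r * deriv F (of_real r * z)))) (at (of_real r))"
      by (rule derivative_eq_intros d refl | simp add: power2_eq_square algebra_simps)+
    show "((\<lambda>r. (of_real r)^2 * F (of_real r * z)) has_vector_derivative
        2 * (of_real r * F (of_real r * z)) + z * (of_real r * (of_real r * deriv F (of_real r * z))))
        (at r within {0..1})"
      by (rule has_vector_derivative_real_field[OF 1])
  qed simp
  then have i: "((\<lambda>r. 2 * (of_real r * F (of_real r * z)) + z * (of_real r * (of_real r * deriv F (of_real r * z))))
      has_integral F z) {0..1}" by simp
  have i1: "((\<lambda>r. of_real r * F (of_real r * z)) has_integral radial_mean F z) {0..1}"
    unfolding radial_mean_def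
    by (intro integrable_integral radial_mean_integrable continuous_on_subset[OF cF(1)] S z)
  have i2: "((\<lambda>r. of_real r * (of_real r * deriv F (of_real r * z))) has_integral
      integral {0..1} (\<lambda>r. of_real r * (of_real r * deriv F (of_real r * z)))) {0..1}"
    by (intro integrable_integral integrable_continuous_interval continuous_intros
        continuous_on_compose2[OF cF(2)]) (use mem z in auto)
  have "2 * radial_mean F z + z * integral {0..1} (\<lambda>r. of_real r * (of_real r * deriv F (of_real r * z))) = F z"
    using has_integral_unique[OF has_integral_add[OF has_integral_mult_right[OF i1] has_integral_mult_right[OF i2]] i] .
  with D show ?thesis using that by blast
qed

lemma radial_mean_bound:
  assumes "continuous_on (closed_segment 0 z) F" "\<And>u. u \<in> closed_segment 0 z \<Longrightarrow> norm (F u) \<le> B"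
  shows "norm (radial_mean F z) \<le> B"
proof -
  have B: "0 \<le> B" using order_trans[OF norm_ge_zero assms(2)[of 0]] by auto
  have "norm (of_real r * F (of_real r * z)) \<le> B" if "r \<in> {0..1}" for r :: real
  proof -
    have "norm (of_real r * F (of_real r * z)) = r * norm (F (of_real r * z))" using that by (simp add: norm_mult)
    also have "\<dots> \<le> 1 * B"
      using that assms(2)[of "of_real r * z"] B star_scaled_mem[OF order_refl, of r z]
      by (intro mult_mono) auto
    finally show ?thesis by simp
  qed
  then show ?thesis
    unfolding radial_mean_def
    using has_integral_bound[OF B integrable_integral[OF radial_mean_integrable[OF assms(1)], unfolded box_real[symmetric]]]
    by auto
qed

lemma radial_mean_diff:
  assumes "continuous_on (closed_segment 0 z) F" "continuous_on (closed_segment 0 z) G"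
  shows "radial_mean (\<lambda>s. F s - G s) z = radial_mean F z - radial_mean G z"
  unfolding radial_mean_def
  using integral_diff[OF radial_mean_integrable[OF assms(1)] radial_mean_integrable[OF assms(2)]]
  by (simp add: right_diff_distrib)

text \<open>One step of the Picard estimate: integration along the segment from 0 turns a term of
  the exponential series into the next one.\<close>

lemma radial_bound_integrate:
  fixes g :: "complex \<Rightarrow> complex"
  assumes g: "\<And>u. u \<in> closed_segment 0 z \<Longrightarrow> (g has_field_derivative g' u) (at u)" and g0: "g 0 = 0"
    and b: "\<And>u. u \<in> closed_segment 0 z \<Longrightarrow> norm (g' u) \<le> K * (B * (K * norm u) ^ n / fact n)"
  shows "norm (g z) \<le> B * (K * norm z) ^ Suc n / fact (Suc n)"
proof -
  have m: "of_real r * z \<in> closed_segment 0 z" if "0 \<le> r" "r \<le> 1" for r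
    using that by (auto simp: closed_segment_0_iff)
  have 1: "((\<lambda>r. g (of_real r * z)) has_vector_derivative z * g' (of_real r * z)) (at r within {0..1})"
    if "r \<in> {0..1}" for r
    proof (rule has_vector_derivative_real_field)
    have "((\<lambda>r. g (r * z)) has_field_derivative g' (of_real r * z) * z) (at (of_real r))"
      by (rule DERIV_chain2[where f = g and g = "\<lambda>r. r * z", OF g[OF m]]) (use that in \<open>auto intro!: derivative_eq_intros\<close>)
    then show "((\<lambda>r. g (r * z)) has_field_derivative z * g' (of_real r * z)) (at (of_real r))"
      by (simp add: mult.commute)
  qed
  have "norm (g (of_real 1 * z) - g (of_real 0 * z)) \<le>
      B * (K * (1 * norm z)) ^ Suc n / fact (Suc n) - B * (K * (0 * norm z)) ^ Suc n / fact (Suc n)"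
  proof (rule differentiable_bound_general[where f = "\<lambda>r. g (of_real r * z)"
      and f' = "\<lambda>r. z * g' (of_real r * z)"
      and \<phi> = "\<lambda>r. B * (K * (r * norm z)) ^ Suc n / fact (Suc n)"
      and \<phi>' = "\<lambda>r. norm z * (K * (B * (K * (r * norm z)) ^ n / fact n))" and a = 0 and b = 1])
    show "continuous_on {0..1} (\<lambda>r. g (of_real r * z))"
      unfolding continuous_on_eq_continuous_within using 1 has_vector_derivative_continuous by blast
    show "((\<lambda>r. g (of_real r * z)) has_vector_derivative z * g' (of_real r * z)) (at r)"
      if "0 < r" "r < 1" for r
      using 1[of r] that at_within_interior[of r "{0..1}"] by simp
    show "((\<lambda>r. B * (K * (r * norm z)) ^ Suc n / fact (Suc n)) has_vector_derivative
        norm z * (K * (B * (K * (r * norm z)) ^ n / fact n))) (at r)" for r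
      unfolding has_real_derivative_iff_has_vector_derivative[symmetric]
      by (rule derivative_eq_intros refl | simp add: field_simps del: fact_Suc)+ (simp add: field_simps)
    show "norm (z * g' (of_real r * z)) \<le> norm z * (K * (B * (K * (r * norm z)) ^ n / fact n))"
      if "0 < r" "r < 1" for r
      using mult_left_mono[OF b[OF m, of r], of "norm z"] that by (simp add: norm_mult)
  qed (auto intro!: continuous_intros)
  then show ?thesis using g0 by simp
qed

lemma starlike_primitive:
  assumes S: "convex S" "open S" "(0::complex) \<in> S" and f: "f holomorphic_on S" and z: "z \<in> S"
  shows "((\<lambda>x. contour_integral (linepath 0 x) f) has_field_derivative f z) (at z)"
proof (rule triangle_contour_integrals_starlike_primitive[where S = S])
  show "continuous_on S f" using f by (rule holomorphic_on_imp_continuous_on)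
  show "closed_segment 0 y \<subseteq> S" if "y \<in> S" for y
    using S that by (simp add: closed_segment_subset)
  show "contour_integral (linepath 0 b) f + contour_integral (linepath b c) f + contour_integral (linepath c 0) f = 0"
    if "closed_segment b c \<subseteq> S" for b c
  proof -
    have bc: "b \<in> S" "c \<in> S" using that by auto
    have "convex hull {0, b, c} \<subseteq> S" using S bc by (intro hull_minimal) auto
    then have "(f has_contour_integral 0) (linepath 0 b +++ linepath b c +++ linepath c 0)"
      using f by (intro Cauchy_theorem_triangle holomorphic_on_subset[OF f])
    then show ?thesis
      using has_chain_integral_chain_integral3 by blast
  qed
qed (use S z in auto)

text \<open>Where \<open>P\<close> does not vanish, the equation is (z^2 f' / P)' = z q f,
  integrated from its singular point 0. Taking the radial mean does not enlarge bounds, so the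
  singularity is harmless: on a compact convex set containing 0 the differences of the successive
  approximations are dominated by an exponential series, and they converge on the whole
  domain.\<close>

lemma singular_volterra:
  assumes S: "convex S" "open S" "(0::complex) \<in> S" and P: "P holomorphic_on S" and q: "q holomorphic_on S"
  obtains f where "f holomorphic_on S" "f 0 = c"
    "\<And>z. z \<in> S \<Longrightarrow> deriv f z = P z * radial_mean (\<lambda>s. q s * f s) z"
proof -
  have seg: "closed_segment 0 z \<subseteq> S" if "z \<in> S" for z
    using S that by (simp add: closed_segment_subset)
  define A where "A = (\<lambda>h z. P z * radial_mean (\<lambda>s. q s * h s) z)"
  have Ahol: "A h holomorphic_on S" if "h holomorphic_on S" for h
  proof -
    have "radial_mean (\<lambda>s. q s * h s) holomorphic_on S"
      using radial_mean_has_derivative[OF S(2) seg holomorphic_on_mult[OF q that]] S(2)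
      by (metis (no_types, lifting) holomorphic_on_open)
    then show ?thesis unfolding A_def using P by (intro holomorphic_intros)
  qed
  define F where "F = rec_nat (\<lambda>_. c) (\<lambda>_ h x. c + contour_integral (linepath 0 x) (A h))"
  have F0: "F 0 = (\<lambda>_. c)" and FS: "F (Suc n) = (\<lambda>x. c + contour_integral (linepath 0 x) (A (F n)))" for n
    by (simp_all add: F_def)
  have Fhol: "F n holomorphic_on S" and Fder: "z \<in> S \<Longrightarrow> (F (Suc n) has_field_derivative A (F n) z) (at z)" for n z
  proof -
    have D: "z \<in> S \<Longrightarrow> (F (Suc n) has_field_derivative A (F n) z) (at z)" if "F n holomorphic_on S" for n z
      unfolding FS using starlike_primitive[OF S Ahol[OF that]] by (auto intro!: derivative_eq_intros)
    show h: "F n holomorphic_on S" for n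
    proof (induction n)
      case (Suc n)
      then show ?case using D S(2) holomorphic_on_open by blast
    qed (simp add: F0)
    show "z \<in> S \<Longrightarrow> (F (Suc n) has_field_derivative A (F n) z) (at z)" for z n using D h by blast
  qed
  have Fz: "F n 0 = c" for n by (cases n) (simp_all add: F0 FS)
  define d where "d = (\<lambda>n z. F (Suc n) z - F n z)"
  have dhol: "d n holomorphic_on S" for n unfolding d_def using Fhol by (intro holomorphic_intros)
  have dder: "(d (Suc n) has_field_derivative P z * radial_mean (\<lambda>s. q s * d n s) z) (at z)" if z: "z \<in> S" for n z
  proof -
    have "radial_mean (\<lambda>s. q s * d n s) z = radial_mean (\<lambda>s. q s * F (Suc n) s) z - radial_mean (\<lambda>s. q s * F n s) z"
      unfolding d_def right_diff_distrib
      by (rule radial_mean_diff; rule continuous_on_subset[OF holomorphic_on_imp_continuous_on seg[OF z]])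
         (auto intro!: holomorphic_intros q Fhol)
    then have "P z * radial_mean (\<lambda>s. q s * d n s) z = A (F (Suc n)) z - A (F n) z"
      by (simp add: A_def right_diff_distrib)
    then show ?thesis unfolding d_def using Fder[OF z] by (auto intro!: derivative_eq_intros)
  qed
  define f where "f = (\<lambda>z. c + (\<Sum>n. d n z))"
  have conv: "uniform_limit C (\<lambda>n z. F n z) f sequentially"
    if C: "compact C" "convex C" "0 \<in> C" "C \<subseteq> S" for C
  proof -
    have bdd: "\<exists>B>0. \<forall>z\<in>C. norm (h z) \<le> B" if "h holomorphic_on S" for h :: "complex \<Rightarrow> complex"
      using compact_imp_bounded[OF compact_continuous_image[OF continuous_on_subset[OF holomorphic_on_imp_continuous_on[OF that] C(4)] C(1)]]
      by (auto simp: bounded_pos)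
    obtain K1 where K1: "0 < K1" "\<And>z. z \<in> C \<Longrightarrow> norm (P z) \<le> K1" using bdd[OF P] by blast
    obtain K2 where K2: "0 < K2" "\<And>z. z \<in> C \<Longrightarrow> norm (q z) \<le> K2" using bdd[OF q] by blast
    obtain B where B: "0 < B" "\<And>z. z \<in> C \<Longrightarrow> norm (d 0 z) \<le> B" using bdd[OF dhol] by blast
    obtain R where R: "0 < R" "\<And>z. z \<in> C \<Longrightarrow> norm z \<le> R" using bdd[of "\<lambda>z. z"] by (auto intro: holomorphic_intros)
    define K where "K = K1 * K2"
    have K: "0 < K" using K1 K2 by (simp add: K_def)
    have segC: "closed_segment 0 z \<subseteq> C" if "z \<in> C" for z
      using C that by (simp add: closed_segment_subset)
    have est: "norm (d n z) \<le> B * (K * norm z) ^ n / fact n" if "z \<in> C" for n z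
      using that
    proof (induction n arbitrary: z)
      case 0
      then show ?case using B by simp
    next
      case (Suc n)
      show ?case
      proof (rule radial_bound_integrate)
        fix u assume "u \<in> closed_segment 0 z"
        then have u: "u \<in> C" using segC[OF Suc.prems] by auto
        then show "(d (Suc n) has_field_derivative P u * radial_mean (\<lambda>s. q s * d n s) u) (at u)"
          using C dder by auto
        have "norm (radial_mean (\<lambda>s. q s * d n s) u) \<le> K2 * (B * (K * norm u) ^ n / fact n)"
        proof (rule radial_mean_bound)
          show "continuous_on (closed_segment 0 u) (\<lambda>s. q s * d n s)"
            using u C(4) by (intro continuous_on_subset[OF holomorphic_on_imp_continuous_on seg])
               (auto intro!: holomorphic_intros q dhol)
          fix v assume v: "v \<in> closed_segment 0 u"
          then have vC: "v \<in> C" using segC[OF u] by auto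
          have nv: "norm v \<le> norm u" using segment_bound1[OF v] by simp
          have "norm (d n v) \<le> B * (K * norm v) ^ n / fact n" by (rule Suc.IH[OF vC])
          also have "\<dots> \<le> B * (K * norm u) ^ n / fact n"
            using nv K B by (intro divide_right_mono mult_left_mono power_mono) auto
          finally show "norm (q v * d n v) \<le> K2 * (B * (K * norm u) ^ n / fact n)"
            unfolding norm_mult using K2 vC by (intro mult_mono) auto
        qed
        then have "norm (P u) * norm (radial_mean (\<lambda>s. q s * d n s) u) \<le> K1 * (K2 * (B * (K * norm u) ^ n / fact n))"
          using K1 u by (intro mult_mono) auto
        then show "norm (P u * radial_mean (\<lambda>s. q s * d n s) u) \<le> K * (B * (K * norm u) ^ n / fact n)"
          by (simp add: norm_mult K_def mult.assoc)
      next
        show "d (Suc n) 0 = 0" by (simp add: d_def Fz)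
      qed
    qed
    have "uniform_limit C (\<lambda>n z. \<Sum>i<n. d i z) (\<lambda>z. \<Sum>n. d n z) sequentially"
    proof (rule Weierstrass_m_test)
      show "norm (d n z) \<le> B * ((K * R) ^ n / fact n)" if "z \<in> C" for n z
      proof -
        have "norm (d n z) \<le> B * (K * norm z) ^ n / fact n" by (rule est[OF that])
        also have "\<dots> \<le> B * (K * R) ^ n / fact n"
          using K B R that by (intro divide_right_mono mult_left_mono power_mono) auto
        finally show ?thesis by simp
      qed
      show "summable (\<lambda>n. B * ((K * R) ^ n / fact n))"
        using summable_exp[of "K * R"] by (intro summable_mult) (simp add: field_simps)
    qed
    then have "uniform_limit C (\<lambda>n z. c + (\<Sum>i<n. d i z)) f sequentially"
      unfolding f_def by (intro uniform_limit_intros)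
    moreover have "c + (\<Sum>i<n. d i z) = F n z" for n z
      using sum_lessThan_telescope[of "\<lambda>i. F i z" n] by (simp add: d_def F0)
    ultimately show ?thesis by simp
  qed
  \<comment> \<open>The hull with 0 contains the segments from 0 to all points near
    \<open>z\<close>. The radial mean uses values on these segments, so uniform convergence on the
    hull allows the limit under the mean.\<close>
  have nbh: "\<exists>e>0. cball z e \<subseteq> S \<and> compact (convex hull insert 0 (cball z e)) \<and> convex hull insert 0 (cball z e) \<subseteq> S"
    if z: "z \<in> S" for z
  proof -
    obtain e where e: "0 < e" "cball z e \<subseteq> S" using S(2) z open_contains_cball by blast
    have "convex hull insert 0 (cball z e) \<subseteq> S" using S e by (intro hull_minimal) auto
    moreover have "compact (convex hull insert 0 (cball z e))" by (intro compact_convex_hull compact_insert compact_cball)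
    ultimately show ?thesis using e by blast
  qed
  have ul: "\<exists>e>0. cball z e \<subseteq> S \<and> uniform_limit (convex hull insert 0 (cball z e)) F f sequentially"
    if z: "z \<in> S" for z
  proof -
    obtain e where e: "0 < e" "cball z e \<subseteq> S" "compact (convex hull insert 0 (cball z e))"
      "convex hull insert 0 (cball z e) \<subseteq> S" using nbh[OF z] by blast
    have "uniform_limit (convex hull insert 0 (cball z e)) F f sequentially"
      using conv[OF e(3) _ _ e(4)] by (simp add: hull_inc)
    then show ?thesis using e by blast
  qed
  have fhol: "f holomorphic_on S"
  proof (rule holomorphic_uniform_sequence[OF S(2) Fhol])
    fix x assume "x \<in> S"
    from ul[OF this] show "\<exists>d>0. cball x d \<subseteq> S \<and> uniform_limit (cball x d) F f sequentially"
      by (metis hull_subset insert_subset uniform_limit_on_subset)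
  qed
  have "deriv f z = P z * radial_mean (\<lambda>s. q s * f s) z" if z: "z \<in> S" for z
  proof -
    obtain e where e: "0 < e" "cball z e \<subseteq> S" "uniform_limit (convex hull insert 0 (cball z e)) F f sequentially"
      using ul[OF z] by blast
    have segz: "closed_segment 0 z \<subseteq> convex hull insert 0 (cball z e)"
      using e(1) by (intro closed_segment_subset) (auto simp: hull_inc)
    have u1: "uniform_limit (closed_segment 0 z) F f sequentially"
      by (rule uniform_limit_on_subset[OF e(3) segz])
    have u2: "uniform_limit (ball z e) F f sequentially"
      by (rule uniform_limit_on_subset[OF e(3)]) (auto intro: hull_inc)
    have l1: "(\<lambda>n. deriv (F n) z) \<longlonglongrightarrow> deriv f z"
      using higher_deriv_complex_uniform_limit[OF u2 always_eventually, of z 1] e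
        holomorphic_on_subset[OF Fhol, of "ball z e"] ball_subset_cball[of z e] by auto
    then have l1': "(\<lambda>n. deriv (F (Suc n)) z) \<longlonglongrightarrow> deriv f z" by (rule LIMSEQ_Suc)
    have cq: "continuous_on (closed_segment 0 z) q" "continuous_on (closed_segment 0 z) (F n)" "continuous_on (closed_segment 0 z) f" for n
      using q Fhol fhol by (auto intro!: continuous_on_subset[OF holomorphic_on_imp_continuous_on seg[OF z]])
    obtain K where K: "0 < K" "\<And>u. u \<in> closed_segment 0 z \<Longrightarrow> norm (q u) \<le> K"
      using compact_imp_bounded[OF compact_continuous_image[OF cq(1) compact_segment]] by (auto simp: bounded_pos)
    have l2: "(\<lambda>n. radial_mean (\<lambda>s. q s * F n s) z) \<longlonglongrightarrow> radial_mean (\<lambda>s. q s * f s) z"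
    proof (rule metric_LIMSEQ_I)
      fix \<epsilon> :: real assume \<epsilon>: "0 < \<epsilon>"
      from uniform_limitD[OF u1, of "\<epsilon> / (2 * K)"] \<epsilon> K(1) obtain n0
        where n0: "\<And>n u. n \<ge> n0 \<Longrightarrow> u \<in> closed_segment 0 z \<Longrightarrow> dist (F n u) (f u) < \<epsilon> / (2 * K)"
        by (auto simp: eventually_sequentially)
      have "dist (radial_mean (\<lambda>s. q s * F n s) z) (radial_mean (\<lambda>s. q s * f s) z) < \<epsilon>" if n: "n \<ge> n0" for n
      proof -
        have "norm (radial_mean (\<lambda>s. q s * F n s - q s * f s) z) \<le> K * (\<epsilon> / (2 * K))"
        proof (rule radial_mean_bound)
          fix u assume u: "u \<in> closed_segment 0 z"
          have "norm (q u) * norm (F n u - f u) \<le> K * (\<epsilon> / (2 * K))"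
            using K u n0[OF n u] by (intro mult_mono) (auto simp: dist_norm)
          then show "norm (q u * F n u - q u * f u) \<le> K * (\<epsilon> / (2 * K))"
            by (simp add: norm_mult flip: right_diff_distrib)
        qed (intro continuous_intros cq)
        also have "K * (\<epsilon> / (2 * K)) < \<epsilon>" using K \<epsilon> by simp
        finally show ?thesis
          by (subst (asm) radial_mean_diff) (auto intro!: continuous_intros cq simp: dist_norm)
      qed
      then show "\<exists>no. \<forall>n\<ge>no. dist (radial_mean (\<lambda>s. q s * F n s) z) (radial_mean (\<lambda>s. q s * f s) z) < \<epsilon>"
        by blast
    qed
    have "deriv (F (Suc n)) z = P z * radial_mean (\<lambda>s. q s * F n s) z" for n
      using DERIV_imp_deriv[OF Fder[OF z]] by (simp add: A_def)
    with l1' have "(\<lambda>n. P z * radial_mean (\<lambda>s. q s * F n s) z) \<longlonglongrightarrow> deriv f z" by simp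
    then show ?thesis using LIMSEQ_unique tendsto_mult[OF tendsto_const l2] by blast
  qed
  moreover have "f 0 = c" by (simp add: f_def d_def Fz)
  ultimately show ?thesis using that fhol by blast
qed

lemma DERIV_compose_affine:
  fixes f :: "complex \<Rightarrow> complex"
  assumes "(f has_field_derivative D) (at (b + c * (u - a)))"
  shows "((\<lambda>u. f (b + c * (u - a))) has_field_derivative c * D) (at u)"
proof -
  have "((\<lambda>u. b + c * (u - a)) has_field_derivative c) (at u)"
    by (auto intro!: derivative_eq_intros)
  from DERIV_chain2[OF assms this] show ?thesis by (simp add: mult.commute)
qed

section \<open>Convolution in the complex plane\<close>

text \<open>The integral of f(y - s) g(s) from a to y along the segment s = a + r (y - a). The fixed
  interval of integration allows differentiation under the integral sign.\<close>

definition conv :: "complex \<Rightarrow> (complex \<Rightarrow> complex) \<Rightarrow> (complex \<Rightarrow> complex) \<Rightarrow> complex \<Rightarrow> complex" where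
  "conv a f g y = (y - a) *
     integral {0..1} (\<lambda>r. f (of_real (1 - r) * (y - a)) * g (a + of_real r * (y - a)))"

text \<open>The condition on \<open>Y\<close> leaves out \<open>r = 0\<close>, because the base
  point may be a boundary point at which the second factor is merely continuous. The condition on
  \<open>S\<close> includes it, because the kernel is evaluated at 0 when s = y.\<close>

definition conv_domain :: "complex set \<Rightarrow> complex \<Rightarrow> complex set \<Rightarrow> bool" where
  "conv_domain S a Y \<longleftrightarrow> open S \<and> open Y \<and>
     (\<forall>y\<in>Y. \<forall>r::real. 0 < r \<longrightarrow> r \<le> 1 \<longrightarrow> a + of_real r * (y - a) \<in> Y) \<and>
     (\<forall>y\<in>Y. \<forall>r::real. 0 \<le> r \<longrightarrow> r \<le> 1 \<longrightarrow> of_real r * (y - a) \<in> S)"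

lemma conv_domain_segment:
  assumes "conv_domain S a Y" "y \<in> Y" "0 \<le> r" "r \<le> 1"
  shows "a + of_real r * (y - a) \<in> insert a Y" "of_real (1 - r) * (y - a) \<in> S"
    "0 < r \<Longrightarrow> a + of_real r * (y - a) \<in> Y"
proof -
  have Y: "0 < r \<Longrightarrow> a + of_real r * (y - a) \<in> Y" and S: "of_real (1 - r) * (y - a) \<in> S"
    using assms unfolding conv_domain_def by (simp_all only: diff_ge_0_iff_ge)
  show "0 < r \<Longrightarrow> a + of_real r * (y - a) \<in> Y" by (rule Y)
  show "of_real (1 - r) * (y - a) \<in> S" by (rule S)
  show "a + of_real r * (y - a) \<in> insert a Y"
    using Y assms(3) by (cases "r = 0") simp_all
qed

lemma conv_domain_open: "conv_domain S a Y \<Longrightarrow> open S" "conv_domain S a Y \<Longrightarrow> open Y"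
  unfolding conv_domain_def by (rule conjunct1, assumption) (rule conjunct1, rule conjunct2, assumption)

lemma conv_integrand_continuous:
  fixes f g :: "complex \<Rightarrow> complex"
  assumes D: "conv_domain S a Y" and f: "continuous_on S f" and g: "continuous_on (insert a Y) g" and y: "y \<in> Y"
  shows "continuous_on {0..1} (\<lambda>r::real. f (of_real (1 - r) * (y - a)) * g (a + of_real r * (y - a)))"
proof -
  have i1: "(\<lambda>r::real. of_real (1 - r) * (y - a)) ` {0..1} \<subseteq> S"
    by (intro image_subsetI conv_domain_segment(2)[OF D y]) auto
  have i2: "(\<lambda>r::real. a + of_real r * (y - a)) ` {0..1} \<subseteq> insert a Y"
    by (intro image_subsetI conv_domain_segment(1)[OF D y]) auto
  show ?thesis
    by (intro continuous_on_mult continuous_on_compose2[OF f _ i1] continuous_on_compose2[OF g _ i2] continuous_intros)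
qed

lemma conv_integrable:
  fixes f g :: "complex \<Rightarrow> complex"
  assumes "conv_domain S a Y" "continuous_on S f" "continuous_on (insert a Y) g" "y \<in> Y"
  shows "(\<lambda>r::real. f (of_real (1 - r) * (y - a)) * g (a + of_real r * (y - a))) integrable_on {0..1}"
  by (intro integrable_continuous_interval conv_integrand_continuous[OF assms])

lemma conv_has_integral:
  assumes "conv_domain S a Y" "continuous_on S f" "continuous_on (insert a Y) g" "y \<in> Y"
  shows "((\<lambda>r. (y - a) * (f (of_real (1 - r) * (y - a)) * g (a + of_real r * (y - a)))) has_integral conv a f g y) {0..1}"
  unfolding conv_def by (intro has_integral_mult_right integrable_integral conv_integrable[OF assms])

lemma conv_cong:
  assumes "conv_domain S a Y" "y \<in> Y" "\<And>s. s \<in> S \<Longrightarrow> f s = f' s" "\<And>s. s \<in> insert a Y \<Longrightarrow> g s = g' s"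
  shows "conv a f g y = conv a f' g' y"
proof -
  have "f (of_real (1 - r) * (y - a)) * g (a + of_real r * (y - a)) =
      f' (of_real (1 - r) * (y - a)) * g' (a + of_real r * (y - a))" if "r \<in> {0..1}" for r :: real
  proof -
    have r: "0 \<le> r" "r \<le> 1" using that by simp_all
    show ?thesis
      by (rule arg_cong2[of _ _ _ _ "(*)"], rule assms(3), rule conv_domain_segment(2)[OF assms(1,2) r],
          rule assms(4), rule conv_domain_segment(1)[OF assms(1,2) r])
  qed
  then show ?thesis unfolding conv_def by (rule arg_cong[OF integral_cong])
qed

lemma conv_linear_left:
  assumes "conv_domain S a Y" "continuous_on S f" "continuous_on S h" "continuous_on (insert a Y) g" "y \<in> Y"
  shows "conv a (\<lambda>s. c * f s + d * h s) g y = c * conv a f g y + d * conv a h g y"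
proof -
  have cfh: "continuous_on S (\<lambda>s. c * f s + d * h s)" by (intro continuous_intros assms(2,3))
  have 1: "((\<lambda>r. c * ((y - a) * (f (of_real (1 - r) * (y - a)) * g (a + of_real r * (y - a)))) +
         d * ((y - a) * (h (of_real (1 - r) * (y - a)) * g (a + of_real r * (y - a)))))
      has_integral c * conv a f g y + d * conv a h g y) {0..1}"
    by (intro has_integral_add has_integral_mult_right conv_has_integral[OF assms(1,2,4,5)] conv_has_integral[OF assms(1,3,4,5)])
  have 2: "((\<lambda>r. (y - a) * ((c * f (of_real (1 - r) * (y - a)) + d * h (of_real (1 - r) * (y - a))) * g (a + of_real r * (y - a))))
      has_integral conv a (\<lambda>s. c * f s + d * h s) g y) {0..1}"
    by (rule conv_has_integral[OF assms(1) cfh assms(4,5)])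
  have 3: "(\<lambda>r. c * ((y - a) * (f (of_real (1 - r) * (y - a)) * g (a + of_real r * (y - a)))) +
         d * ((y - a) * (h (of_real (1 - r) * (y - a)) * g (a + of_real r * (y - a))))) =
      (\<lambda>r. (y - a) * ((c * f (of_real (1 - r) * (y - a)) + d * h (of_real (1 - r) * (y - a))) * g (a + of_real r * (y - a))))"
  proof
    fix r :: real
    have "c * (D * (F * G)) + d * (D * (H * G)) = D * ((c * F + d * H) * G)" for D F G H :: complex
      by (simp add: algebra_simps)
    then show "c * ((y - a) * (f (of_real (1 - r) * (y - a)) * g (a + of_real r * (y - a)))) +
         d * ((y - a) * (h (of_real (1 - r) * (y - a)) * g (a + of_real r * (y - a)))) =
      (y - a) * ((c * f (of_real (1 - r) * (y - a)) + d * h (of_real (1 - r) * (y - a))) * g (a + of_real r * (y - a)))" .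
  qed
  show ?thesis using has_integral_unique[OF 2 1[unfolded 3]] .
qed

lemma conv_sum_right:
  assumes "conv_domain S a Y" "continuous_on S f" "y \<in> Y"
    "\<And>i. i \<in> I \<Longrightarrow> continuous_on (insert a Y) (g i)"
  shows "conv a f (\<lambda>s. \<Sum>i\<in>I. c i * g i s) y = (\<Sum>i\<in>I. c i * conv a f (g i) y)"
proof -
  have "integral {0..1} (\<lambda>r::real. f (of_real (1 - r) * (y - a)) * (\<Sum>i\<in>I. c i * g i (a + of_real r * (y - a)))) =
     integral {0..1} (\<lambda>r::real. \<Sum>i\<in>I. c i * (f (of_real (1 - r) * (y - a)) * g i (a + of_real r * (y - a))))"
    by (intro integral_cong) (simp add: sum_distrib_left mult_ac)
  also have "\<dots> = (\<Sum>i\<in>I. integral {0..1} (\<lambda>r::real. c i * (f (of_real (1 - r) * (y - a)) * g i (a + of_real r * (y - a)))))"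
  proof (cases "finite I")
    case True
    then show ?thesis
      by (rule integral_sum) (rule integrable_on_mult_right, rule conv_integrable[OF assms(1,2,4,3)])
  qed simp
  also have "\<dots> = (\<Sum>i\<in>I. c i * integral {0..1} (\<lambda>r::real. f (of_real (1 - r) * (y - a)) * g i (a + of_real r * (y - a))))"
    by (simp only: integral_mult_right)
  finally have eq: "integral {0..1} (\<lambda>r::real. f (of_real (1 - r) * (y - a)) * (\<Sum>i\<in>I. c i * g i (a + of_real r * (y - a)))) =
     (\<Sum>i\<in>I. c i * integral {0..1} (\<lambda>r::real. f (of_real (1 - r) * (y - a)) * g i (a + of_real r * (y - a))))" .
  show ?thesis unfolding conv_def eq
    by (subst sum_distrib_left) (rule sum.cong, simp_all only: mult.left_commute)
qed

text \<open>The arguments of the two factors always add up to \<open>y\<close>.\<close>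

lemma exp_conv: "exp y * conv a f g y = conv a (\<lambda>s. exp s * f s) (\<lambda>s. exp s * g s) y"
proof -
  let ?I = "\<lambda>r::real. f (of_real (1 - r) * (y - a)) * g (a + of_real r * (y - a))"
  have eq: "exp y * ?I r = exp (of_real (1 - r) * (y - a)) * f (of_real (1 - r) * (y - a)) *
      (exp (a + of_real r * (y - a)) * g (a + of_real r * (y - a)))" for r :: real
  proof -
    have "of_real (1 - r) * (y - a) + (a + of_real r * (y - a)) = y" by (simp add: algebra_simps)
    from arg_cong[OF this, of exp]
    have e: "exp y = exp (of_real (1 - r) * (y - a)) * exp (a + of_real r * (y - a))"
      by (simp only: exp_add)
    have "E1 * E2 * (F * G) = E1 * F * (E2 * G)" for E1 E2 F G :: complex
      by (simp add: mult_ac)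
    then show ?thesis by (subst e)
  qed
  have i1: "exp y * integral {0..1} ?I = integral {0..1} (\<lambda>r. exp y * ?I r)"
    by (rule integral_mult_right[symmetric])
  have i2: "integral {0..1} (\<lambda>r. exp y * ?I r) = integral {0..1} (\<lambda>r. exp (of_real (1 - r) * (y - a)) * f (of_real (1 - r) * (y - a)) *
      (exp (a + of_real r * (y - a)) * g (a + of_real r * (y - a))))"
    by (rule integral_cong) (rule eq)
  have "exp y * ((y - a) * J) = (y - a) * J'" if "exp y * J = J'" for J J'
    unfolding that[symmetric] by (rule mult.left_commute)
  from this[OF trans[OF i1 i2]] show ?thesis unfolding conv_def .
qed

text \<open>Differentiation under the integral sign produces a term with \<open>g1\<close>, which
  integration by parts moves back to the kernel. The second claim is the integration by parts
  itself; its boundary term at \<open>a\<close> disappears for functions vanishing there.\<close>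

lemma conv_derivative:
  assumes D: "conv_domain S a Y" and f: "f holomorphic_on S" and g: "continuous_on (insert a Y) g"
    and g1: "continuous_on (insert a Y) g1" and gd: "\<And>y. y \<in> Y \<Longrightarrow> (g has_field_derivative g1 y) (at y)"
    and y: "y \<in> Y"
  shows "(conv a f g has_field_derivative f 0 * g y + conv a (deriv f) g y) (at y)"
    and "conv a (deriv f) g y + f 0 * g y = conv a f g1 y + f (y - a) * g a"
proof -
  note op = conv_domain_open[OF D] and [simp del] = of_real_diff
  have cf: "continuous_on S f" "continuous_on S (deriv f)"
    using f op by (auto intro!: holomorphic_on_imp_continuous_on holomorphic_intros)
  have fd: "(f has_field_derivative deriv f u) (at u)" if "u \<in> S" for u
    using f op that by (auto intro: holomorphic_derivI)
  obtain e where e: "0 < e" "ball y e \<subseteq> Y" using openE[OF op(2) y] by blast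
  let ?f = "\<lambda>u r. f (of_real (1 - r) * (u - a))" and ?f' = "\<lambda>u r. deriv f (of_real (1 - r) * (u - a))"
  let ?g = "\<lambda>u r. g (a + of_real r * (u - a))" and ?g1 = "\<lambda>u r. g1 (a + of_real r * (u - a))"
  note seg = conv_domain_segment[OF D]
  have L: "((\<lambda>u. integral (cbox 0 1) (\<lambda>r. ?f u r * ?g u r)) has_field_derivative
      integral (cbox 0 1) (\<lambda>r. of_real (1 - r) * ?f' y r * ?g y r + ?f y r * (of_real r * ?g1 y r))) (at y within ball y e)"
  proof (rule leibniz_rule_field_derivative[where U = "ball y e"
      and fx = "\<lambda>u r. of_real (1 - r) * ?f' u r * ?g u r + ?f u r * (of_real r * ?g1 u r)"])
    fix u and r :: real assume u: "u \<in> ball y e" "r \<in> cbox 0 1"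
    then have uY: "u \<in> Y" using e by auto
    have r: "0 \<le> r" "r \<le> 1" using u by auto
    have 1: "((\<lambda>u. ?f u r) has_field_derivative of_real (1 - r) * ?f' u r) (at u)"
      by (rule DERIV_compose_affine[of f "?f' u r" 0 "of_real (1 - r)" u a, unfolded add_0_left, OF fd[OF seg(2)[OF uY r]]])
    have 2: "((\<lambda>u. ?g u r) has_field_derivative of_real r * ?g1 u r) (at u)"
    \<comment> \<open>For \<open>r = 0\<close> the argument is constantly \<open>a\<close>, where
      \<open>g\<close> need not be differentiable; the claimed derivative is 0 there because of the
      factor \<open>r\<close>.\<close>
    proof (cases "r = 0")
      case False
      with r have "0 < r" by simp
      show ?thesis
        by (rule DERIV_compose_affine[OF gd[OF seg(3)[OF uY r \<open>0 < r\<close>]]])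
    qed simp
    show "((\<lambda>u. ?f u r * ?g u r) has_field_derivative
        of_real (1 - r) * ?f' u r * ?g u r + ?f u r * (of_real r * ?g1 u r)) (at u within ball y e)"
      by (rule has_field_derivative_at_within, rule DERIV_cong[OF DERIV_mult'[OF 1 2]]) (simp only: add.commute)
  next
    fix u assume "u \<in> ball y e"
    then show "(\<lambda>r. ?f u r * ?g u r) integrable_on cbox 0 1"
      using conv_integrable[OF D cf(1) g, of u] e by auto
  next
    have i1: "(\<lambda>p. of_real (1 - snd p) * (fst p - a)) ` (ball y e \<times> {0..1}) \<subseteq> S"
      by (intro image_subsetI seg) (use e in auto)
    have i2: "(\<lambda>p. a + of_real (snd p) * (fst p - a)) ` (ball y e \<times> {0..1}) \<subseteq> insert a Y"
      by (intro image_subsetI seg) (use e in auto)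
    have "continuous_on (ball y e \<times> {0..1}) (\<lambda>p. h (of_real (1 - snd p) * (fst p - a)))"
      if "continuous_on S h" for h :: "complex \<Rightarrow> complex"
      by (intro continuous_on_compose2[OF that _ i1] continuous_intros)
    moreover have "continuous_on (ball y e \<times> {0..1}) (\<lambda>p. h (a + of_real (snd p) * (fst p - a)))"
      if "continuous_on (insert a Y) h" for h :: "complex \<Rightarrow> complex"
      by (intro continuous_on_compose2[OF that _ i2] continuous_intros)
    ultimately show "continuous_on (ball y e \<times> cbox 0 1) (\<lambda>(u, r). of_real (1 - r) * ?f' u r * ?g u r + ?f u r * (of_real r * ?g1 u r))"
      unfolding split_beta box_real using cf g g1 by (intro continuous_intros) auto
  qed (use e in auto)
  define I1 where "I1 = integral {0..1} (\<lambda>r. of_real (1 - r) * ?f' y r * ?g y r + ?f y r * (of_real r * ?g1 y r))"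
  have L': "((\<lambda>u. integral {0..1} (\<lambda>r. ?f u r * ?g u r)) has_field_derivative I1) (at y)"
  proof -
    have "at y within ball y e = at y" using e by (intro at_within_open) auto
    then show ?thesis using L unfolding I1_def box_real by metis
  qed
  have cderiv: "(conv a f g has_field_derivative integral {0..1} (\<lambda>r. ?f y r * ?g y r) + (y - a) * I1) (at y)"
  proof -
    have "((\<lambda>u. u - a) has_field_derivative 1) (at y)" by (auto intro!: derivative_eq_intros)
    from DERIV_mult'[OF this L'] show ?thesis
      unfolding conv_def[abs_def] by (rule DERIV_cong) (simp only: mult_1 add.commute)
  qed
  have i1: "(\<lambda>r::real. of_real (1 - r) * (y - a)) ` {0..1} \<subseteq> S" and
    i2: "(\<lambda>r::real. a + of_real r * (y - a)) ` {0..1} \<subseteq> insert a Y"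
    by (intro image_subsetI seg(1)[OF y] seg(2)[OF y]; simp)+
  have cI: "continuous_on {0..1} (\<lambda>r::real. h (of_real (1 - r) * (y - a)))" if "continuous_on S h" for h :: "complex \<Rightarrow> complex"
    by (intro continuous_on_compose2[OF that _ i1] continuous_intros)
  have cJ: "continuous_on {0..1} (\<lambda>r::real. h (a + of_real r * (y - a)))" if "continuous_on (insert a Y) h" for h :: "complex \<Rightarrow> complex"
    by (intro continuous_on_compose2[OF that _ i2] continuous_intros)
  note cc = cI[OF cf(1)] cI[OF cf(2)] cJ[OF g] cJ[OF g1]
  have hI1: "((\<lambda>r. of_real (1 - r) * ?f' y r * ?g y r + ?f y r * (of_real r * ?g1 y r)) has_integral I1) {0..1}"
    unfolding I1_def by (intro integrable_integral integrable_continuous_interval continuous_intros cc)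
  have hfg: "((\<lambda>r. ?f y r * ?g y r) has_integral integral {0..1} (\<lambda>r. ?f y r * ?g y r)) {0..1}"
    by (intro integrable_integral integrable_continuous_interval continuous_intros cc)
  note hf'g = conv_has_integral[OF D cf(2) g y] and hfg1 = conv_has_integral[OF D cf(1) g1 y]
  have vd: "((\<lambda>r. ?f y r * ?g y r) has_vector_derivative - (y - a) * ?f' y r * ?g y r + ?f y r * ((y - a) * ?g1 y r)) (at r)"
    if r: "r \<in> {0<..<1}" for r
  proof -
    have 1: "((\<lambda>s. f ((1 - s) * (y - a))) has_field_derivative - (y - a) * ?f' y r) (at (of_real r))"
    proof -
      have *: "(1 - s) * (y - a) = (y - a) + (- (y - a)) * (s - 0)" for s :: complex by (simp add: algebra_simps)
      have "(f has_field_derivative ?f' y r) (at ((y - a) + (- (y - a)) * (of_real r - 0)))"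
        by (subst *[symmetric]) (use fd[OF seg(2)[OF y, of r]] r in \<open>simp add: of_real_diff\<close>)
      from DERIV_compose_affine[OF this] show ?thesis by (simp only: *)
    qed
    have 2: "((\<lambda>s. g (a + s * (y - a))) has_field_derivative (y - a) * ?g1 y r) (at (of_real r))"
      using DERIV_compose_affine[of g "?g1 y r" a "y - a" "of_real r" 0] gd[OF seg(3)[OF y, of r]] r
      by (simp add: mult.commute)
    from has_vector_derivative_real_field[OF DERIV_mult'[OF 1 2]]
    show ?thesis by (simp add: add.commute of_real_diff)
  qed
  have J1: "((\<lambda>r. - (y - a) * ?f' y r * ?g y r + ?f y r * ((y - a) * ?g1 y r)) has_integral
      ?f y 1 * ?g y 1 - ?f y 0 * ?g y 0) {0..1}"
    by (rule fundamental_theorem_of_calculus_interior) (simp, intro continuous_intros cc, rule vd)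
  \<comment> \<open>The primitive weighted by \<open>r\<close> absorbs the weights \<open>r\<close>
    and \<open>1 - r\<close> that the dilation of the segment brings into the Leibniz
    derivative.\<close>
  have J2: "((\<lambda>r. ?f y r * ?g y r + of_real r * (- (y - a) * ?f' y r * ?g y r + ?f y r * ((y - a) * ?g1 y r))) has_integral
      of_real 1 * (?f y 1 * ?g y 1) - of_real 0 * (?f y 0 * ?g y 0)) {0..1}"
  proof (rule fundamental_theorem_of_calculus_interior)
    fix r :: real assume r: "r \<in> {0<..<1}"
    have "((\<lambda>r. of_real r :: complex) has_vector_derivative 1) (at r)"
      by (auto intro!: derivative_eq_intros)
    from has_vector_derivative_mult[OF this vd[OF r]]
    show "((\<lambda>r. of_real r * (?f y r * ?g y r)) has_vector_derivative
        ?f y r * ?g y r + of_real r * (- (y - a) * ?f' y r * ?g y r + ?f y r * ((y - a) * ?g1 y r))) (at r)"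
      by (simp add: add.commute)
  qed (simp, intro continuous_intros cc)
  show "conv a (deriv f) g y + f 0 * g y = conv a f g1 y + f (y - a) * g a"
  proof -
    have "((\<lambda>r. (y - a) * (?f y r * ?g1 y r) - (y - a) * (?f' y r * ?g y r)) has_integral
        conv a f g1 y - conv a (deriv f) g y) {0..1}"
      by (intro has_integral_diff hfg1 hf'g)
    moreover have "(\<lambda>r. (y - a) * (?f y r * ?g1 y r) - (y - a) * (?f' y r * ?g y r)) =
        (\<lambda>r. - (y - a) * ?f' y r * ?g y r + ?f y r * ((y - a) * ?g1 y r))"
    proof
      fix r :: real
      have "d * (F * G1) - d * (F' * G) = - d * F' * G + F * (d * G1)" for F G d F' G1 :: complex
        by (simp add: algebra_simps)
      then show "(y - a) * (?f y r * ?g1 y r) - (y - a) * (?f' y r * ?g y r) = - (y - a) * ?f' y r * ?g y r + ?f y r * ((y - a) * ?g1 y r)" .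
    qed
    ultimately have "conv a f g1 y - conv a (deriv f) g y = ?f y 1 * ?g y 1 - ?f y 0 * ?g y 0"
      using has_integral_unique[OF _ J1] by simp
    then show ?thesis by (simp add: algebra_simps)
  qed
  have "((\<lambda>r. (?f y r * ?g y r + of_real r * (- (y - a) * ?f' y r * ?g y r + ?f y r * ((y - a) * ?g1 y r))) +
      (y - a) * (?f' y r * ?g y r)) has_integral f 0 * g y + conv a (deriv f) g y) {0..1}"
    using has_integral_add[OF J2 hf'g] by simp
  moreover have "((\<lambda>r. ?f y r * ?g y r + (y - a) * (of_real (1 - r) * ?f' y r * ?g y r + ?f y r * (of_real r * ?g1 y r)))
      has_integral integral {0..1} (\<lambda>r. ?f y r * ?g y r) + (y - a) * I1) {0..1}"
    by (intro has_integral_add has_integral_mult_right hfg hI1)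
  moreover have "(\<lambda>r. (?f y r * ?g y r + of_real r * (- (y - a) * ?f' y r * ?g y r + ?f y r * ((y - a) * ?g1 y r))) + (y - a) * (?f' y r * ?g y r)) =
     (\<lambda>r. ?f y r * ?g y r + (y - a) * (of_real (1 - r) * ?f' y r * ?g y r + ?f y r * (of_real r * ?g1 y r)))"
  proof
    fix r :: real
    have "F * G + R * (- d * F' * G + F * (d * G1)) + d * (F' * G) = F * G + d * ((1 - R) * F' * G + F * (R * G1))"
      for F G R d F' G1 :: complex by (simp add: algebra_simps)
    from this[of "?f y r" "?g y r" "of_real r" "y - a" "?f' y r" "?g1 y r"]
    show "(?f y r * ?g y r + of_real r * (- (y - a) * ?f' y r * ?g y r + ?f y r * ((y - a) * ?g1 y r))) + (y - a) * (?f' y r * ?g y r) =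
     ?f y r * ?g y r + (y - a) * (of_real (1 - r) * ?f' y r * ?g y r + ?f y r * (of_real r * ?g1 y r))"
      by (simp only: of_real_diff of_real_1)
  qed
  ultimately have "integral {0..1} (\<lambda>r. ?f y r * ?g y r) + (y - a) * I1 = f 0 * g y + conv a (deriv f) g y"
    by (simp only:) (rule has_integral_unique)
  with cderiv show "(conv a f g has_field_derivative f 0 * g y + conv a (deriv f) g y) (at y)" by simp
qed

section \<open>The transmutation kernel\<close>

lemma exp_minus_one_factor:
  obtains E where "E holomorphic_on UNIV" "\<And>t. 1 - exp (- t) = t * E t" "E 0 = (1::complex)"
proof
  let ?E = "\<lambda>t. if t = 0 then deriv (\<lambda>t. 1 - exp (- t)) 0 else (1 - exp (- t) - (1 - exp (- 0))) / (t - 0) :: complex"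
  show "?E holomorphic_on UNIV"
    by (rule pole_theorem_open_0[where a = 0 and g = "\<lambda>t. 1 - exp (- t)"]) (auto intro!: holomorphic_intros)
  have "((\<lambda>t. 1 - exp (- t)) has_field_derivative 1) (at (0::complex))"
    by (auto intro!: derivative_eq_intros)
  then show "?E 0 = 1" by (simp add: DERIV_imp_deriv)
  show "1 - exp (- t) = t * ?E t" for t by auto
qed

text \<open>
  With \<open>p t = (1 - exp (- t))\<^sup>2 exp (- (\<rho>\<^sub>1 + \<rho>\<^sub>2) t)\<close> the differential equation takes the form
  \<open>(p k')' = (1 - exp (- t)) exp (- (\<rho>\<^sub>1 + \<rho>\<^sub>2 + 1) t) ((\<rho>\<^sub>1 + 1) (\<rho>\<^sub>2 + 1) + (\<rho>\<^sub>1 + \<rho>\<^sub>2 + 1) exp t) k\<close>, which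
  is integrated from the singular point \<open>0\<close>. The strip contains no other zero of \<open>1 - exp (- t)\<close>.
\<close>
lemma transmutation_kernel:
  fixes \<rho>\<^sub>1 \<rho>\<^sub>2 :: complex
  defines "S \<equiv> {t. \<bar>Im t\<bar> < 2 * pi}"
  obtains k where "k holomorphic_on S" "k 0 = (\<rho>\<^sub>1 + 1) * (\<rho>\<^sub>2 + 1)"
    "\<And>t. t \<in> S \<Longrightarrow> (exp t - 1) * deriv (deriv k) t =
        (exp t * (\<rho>\<^sub>1 + \<rho>\<^sub>2) - (\<rho>\<^sub>1 + \<rho>\<^sub>2 + 2)) * deriv k t +
        ((\<rho>\<^sub>1 + 1) * (\<rho>\<^sub>2 + 1) + (\<rho>\<^sub>1 + \<rho>\<^sub>2 + 1) * exp t) * k t"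
proof -
  define \<sigma> where "\<sigma> = \<rho>\<^sub>1 + \<rho>\<^sub>2"
  define c where "c = (\<rho>\<^sub>1 + 1) * (\<rho>\<^sub>2 + 1)"
  have S_eq: "S = {t. Im t < 2 * pi} \<inter> {t. Im t > - (2 * pi)}" by (auto simp: S_def)
  have S: "convex S" "open S" "0 \<in> S"
    unfolding S_eq by (auto intro!: convex_Int convex_halfspace_Im_lt convex_halfspace_Im_gt
        open_Int open_halfspace_Im_lt open_halfspace_Im_gt)
  obtain E where E: "E holomorphic_on UNIV" "\<And>t. 1 - exp (- t) = t * E t" "E 0 = (1::complex)"
    using exp_minus_one_factor by metis
  \<comment> \<open>The zeros of \<open>E\<close> are the nonzero integer multiples of 2 pi i, which
    the strip excludes.\<close>
  have Enz: "E t \<noteq> 0" if "t \<in> S" for t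
  proof
    assume 0: "E t = 0"
    then have "exp (- t) = 1" using E(2)[of t] by simp
    then obtain n :: int where n: "Re (- t) = 0" "Im (- t) = of_int (2 * n) * pi"
      unfolding exp_eq_1 by blast
    have "\<bar>of_int (2 * n) * pi\<bar> < 2 * pi" using that n by (simp add: S_def)
    then have "\<bar>real_of_int n\<bar> < 1" by (simp add: abs_mult)
    then have "n = 0" by linarith
    then have "t = 0" using n by (simp add: complex_eq_iff)
    then show False using 0 E(3) by simp
  qed
  have Ed: "(E has_field_derivative deriv E t) (at t)" for t
    using E(1) by (auto intro: holomorphic_derivI)
  have Ed_eq: "E t + t * deriv E t = exp (- t)" for t
  proof -
    have "((\<lambda>t. t * E t) has_field_derivative E t + t * deriv E t) (at t)"
      by (auto intro!: derivative_eq_intros Ed)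
    moreover have "((\<lambda>t. 1 - exp (- t)) has_field_derivative exp (- t)) (at t)"
      by (auto intro!: derivative_eq_intros)
    ultimately show ?thesis using DERIV_unique E(2) by (metis (no_types, lifting) ext)
  qed
  have holE: "E holomorphic_on S" using E(1) by (rule holomorphic_on_subset) auto
  \<comment> \<open>Since 1 - exp(-t) = t E(t), the self-adjoint form of the equation reads (t^2 k'
    / P)' = t q k. Its integral from 0 is k' = P times the radial mean of q k.\<close>
  define P where "P = (\<lambda>t. exp (\<sigma> * t) / (E t)\<^sup>2)"
  define q where "q = (\<lambda>t. E t * exp (- t) * exp (- \<sigma> * t) * (c + (\<sigma> + 1) * exp t))"
  have "P holomorphic_on S" "q holomorphic_on S"
    unfolding P_def q_def using Enz by (auto intro!: holomorphic_intros holE)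
  from singular_volterra[OF S this] obtain k where k: "k holomorphic_on S" "k 0 = c"
    "\<And>t. t \<in> S \<Longrightarrow> deriv k t = P t * radial_mean (\<lambda>s. q s * k s) t" by metis
  have "(exp t - 1) * deriv (deriv k) t =
        (exp t * \<sigma> - (\<sigma> + 2)) * deriv k t + (c + (\<sigma> + 1) * exp t) * k t" if t: "t \<in> S" for t
  proof -
    have seg: "z \<in> S \<Longrightarrow> closed_segment 0 z \<subseteq> S" for z
      using S by (simp add: closed_segment_subset)
    have hqk: "(\<lambda>s. q s * k s) holomorphic_on S"
      using \<open>q holomorphic_on S\<close> k(1) by (intro holomorphic_intros)
    obtain D where D: "(radial_mean (\<lambda>s. q s * k s) has_field_derivative D) (at t)"
      "2 * radial_mean (\<lambda>s. q s * k s) t + t * D = q t * k t"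
      by (rule radial_mean_has_derivative[OF S(2) seg hqk t])
    have dk: "(deriv k has_field_derivative deriv (deriv k) t) (at t)"
      using k(1) S(2) t by (auto intro!: holomorphic_derivI holomorphic_intros)
    have "((\<lambda>t. exp (- \<sigma> * t) * (E t)\<^sup>2 * deriv k t) has_field_derivative D) (at t)"
    proof (rule DERIV_cong_ev[OF refl _ refl, THEN iffD1, OF _ D(1)])
      have "eventually (\<lambda>z. z \<in> S) (nhds t)" using S(2) t by (rule eventually_nhds_in_open)
      then show "\<forall>\<^sub>F z in nhds t. radial_mean (\<lambda>s. q s * k s) z = exp (- \<sigma> * z) * (E z)\<^sup>2 * deriv k z"
        by eventually_elim (use k(3) Enz in \<open>simp add: P_def exp_minus field_simps\<close>)
    qed
    moreover have "((\<lambda>t. exp (- \<sigma> * t) * (E t)\<^sup>2 * deriv k t) has_field_derivative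
        exp (- \<sigma> * t) * ((2 * E t * deriv E t - \<sigma> * (E t)\<^sup>2) * deriv k t + (E t)\<^sup>2 * deriv (deriv k) t)) (at t)"
      by (rule derivative_eq_intros Ed dk refl)+ (simp add: algebra_simps power2_eq_square)
    ultimately have D': "D = exp (- \<sigma> * t) * ((2 * E t * deriv E t - \<sigma> * (E t)\<^sup>2) * deriv k t + (E t)\<^sup>2 * deriv (deriv k) t)"
      by (rule DERIV_unique)
    have R: "radial_mean (\<lambda>s. q s * k s) t = exp (- \<sigma> * t) * (E t)\<^sup>2 * deriv k t"
      using k(3)[OF t] Enz[OF t] by (simp add: P_def exp_minus field_simps)
    have "exp (- \<sigma> * t) * E t * (2 * E t * deriv k t + t * ((2 * deriv E t - \<sigma> * E t) * deriv k t + E t * deriv (deriv k) t))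
        = exp (- \<sigma> * t) * E t * (exp (- t) * (c + (\<sigma> + 1) * exp t) * k t)"
      using D(2) unfolding D' R unfolding q_def by (simp add: power2_eq_square algebra_simps)
    then have "2 * E t * deriv k t + t * ((2 * deriv E t - \<sigma> * E t) * deriv k t + E t * deriv (deriv k) t)
        = exp (- t) * (c + (\<sigma> + 1) * exp t) * k t"
      using Enz[OF t] by simp
    then have "2 * (E t + t * deriv E t) * deriv k t - \<sigma> * (t * E t) * deriv k t + (t * E t) * deriv (deriv k) t
        = exp (- t) * (c + (\<sigma> + 1) * exp t) * k t"
      by (simp add: algebra_simps)
    then have "2 * exp (- t) * deriv k t - \<sigma> * (1 - exp (- t)) * deriv k t + (1 - exp (- t)) * deriv (deriv k) t
        = exp (- t) * (c + (\<sigma> + 1) * exp t) * k t"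
      unfolding Ed_eq E(2)[symmetric] .
    then have "exp t * (2 * exp (- t) * deriv k t - \<sigma> * (1 - exp (- t)) * deriv k t + (1 - exp (- t)) * deriv (deriv k) t)
        = exp t * (exp (- t) * (c + (\<sigma> + 1) * exp t) * k t)"
      by simp
    moreover have ee: "exp t * exp (- t) = 1" by (simp add: exp_minus)
    have "exp t * (2 * exp (- t) * k1 - \<sigma> * (1 - exp (- t)) * k1 + (1 - exp (- t)) * k2)
        = 2 * (exp t * exp (- t)) * k1 - \<sigma> * (exp t - exp t * exp (- t)) * k1 + (exp t - exp t * exp (- t)) * k2" for k1 k2
      by (simp add: algebra_simps)
    moreover have "exp t * (exp (- t) * (c + (\<sigma> + 1) * exp t) * k0) = exp t * exp (- t) * (c + (\<sigma> + 1) * exp t) * k0" for k0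
      by (simp add: algebra_simps)
    ultimately have "2 * deriv k t - \<sigma> * (exp t - 1) * deriv k t + (exp t - 1) * deriv (deriv k) t
        = (c + (\<sigma> + 1) * exp t) * k t"
      by (simp add: ee)
    then show ?thesis by (simp add: algebra_simps)
  qed
  then show ?thesis using that[OF k(1)] k(2) by (simp add: c_def \<sigma>_def add.assoc)
qed

text \<open>
  Uniqueness of the solution with prescribed resonant coefficients: in the Taylor coefficients of
  \<open>H\<close> the system becomes a recursion whose only obstruction are the indices \<open>m\<close> with \<open>\<alpha> + m = d j\<close>.
\<close>
lemma fuchs_branch_unique:
  fixes S :: nat
  assumes Y: "side_domain Y a" and conn: "connected Y"
    and f: "\<And>j. j < S \<Longrightarrow> f j holomorphic_on Y"
    and eq: "\<And>y j. y \<in> Y \<Longrightarrow> j < S \<Longrightarrow> \<phi> j y * deriv (f j) y = (\<Sum>k<S. M j k * f k y)"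
    and br: "\<And>j. j < S \<Longrightarrow> has_branch Y a \<alpha> (f j) (H j)"
    and \<phi>: "\<And>j. j < S \<Longrightarrow> \<phi> j holomorphic_on UNIV"
    and \<phi>1: "\<And>j. j < S \<Longrightarrow> \<phi> j a = 0 \<Longrightarrow> deriv (\<phi> j) a = 1"
    and M: "\<And>j k. j < S \<Longrightarrow> k < S \<Longrightarrow> \<phi> j a = 0 \<Longrightarrow> \<phi> k a = 0 \<Longrightarrow> j \<noteq> k \<Longrightarrow> M j k = 0"
    and \<alpha>: "\<And>m::nat. \<alpha> + of_nat m \<noteq> 0"
    and res: "\<And>j m. j < S \<Longrightarrow> \<phi> j a = 0 \<Longrightarrow> \<alpha> + of_nat m = M j j \<Longrightarrow> (deriv ^^ m) (H j) a = 0"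
    and j: "j < S" and y: "y \<in> Y"
  shows "f j y = 0"
proof -
  define F where "F = (\<lambda>j. fps_expansion (H j) a)"
  define p where "p = (\<lambda>j. fps_expansion (\<phi> j) a)"
  have an: "H j analytic_on {a}" if "j < S" for j
    using br[OF that] by (rule has_branchE) (metis analytic_at centre_in_ball open_ball)
  have nthF: "fps_nth (F j) m = (deriv ^^ m) (H j) a / fact m" for j m
    by (simp add: F_def fps_expansion_def)
  have hF: "(\<lambda>s. H j (a + s)) has_fps_expansion F j" if "j < S" for j
    unfolding F_def by (rule analytic_at_imp_has_fps_expansion[OF an[OF that]])
  have "fps_expansion (deriv (H j)) a = fps_deriv (F j)" for j
    by (rule fps_ext) (simp add: F_def fps_expansion_def funpow_swap1 del: of_nat_Suc)
  then have hF': "(\<lambda>s. deriv (H j) (a + s)) has_fps_expansion fps_deriv (F j)" if "j < S" for j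
    using analytic_at_imp_has_fps_expansion[OF analytic_deriv[OF an[OF that]]] by simp
  have hp: "(\<lambda>s. \<phi> j (a + s)) has_fps_expansion p j" if "j < S" for j
    unfolding p_def by (rule analytic_at_imp_has_fps_expansion)
      (use \<phi>[OF that] in \<open>auto simp: analytic_at intro!: exI[of _ UNIV]\<close>)
  have p0: "fps_nth (p j) 0 = \<phi> j a" and p1: "fps_nth (p j) (Suc 0) = deriv (\<phi> j) a" for j
    by (simp_all add: p_def fps_expansion_def)
  have hsum: "(\<lambda>s. \<Sum>k<n. M j k * H k (a + s)) has_fps_expansion (\<Sum>k<n. fps_const (M j k) * F k)"
    if "n \<le> S" for n j :: nat
    using that by (induction n) (auto intro!: fps_expansion_intros hF)
  \<comment> \<open>Both sides of the system are written as branches with exponent alpha - 1.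
    Uniqueness of the regular factors turns the system into an identity of formal power
    series.\<close>
  have rec: "p j * (fps_const \<alpha> * F j + fps_X * fps_deriv (F j)) = fps_X * (\<Sum>k<S. fps_const (M j k) * F k)"
    if j: "j < S" for j
  proof -
    have 1: "has_branch Y a (\<alpha> - 1) (\<lambda>y. \<phi> j y * deriv (f j) y)
        (\<lambda>y. \<phi> j y * (\<alpha> * H j y + (y - a) * deriv (H j) y))"
      by (rule has_branch_mult[OF has_branch_deriv[OF Y br[OF j]] open_UNIV _ \<phi>[OF j]]) auto
    have "has_branch Y a \<alpha> (\<lambda>y. \<Sum>k<S. M j k * f k y) (\<lambda>y. \<Sum>k<S. M j k * H k y)"
      by (intro has_branch_sum has_branch_const_mult br) auto
    then have "has_branch Y a \<alpha> (\<lambda>y. \<phi> j y * deriv (f j) y) (\<lambda>y. \<Sum>k<S. M j k * H k y)"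
      by (subst has_branch_cong[OF eq[OF _ j]])
    then have 2: "has_branch Y a (\<alpha> - 1) (\<lambda>y. \<phi> j y * deriv (f j) y) (\<lambda>y. (y - a) * (\<Sum>k<S. M j k * H k y))"
      by (intro has_branch_raise[OF Y]) simp
    obtain \<epsilon> where e: "0 < \<epsilon>" "\<And>y. y \<in> ball a \<epsilon> \<Longrightarrow>
        \<phi> j y * (\<alpha> * H j y + (y - a) * deriv (H j) y) = (y - a) * (\<Sum>k<S. M j k * H k y)"
      using has_branch_unique[OF Y 1 2] by metis
    have L: "(\<lambda>s. \<phi> j (a + s) * (\<alpha> * H j (a + s) + s * deriv (H j) (a + s))) has_fps_expansion
        p j * (fps_const \<alpha> * F j + fps_X * fps_deriv (F j))"
      by (intro fps_expansion_intros hp hF hF' j)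
    have R: "(\<lambda>s. s * (\<Sum>k<S. M j k * H k (a + s))) has_fps_expansion fps_X * (\<Sum>k<S. fps_const (M j k) * F k)"
      by (intro fps_expansion_intros hsum) simp
    have "eventually (\<lambda>s. s \<in> ball 0 \<epsilon>) (nhds 0)"
      using e by (intro eventually_nhds_in_open) auto
    then have "eventually (\<lambda>s. \<phi> j (a + s) * (\<alpha> * H j (a + s) + s * deriv (H j) (a + s)) = s * (\<Sum>k<S. M j k * H k (a + s))) (nhds 0)"
      by eventually_elim (use e(2)[of "a + _"] in \<open>simp add: dist_norm\<close>)
    then have "(\<lambda>s. s * (\<Sum>k<S. M j k * H k (a + s))) has_fps_expansion p j * (fps_const \<alpha> * F j + fps_X * fps_deriv (F j))"
      by (rule has_fps_expansion_cong[OF _ refl, THEN iffD1, OF _ L])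
    then show ?thesis using R fps_expansion_unique_complex by blast
  qed
  have G: "fps_nth (fps_const \<alpha> * F j + fps_X * fps_deriv (F j)) n = (\<alpha> + of_nat n) * fps_nth (F j) n" for j n
    by (cases n) (simp_all add: algebra_simps)
  have zero: "\<forall>j<S. fps_nth (F j) m = 0" for m
  proof (induction m rule: less_induct)
    case (less m)
    then have below: "fps_nth (F j) n = 0" if "j < S" "n < m" for j n using that by blast
    \<comment> \<open>In a row regular at \<open>a\<close>, the coefficient of order
      \<open>m\<close> expresses \<open>\<phi> j a * (\<alpha> + of_nat m)\<close> times the unknown
      by earlier coefficients, and neither factor is zero.\<close>
    have nonblock: "fps_nth (F j) m = 0" if j: "j < S" and nz: "\<phi> j a \<noteq> 0" for j
    proof -
      have "fps_nth (p j * (fps_const \<alpha> * F j + fps_X * fps_deriv (F j))) m =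
          (\<Sum>i\<in>{0}. fps_nth (p j) i * ((\<alpha> + of_nat (m - i)) * fps_nth (F j) (m - i)))"
        unfolding fps_mult_nth G by (rule sum.mono_neutral_right) (use below j in auto)
      moreover have "fps_nth (fps_X * (\<Sum>k<S. fps_const (M j k) * F k)) m = 0"
        using below by (auto simp: fps_sum_nth)
      ultimately show ?thesis using rec[OF j] nz \<alpha>[of m] by (simp add: p0)
    qed
    \<comment> \<open>The weight has a simple zero here, so the equation for the coefficient of
      order \<open>m\<close> appears at order \<open>Suc m\<close>. Couplings within the block
      vanish off the diagonal, and the remaining unknowns of order \<open>m\<close> are zero by
      \<open>nonblock\<close>.\<close>
    have block: "fps_nth (F j) m = 0" if j: "j < S" and z: "\<phi> j a = 0" for j
    proof -
      have "fps_nth (p j * (fps_const \<alpha> * F j + fps_X * fps_deriv (F j))) (Suc m) =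
          (\<Sum>i\<in>{Suc 0}. fps_nth (p j) i * ((\<alpha> + of_nat (Suc m - i)) * fps_nth (F j) (Suc m - i)))"
        unfolding fps_mult_nth G
      proof (rule sum.mono_neutral_right)
        show "\<forall>i\<in>{0..Suc m} - {Suc 0}. fps_nth (p j) i * ((\<alpha> + of_nat (Suc m - i)) * fps_nth (F j) (Suc m - i)) = 0"
        proof
          fix i assume i: "i \<in> {0..Suc m} - {Suc 0}"
          show "fps_nth (p j) i * ((\<alpha> + of_nat (Suc m - i)) * fps_nth (F j) (Suc m - i)) = 0"
          proof (cases "i = 0")
            case False
            with i have "Suc m - i < m" by auto
            then show ?thesis using below[OF j] by simp
          qed (simp add: p0 z)
        qed
      qed auto
      then have "fps_nth (p j * (fps_const \<alpha> * F j + fps_X * fps_deriv (F j))) (Suc m) = (\<alpha> + of_nat m) * fps_nth (F j) m"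
        using \<phi>1[OF j z] by (simp add: p1)
      moreover have "fps_nth (fps_X * (\<Sum>k<S. fps_const (M j k) * F k)) (Suc m) = (\<Sum>k<S. M j k * fps_nth (F k) m)"
        by (simp add: fps_sum_nth)
      moreover have "(\<Sum>k<S. M j k * fps_nth (F k) m) = (\<Sum>k\<in>{j}. M j k * fps_nth (F k) m)"
        by (rule sum.mono_neutral_right) (use j M[OF j _ z] nonblock in auto)
      ultimately have "(\<alpha> + of_nat m) * fps_nth (F j) m = M j j * fps_nth (F j) m"
        using rec[OF j] by simp
      then have "\<alpha> + of_nat m = M j j \<or> fps_nth (F j) m = 0" by auto
      then show ?thesis using res[OF j z, of m] by (auto simp: nthF)
    qed
    show ?case using block nonblock by blast
  qed
  have "F j = 0" using zero j by (auto intro!: fps_ext)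
  then have "eventually (\<lambda>s. H j (a + s) = 0) (nhds 0)"
    using hF[OF j] by (simp add: has_fps_expansion_0_iff)
  then obtain d where d: "0 < d" "\<And>s. norm s < d \<Longrightarrow> H j (a + s) = 0"
    by (auto simp: eventually_nhds_metric dist_norm)
  obtain \<epsilon> where e: "0 < \<epsilon>" "\<And>y. y \<in> Y \<Longrightarrow> y \<in> ball a \<epsilon> \<Longrightarrow> f j y = exp (\<alpha> * Ln (y - a)) * H j y"
    using br[OF j] by (rule has_branchE) blast
  have m: "Y \<inter> ball a (min d \<epsilon>) \<noteq> {} \<and> open (Y \<inter> ball a (min d \<epsilon>))"
    using side_domain_meets_ball[OF Y] d e by auto
  show ?thesis
  proof (rule analytic_continuation_open[of "Y \<inter> ball a (min d \<epsilon>)" Y "f j" "\<lambda>_. 0"])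
    fix z assume z: "z \<in> Y \<inter> ball a (min d \<epsilon>)"
    then have "H j (a + (z - a)) = 0" by (intro d) (auto simp: dist_norm norm_minus_commute)
    then show "f j z = 0" using e(2)[of z] z by auto
  qed (use m Y conn f[OF j] y in \<open>auto simp: side_domain_def\<close>)
qed

section \<open>Convolutions near and across the base point\<close>

lemma holomorphic_param_integral:
  fixes F :: "complex \<Rightarrow> real \<Rightarrow> complex"
  assumes W: "open W"
    and d: "\<And>y r. y \<in> W \<Longrightarrow> r \<in> {0..1} \<Longrightarrow> ((\<lambda>y. F y r) has_field_derivative F' y r) (at y)"
    and c: "\<And>y. y \<in> W \<Longrightarrow> continuous_on {0..1} (F y)"
    and c': "continuous_on (W \<times> {0..1}) (\<lambda>p. F' (fst p) (snd p))"
  shows "(\<lambda>y. integral {0..1} (F y)) holomorphic_on W"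
proof -
  have "\<exists>D. ((\<lambda>y. integral {0..1} (F y)) has_field_derivative D) (at y)" if y: "y \<in> W" for y
  proof -
    obtain e where e: "0 < e" "ball y e \<subseteq> W" using openE[OF W y] by blast
    have "((\<lambda>y. integral (cbox 0 1) (F y)) has_field_derivative integral (cbox 0 1) (F' y)) (at y within ball y e)"
    proof (rule leibniz_rule_field_derivative)
      show "((\<lambda>x. F x r) has_field_derivative F' x r) (at x within ball y e)"
        if "x \<in> ball y e" "r \<in> cbox 0 1" for x r
        using d[OF subsetD[OF e(2) that(1)]] that(2) by (auto intro: has_field_derivative_at_within)
      show "F x integrable_on cbox 0 1" if "x \<in> ball y e" for x
        using c[OF subsetD[OF e(2) that]] by (auto intro: integrable_continuous_interval)
      show "continuous_on (ball y e \<times> cbox 0 1) (\<lambda>(x, t). F' x t)"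
        unfolding split_beta by (rule continuous_on_subset[OF c']) (use e in auto)
    qed (use e in auto)
    then show ?thesis using e by (auto simp: at_within_open[of y "ball y e"])
  qed
  then show ?thesis using W by (simp add: holomorphic_on_open)
qed

lemma has_branch_tendsto_0:
  assumes "has_branch Y a \<alpha> f H" "Re \<alpha> > 0" "a \<notin> Y"
  shows "(f \<longlongrightarrow> 0) (at a within Y)"
proof -
  obtain \<epsilon> where e: "0 < \<epsilon>" "H holomorphic_on ball a \<epsilon>"
    "\<And>y. y \<in> Y \<Longrightarrow> y \<in> ball a \<epsilon> \<Longrightarrow> f y = exp (\<alpha> * Ln (y - a)) * H y"
    using assms(1) by (rule has_branchE) blast
  have "isCont H a" using e
    by (metis centre_in_ball continuous_on_eq_continuous_at holomorphic_on_imp_continuous_on open_ball)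
  then have 1: "(H \<longlongrightarrow> H a) (at a within Y)"
    using continuous_at_imp_continuous_within continuous_within by blast
  have 2: "((\<lambda>y. (y - a) powr \<alpha>) \<longlongrightarrow> 0) (at a within Y)"
  proof (rule tendsto_powr_complex_0[OF _ tendsto_const assms(2)])
    show "((\<lambda>y. y - a) \<longlongrightarrow> 0) (at a within Y)" by (auto intro!: tendsto_eq_intros)
  qed
  have "((\<lambda>y. (y - a) powr \<alpha> * H y) \<longlongrightarrow> 0) (at a within Y)"
    using tendsto_mult[OF 2 1] by simp
  moreover have "eventually (\<lambda>y. (y - a) powr \<alpha> * H y = f y) (at a within Y)"
    unfolding eventually_at using e assms(3)
    by (intro exI[of _ \<epsilon>]) (auto simp: powr_def dist_commute)
  ultimately show ?thesis by (rule Lim_transform_eventually)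
qed

lemma continuous_on_insert_extend:
  fixes f :: "complex \<Rightarrow> complex"
  assumes "continuous_on Y f" "(f \<longlongrightarrow> l) (at a within Y)" "open Y" "a \<notin> Y"
  shows "continuous_on (insert a Y) (f(a := l))"
  unfolding continuous_on_def
proof
  fix x assume x: "x \<in> insert a Y"
  show "(f(a := l) \<longlongrightarrow> (f(a := l)) x) (at x within insert a Y)"
  proof (cases "x = a")
    case True
    have "(f(a := l) \<longlongrightarrow> l) (at a within Y)"
      by (rule Lim_transform_within[OF assms(2), of 1]) auto
    moreover have "insert a Y - {a} = Y - {a}" by auto
    ultimately show ?thesis using True by (simp add: at_within_def)
  next
    case False
    then have xY: "x \<in> Y" using x by auto
    have "x \<in> Y - {a}" "open (Y - {a})" using False xY assms(3) by auto
    then have "at x within insert a Y = at x" using xY assms(3)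
      by (intro at_within_nhd[of _ Y]) auto
    moreover have "(f \<longlongrightarrow> f x) (at x)"
      using assms(1,3) xY by (simp add: continuous_on_eq_continuous_at isCont_def)
    then have "(f(a := l) \<longlongrightarrow> f x) (at x)"
      by (rule Lim_transform_within_open[of _ _ _ _ "Y - {a}"]) (use \<open>open (Y - {a})\<close> \<open>x \<in> Y - {a}\<close> in auto)
    ultimately show ?thesis using False by simp
  qed
qed

text \<open>For real r > 0 the power of r (y - a) splits into r^beta and (y - a)^beta, and the
  latter leaves the integral. The weight r^beta is continuous at 0 because Re beta > 0. The
  prefactor y - a of \<open>conv\<close> makes the regular factor vanish at \<open>a\<close>, so
  adding the convolution to a solution keeps its leading coefficient.\<close>

lemma conv_branch:
  assumes D: "conv_domain S a Y" and Y: "side_domain Y a" and k: "k holomorphic_on S" and S0: "0 \<in> S"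
    and f: "has_branch Y a \<beta> f h" and \<beta>: "Re \<beta> > 0" and fa: "f a = 0"
  obtains H where "has_branch Y a \<beta> (conv a k f) H" "H a = 0"
proof -
  obtain \<epsilon> where e: "0 < \<epsilon>" "h holomorphic_on ball a \<epsilon>"
    "\<And>y. y \<in> Y \<Longrightarrow> y \<in> ball a \<epsilon> \<Longrightarrow> f y = exp (\<beta> * Ln (y - a)) * h y"
    using f by (rule has_branchE) blast
  note [simp del] = of_real_diff
  have op: "open S" by (rule conv_domain_open[OF D])
  obtain d where d: "0 < d" "ball 0 d \<subseteq> S" using openE[OF op S0] by blast
  define \<eta> where "\<eta> = min \<epsilon> d"
  have \<eta>: "0 < \<eta>" using e d by (simp add: \<eta>_def)
  have le: "r * norm (y - a) < \<eta>" if "y \<in> ball a \<eta>" "0 \<le> r" "r \<le> 1" for y and r :: real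
  proof -
    have "r * norm (y - a) \<le> 1 * norm (y - a)" using that by (intro mult_right_mono) auto
    then show ?thesis using that by (simp add: dist_norm norm_minus_commute)
  qed
  have m1: "of_real (1 - r) * (y - a) \<in> S" if "y \<in> ball a \<eta>" "r \<in> {0..1}" for y and r :: real
  proof -
    have "norm (of_real (1 - r) * (y - a)) < d" using le[OF that(1), of "1 - r"] that
      by (simp add: norm_mult \<eta>_def del: of_real_diff)
    then show ?thesis using d by auto
  qed
  have m2: "a + of_real r * (y - a) \<in> ball a \<epsilon>" if "y \<in> ball a \<eta>" "r \<in> {0..1}" for y and r :: real
    using le[OF that(1), of r] that by (simp add: norm_mult \<eta>_def dist_norm)
  have kd: "(k has_field_derivative deriv k u) (at u)" if "u \<in> S" for u
    using k op that by (auto intro: holomorphic_derivI)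
  have hd: "(h has_field_derivative deriv h u) (at u)" if "u \<in> ball a \<epsilon>" for u
    using e(2) that by (auto intro: holomorphic_derivI)
  have ck: "continuous_on S k" "continuous_on S (deriv k)"
    using k op by (auto intro!: holomorphic_on_imp_continuous_on holomorphic_intros)
  have ch: "continuous_on (ball a \<epsilon>) h" "continuous_on (ball a \<epsilon>) (deriv h)"
    using e(2) by (auto intro!: holomorphic_on_imp_continuous_on holomorphic_intros)
  define I where "I = (\<lambda>y. integral {0..1} (\<lambda>r. of_real r powr \<beta> * (k (of_real (1 - r) * (y - a)) * h (a + of_real r * (y - a)))))"
  have "I holomorphic_on ball a \<eta>"
    unfolding I_def
  proof (rule holomorphic_param_integral[where
      F' = "\<lambda>y r. of_real r powr \<beta> * (of_real (1 - r) * deriv k (of_real (1 - r) * (y - a)) * h (a + of_real r * (y - a)) +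
         k (of_real (1 - r) * (y - a)) * (of_real r * deriv h (a + of_real r * (y - a))))"])
    fix y and r :: real assume yr: "y \<in> ball a \<eta>" "r \<in> {0..1}"
    have 1: "((\<lambda>y. k (of_real (1 - r) * (y - a))) has_field_derivative of_real (1 - r) * deriv k (of_real (1 - r) * (y - a))) (at y)"
      by (rule DERIV_compose_affine[of k "deriv k (of_real (1 - r) * (y - a))" 0 "of_real (1 - r)" y a, unfolded add_0_left,
            OF kd[OF m1[OF yr]]])
    have 2: "((\<lambda>y. h (a + of_real r * (y - a))) has_field_derivative of_real r * deriv h (a + of_real r * (y - a))) (at y)"
      by (rule DERIV_compose_affine[OF hd[OF m2[OF yr]]])
    show "((\<lambda>y. of_real r powr \<beta> * (k (of_real (1 - r) * (y - a)) * h (a + of_real r * (y - a)))) has_field_derivative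
        of_real r powr \<beta> * (of_real (1 - r) * deriv k (of_real (1 - r) * (y - a)) * h (a + of_real r * (y - a)) +
         k (of_real (1 - r) * (y - a)) * (of_real r * deriv h (a + of_real r * (y - a))))) (at y)"
      using DERIV_cmult[OF DERIV_mult'[OF 1 2], of "of_real r powr \<beta>"] by (simp add: add.commute)
  next
    have pw: "continuous_on T (\<lambda>p. of_real (g p) powr \<beta>)" if "continuous_on T g" "\<And>p. p \<in> T \<Longrightarrow> 0 \<le> g p"
      for T and g :: "'a::topological_space \<Rightarrow> real"
      by (rule continuous_on_powr_complex) (use that \<beta> in \<open>auto intro!: continuous_intros\<close>)
    show "continuous_on {0..1} (\<lambda>r. of_real r powr \<beta> * (k (of_real (1 - r) * (y - a)) * h (a + of_real r * (y - a))))"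
      if "y \<in> ball a \<eta>" for y
      by (intro continuous_intros pw continuous_on_compose2[OF ck(1)] continuous_on_compose2[OF ch(1)])
         (use m1[OF that] m2[OF that] in auto)
    have "continuous_on (ball a \<eta> \<times> {0..1}) (\<lambda>p. q (of_real (1 - snd p) * (fst p - a)))"
      if "continuous_on S q" for q :: "complex \<Rightarrow> complex"
      by (intro continuous_on_compose2[OF that] continuous_intros) (use m1 in auto)
    moreover have "continuous_on (ball a \<eta> \<times> {0..1}) (\<lambda>p. q (a + of_real (snd p) * (fst p - a)))"
      if "continuous_on (ball a \<epsilon>) q" for q :: "complex \<Rightarrow> complex"
      by (intro continuous_on_compose2[OF that] continuous_intros) (use m2 in auto)
    ultimately show "continuous_on (ball a \<eta> \<times> {0..1}) (\<lambda>p. of_real (snd p) powr \<beta> * (of_real (1 - snd p) * deriv k (of_real (1 - snd p) * (fst p - a)) * h (a + of_real (snd p) * (fst p - a)) +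
         k (of_real (1 - snd p) * (fst p - a)) * (of_real (snd p) * deriv h (a + of_real (snd p) * (fst p - a)))))"
      using ck ch by (intro continuous_intros pw) auto
  qed simp
  then have hol: "(\<lambda>y. (y - a) * I y) holomorphic_on ball a \<eta>" by (intro holomorphic_intros)
  have "has_branch Y a \<beta> (conv a k f) (\<lambda>y. (y - a) * I y)"
  proof (rule has_branchI[OF \<eta> hol])
    fix y assume y: "y \<in> Y" "y \<in> ball a \<eta>"
    have ne: "y - a \<noteq> 0" using side_domain_notin_nonpos[OF Y y(1)] by auto
    have "k (of_real (1 - r) * (y - a)) * f (a + of_real r * (y - a)) =
        exp (\<beta> * Ln (y - a)) * (of_real r powr \<beta> * (k (of_real (1 - r) * (y - a)) * h (a + of_real r * (y - a))))"
      if r: "r \<in> {0..1}" for r :: real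
    proof (cases "r = 0")
      case False
      with r have r0: "0 < r" by auto
      have "a + of_real r * (y - a) \<in> Y" using r by (intro conv_domain_segment(3)[OF D y(1) _ _ r0]) auto
      then have "f (a + of_real r * (y - a)) = exp (\<beta> * Ln (of_real r * (y - a))) * h (a + of_real r * (y - a))"
        using e(3)[of "a + of_real r * (y - a)"] m2[OF y(2) r] by simp
      also have "Ln (of_real r * (y - a)) = of_real (ln r) + Ln (y - a)"
        using Ln_times_of_real[OF r0 ne] r0 by (simp add: Ln_of_real)
      also have "exp (\<beta> * (of_real (ln r) + Ln (y - a))) = of_real r powr \<beta> * exp (\<beta> * Ln (y - a))"
        using r0 by (simp add: powr_def Ln_of_real exp_add ring_distribs)
      finally show ?thesis by simp
    qed (simp add: fa)
    then have "integral {0..1} (\<lambda>r. k (of_real (1 - r) * (y - a)) * f (a + of_real r * (y - a))) =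
       integral {0..1} (\<lambda>r. exp (\<beta> * Ln (y - a)) * (of_real r powr \<beta> * (k (of_real (1 - r) * (y - a)) * h (a + of_real r * (y - a)))))"
      by (intro integral_cong) auto
    then show "conv a k f y = exp (\<beta> * Ln (y - a)) * ((y - a) * I y)"
      by (simp add: conv_def I_def)
  qed
  then show ?thesis using that by simp
qed

text \<open>Cauchy's theorem for the triangle a, b, y. In the resulting integral the segment is
  fixed and \<open>y\<close> enters through the kernel alone, so that it can be continued in
  \<open>y\<close> beyond the strip.\<close>

lemma conv_change_base:
  assumes a: "side_domain Y a" and b: "side_domain Y b" and ab: "Im a \<noteq> Im b"
    and E: "convex (insert a (insert b Y))" and S: "\<And>s. s \<in> insert a (insert b Y) \<Longrightarrow> y - s \<in> S"
    and k: "k holomorphic_on S" and f: "continuous_on (insert a (insert b Y)) f" "f holomorphic_on Y" and y: "y \<in> Y"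
  shows "conv a k f y - conv b k f y =
    (b - a) * integral {0..1} (\<lambda>r. k (y - (a + of_real r * (b - a))) * f (a + of_real r * (b - a)))"
proof -
  let ?E = "insert a (insert b Y)"
  define g where "g = (\<lambda>s. k (y - s) * f s)"
  have cg: "continuous_on ?E g"
    unfolding g_def by (intro continuous_intros f continuous_on_compose2[OF holomorphic_on_imp_continuous_on[OF k]]) (use S in auto)
  have "(\<lambda>s. k (y - s)) holomorphic_on Y"
    by (rule holomorphic_on_compose_gen[OF _ k, unfolded o_def]) (use S in \<open>auto intro!: holomorphic_intros\<close>)
  then have hg: "g holomorphic_on Y" unfolding g_def by (intro holomorphic_intros f)
  have hull: "convex hull {a, b, y} \<subseteq> ?E" using E y by (intro hull_minimal) auto
  \<comment> \<open>The vertices \<open>a\<close> and \<open>b\<close> cannot be interior points of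
    the triangle: a small horizontal shift leaves the set, as \<open>Y\<close> has no points at the
    heights of \<open>a\<close> and \<open>b\<close>.\<close>
  have no: "c \<notin> U" if U: "open U" "U \<subseteq> ?E" and c: "side_domain Y c" "c = a \<and> d = b \<or> c = b \<and> d = a" for U c d
  proof
    assume "c \<in> U"
    then obtain \<epsilon> where e: "0 < \<epsilon>" "cball c \<epsilon> \<subseteq> U" using U(1) open_contains_cball by blast
    have "c + of_real \<epsilon> \<in> ?E" using e U(2) by (auto simp: subset_iff dist_norm)
    moreover have "c + of_real \<epsilon> \<notin> Y" using c(1) by (auto simp: side_domain_def)
    moreover have "c + of_real \<epsilon> \<noteq> c" using e by simp
    moreover have "c + of_real \<epsilon> \<noteq> d" using ab c(2) by (auto simp: complex_eq_iff)
    ultimately show False using c(2) by auto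
  qed
  have "interior (convex hull {a, b, y}) \<subseteq> Y"
    using no[OF open_interior subset_trans[OF interior_subset hull] a, of b]
      no[OF open_interior subset_trans[OF interior_subset hull] b, of a]
      subset_trans[OF interior_subset hull] by blast
  then have "(g has_contour_integral 0) (linepath a b +++ linepath b y +++ linepath y a)"
    by (intro Cauchy_theorem_triangle_interior continuous_on_subset[OF cg hull] holomorphic_on_subset[OF hg])
  then have tri: "contour_integral (linepath a b) g + contour_integral (linepath b y) g + contour_integral (linepath y a) g = 0"
    using has_chain_integral_chain_integral3 by blast
  have seg: "closed_segment u v \<subseteq> ?E" if "u \<in> ?E" "v \<in> ?E" for u v
    using E that by (simp add: closed_segment_subset)
  have ci: "contour_integral (linepath u v) g = (v - u) * integral {0..1} (\<lambda>r. g (u + of_real r * (v - u)))"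
    if uv: "u \<in> ?E" "v \<in> ?E" for u v
  proof -
    have "g contour_integrable_on linepath u v"
      by (intro contour_integrable_continuous_linepath continuous_on_subset[OF cg seg[OF uv]])
    then have 1: "((\<lambda>r. g (linepath u v r) * (v - u)) has_integral contour_integral (linepath u v) g) {0..1}"
      using has_contour_integral_integral has_contour_integral_linepath by blast
    have lp: "linepath u v r = u + of_real r * (v - u)" for r
      by (simp add: linepath_def scaleR_conv_of_real algebra_simps)
    have "contour_integral (linepath u v) g = integral {0..1} (\<lambda>r. g (u + of_real r * (v - u)) * (v - u))"
      using integral_unique[OF 1, symmetric] unfolding lp .
    also have "\<dots> = integral {0..1} (\<lambda>r. g (u + of_real r * (v - u))) * (v - u)"
      by (rule integral_mult_left)
    finally show ?thesis by (simp only: mult.commute)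
  qed
  have cv: "contour_integral (linepath u y) g = conv u k f y" if "u \<in> ?E" for u
  proof -
    have "y - (u + of_real r * (y - u)) = of_real (1 - r) * (y - u)" for r by (simp add: algebra_simps)
    then show ?thesis using ci[OF that, of y] y by (simp add: conv_def g_def)
  qed
  have "contour_integral (linepath y a) g = - contour_integral (linepath a y) g"
    by (rule contour_integral_reverse_linepath) (use continuous_on_subset[OF cg seg] y in auto)
  then have "conv a k f y - conv b k f y = contour_integral (linepath a b) g"
    using tri cv[of a] cv[of b] by (simp add: algebra_simps)
  then show ?thesis unfolding ci[OF insertI1 insertI2[OF insertI1]] unfolding g_def .
qed

section \<open>The intertwining identity behind the kernel\<close>

lemma matrix_sum_linear:
  fixes M :: "nat \<Rightarrow> complex"
  shows "(\<Sum>k<N. M k * (f k + c * g k + h k)) = (\<Sum>k<N. M k * f k) + c * (\<Sum>k<N. M k * g k) + (\<Sum>k<N. M k * h k)"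
  by (simp add: ring_distribs sum.distrib sum_distrib_left mult.left_commute)

text \<open>The system says that \<open>exp y\<close> times the defect v - A w equals tau v. Under
  the convolution with k2 = k' - (sigma + 1) k this replaces the matrix by the new kernel exp s (k2
  + k2'), which the equation of \<open>k\<close> identifies with k'' - (sigma + 2) k' + c k, the
  operator that acts on \<open>X\<close>. The zeros of \<open>w\<close> and \<open>v\<close> at
  \<open>a\<close> suppress the boundary terms there.\<close>

lemma transmutation_equation:
  fixes A :: "nat \<Rightarrow> nat \<Rightarrow> complex" and \<tau> :: "nat \<Rightarrow> complex" and \<sigma> c :: complex
  assumes D: "conv_domain S a Y" and S0: "0 \<in> S" and k: "k holomorphic_on S" "k 0 = c"
    and kode: "\<And>t. t \<in> S \<Longrightarrow> (exp t - 1) * deriv (deriv k) t =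
        (exp t * \<sigma> - (\<sigma> + 2)) * deriv k t + (c + (\<sigma> + 1) * exp t) * k t"
    and w: "\<And>j. j < N \<Longrightarrow> w j holomorphic_on Y"
    and cw: "\<And>j. j < N \<Longrightarrow> continuous_on (insert a Y) (w j)" "\<And>j. j < N \<Longrightarrow> w j a = 0"
    and cv: "\<And>j. j < N \<Longrightarrow> continuous_on (insert a Y) (v j)" "\<And>j. j < N \<Longrightarrow> v j a = 0"
    and wv: "\<And>j y. j < N \<Longrightarrow> y \<in> Y \<Longrightarrow> deriv (w j) y = v j y"
    and sys: "\<And>j y. j < N \<Longrightarrow> y \<in> Y \<Longrightarrow> (1 - \<tau> j * exp (- y)) * v j y = (\<Sum>k<N. A j k * w k y)"
  defines "X \<equiv> \<lambda>j y. w j y + conv a k (w j) y"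
  defines "Z \<equiv> \<lambda>j y. deriv (X j) y - (\<sigma> + 1) * X j y"
  assumes y: "y \<in> Y" and j: "j < N"
  shows "\<tau> j * (deriv (deriv (X j)) y - (\<sigma> + 2) * deriv (X j) y + c * X j y) =
      exp y * (deriv (Z j) y - (\<Sum>k<N. A j k * Z k y))"
    and "X j holomorphic_on Y"
proof -
  note op = conv_domain_open[OF D]
  have k': "deriv k holomorphic_on S" "deriv (deriv k) holomorphic_on S"
    using k op by (auto intro!: holomorphic_intros)
  have ck: "continuous_on S k" "continuous_on S (deriv k)" "continuous_on S (deriv (deriv k))"
    using k k' by (auto intro: holomorphic_on_imp_continuous_on)
  have wd: "(w j has_field_derivative v j y) (at y)" if "j < N" "y \<in> Y" for j y
    using holomorphic_derivI[OF w op(2)] wv that by metis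
  have vhol: "v j holomorphic_on Y" if "j < N" for j
    using holomorphic_deriv[OF w[OF that] op(2)] wv[OF that] by (auto cong: holomorphic_cong)
  have vd: "(v j has_field_derivative deriv (v j) y) (at y)" if "j < N" "y \<in> Y" for j y
    using holomorphic_derivI[OF vhol op(2)] that by metis
  have C1: "(conv a f (w j) has_field_derivative f 0 * w j y + conv a (deriv f) (w j) y) (at y)"
    and C2: "conv a (deriv f) (w j) y + f 0 * w j y = conv a f (v j) y"
    if "f holomorphic_on S" "j < N" "y \<in> Y" for f j y
    using conv_derivative[OF D that(1) cw(1) cv(1) wd that(3)] that(2) cw(2) by auto
  define X1 where "X1 = (\<lambda>j y. v j y + c * w j y + conv a (deriv k) (w j) y)"
  have Xd: "(X j has_field_derivative X1 j y) (at y)" if "j < N" "y \<in> Y" for j y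
    unfolding X_def X1_def using wd[OF that] C1[OF k(1) that] k(2)
    by (auto intro!: derivative_eq_intros)
  then show Xhol: "X j holomorphic_on Y" using op j by (auto simp: holomorphic_on_open)
  have dX: "deriv (X j) y = X1 j y" if "j < N" "y \<in> Y" for j y
    using Xd[OF that] by (rule DERIV_imp_deriv)
  have ev: "eventually (\<lambda>z. z \<in> Y) (nhds y)" if "y \<in> Y" for y
    using op(2) that by (rule eventually_nhds_in_open)
  have dX2: "deriv (deriv (X j)) y = deriv (v j) y + c * v j y + deriv k 0 * w j y + conv a (deriv (deriv k)) (w j) y"
    if jy: "j < N" "y \<in> Y" for j y
  proof -
    have "deriv (deriv (X j)) y = deriv (X1 j) y"
      by (rule deriv_cong_ev[OF eventually_mono[OF ev[OF jy(2)]] refl]) (use dX jy in auto)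
    moreover have "(X1 j has_field_derivative deriv (v j) y + c * v j y + (deriv k 0 * w j y + conv a (deriv (deriv k)) (w j) y)) (at y)"
      unfolding X1_def using vd[OF jy] wd[OF jy] C1[OF k'(1) jy]
      by (auto intro!: derivative_eq_intros)
    ultimately show ?thesis by (simp add: DERIV_imp_deriv add.assoc)
  qed
  \<comment> \<open>\<open>Z\<close> arises from \<open>X\<close> by d/dy - (sigma + 1); inside the
    convolution this operator acts on the kernel.\<close>
  define k2 where "k2 = (\<lambda>t. deriv k t - (\<sigma> + 1) * k t)"
  have k2: "k2 holomorphic_on S" unfolding k2_def by (intro holomorphic_intros k k')
  have ck2: "continuous_on S k2" using k2 by (rule holomorphic_on_imp_continuous_on)
  have k2conv: "conv a k2 g y = conv a (deriv k) g y - (\<sigma> + 1) * conv a k g y"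
    if "continuous_on (insert a Y) g" "y \<in> Y" for g y
  proof -
    have "k2 = (\<lambda>s. 1 * deriv k s + (- (\<sigma> + 1)) * k s)" by (rule ext) (simp add: k2_def algebra_simps)
    then have "conv a k2 g y = 1 * conv a (deriv k) g y + (- (\<sigma> + 1)) * conv a k g y"
      using conv_linear_left[OF D ck(2) ck(1) that] by (simp only:)
    then show ?thesis by (simp add: algebra_simps)
  qed
  have Z_eq: "Z j y = v j y + (c - \<sigma> - 1) * w j y + conv a k2 (w j) y" if "j < N" "y \<in> Y" for j y
    unfolding Z_def dX[OF that] unfolding X1_def X_def k2conv[OF cw(1)[OF that(1)] that(2)]
    by (simp add: algebra_simps)
  have dZ: "deriv (Z j) y = deriv (v j) y + (c - \<sigma> - 1) * v j y + conv a k2 (v j) y"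
    if jy: "j < N" "y \<in> Y" for j y
  proof -
    have "deriv (Z j) y = deriv (\<lambda>y. v j y + (c - \<sigma> - 1) * w j y + conv a k2 (w j) y) y"
      by (rule deriv_cong_ev[OF eventually_mono[OF ev[OF jy(2)]] refl]) (use Z_eq jy in auto)
    moreover have "((\<lambda>y. v j y + (c - \<sigma> - 1) * w j y + conv a k2 (w j) y) has_field_derivative
        deriv (v j) y + (c - \<sigma> - 1) * v j y + (k2 0 * w j y + conv a (deriv k2) (w j) y)) (at y)"
      using vd[OF jy] wd[OF jy] C1[OF k2 jy] by (auto intro!: derivative_eq_intros)
    ultimately show ?thesis using C2[OF k2 jy] by (simp add: DERIV_imp_deriv add.commute)
  qed
  \<comment> \<open>The deviation from v = A w, caused by the factor \<open>exp (- y)\<close> in the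
    system. Multiplied by \<open>exp y\<close> it becomes tau v, which contains no matrix.\<close>
  define \<eta> where "\<eta> = (\<lambda>j y. v j y - (\<Sum>k<N. A j k * w k y))"
  have \<eta>Y: "exp y * \<eta> j y = \<tau> j * v j y" if "j < N" "y \<in> Y" for j y
  proof -
    have "\<eta> j y = \<tau> j * exp (- y) * v j y" using sys[OF that] by (simp add: \<eta>_def algebra_simps)
    then show ?thesis by (simp add: exp_minus)
  qed
  have \<eta>a: "\<eta> j a = 0" "v j a = 0" if "j < N" for j using cw(2) cv(2) that by (simp_all add: \<eta>_def)
  have \<eta>c: "continuous_on (insert a Y) (\<eta> j)" if "j < N" for j
    unfolding \<eta>_def using cw(1) cv(1) that by (intro continuous_intros) auto
  have \<eta>d: "exp y * (deriv (v j) y - (\<Sum>k<N. A j k * v k y)) = \<tau> j * (deriv (v j) y - v j y)"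
    if jy: "j < N" "y \<in> Y" for j y
  proof -
    have "((\<lambda>y. exp y * \<eta> j y) has_field_derivative exp y * (deriv (v j) y - (\<Sum>k<N. A j k * v k y)) + exp y * \<eta> j y) (at y)"
      unfolding \<eta>_def using vd[OF jy] wd[OF _ jy(2)]
      by (auto intro!: derivative_eq_intros simp: mult.commute)
    moreover have "((\<lambda>y. exp y * \<eta> j y) has_field_derivative \<tau> j * deriv (v j) y) (at y)"
      by (rule DERIV_cong_ev[OF refl _ refl, THEN iffD2, OF eventually_mono[OF ev[OF jy(2)]] DERIV_cmult[OF vd[OF jy]]])
         (use \<eta>Y jy in auto)
    ultimately have "exp y * (deriv (v j) y - (\<Sum>k<N. A j k * v k y)) + exp y * \<eta> j y = \<tau> j * deriv (v j) y"
      by (rule DERIV_unique)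
    then show ?thesis using \<eta>Y[OF jy] by (simp add: algebra_simps)
  qed
  have conv\<eta>: "conv a k2 (v j) y - (\<Sum>k<N. A j k * conv a k2 (w k) y) = conv a k2 (\<eta> j) y"
    if "j < N" "y \<in> Y" for j y
  proof -
    \<comment> \<open>Index \<open>N\<close> is an additional slot for \<open>v j\<close>, so that
      the defect is one linear combination to which \<open>conv_sum_right\<close> applies.\<close>
    define B where "B = (\<lambda>i. if i = N then 1 else - A j i)"
    define g where "g = (\<lambda>i. if i = N then v j else w i)"
    have "conv a k2 (\<lambda>s. \<Sum>i\<in>{..N}. B i * g i s) y = (\<Sum>i\<in>{..N}. B i * conv a k2 (g i) y)"
      by (rule conv_sum_right[OF D ck2 that(2)]) (use cw(1) cv(1) that in \<open>auto simp: g_def\<close>)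
    moreover have "(\<Sum>i\<in>{..N}. B i * h (g i)) = h (v j) - (\<Sum>k<N. A j k * h (w k))" for h :: "_ \<Rightarrow> complex"
    proof -
      have "(\<Sum>i\<in>{..N}. B i * h (g i)) = B N * h (g N) + (\<Sum>i<N. B i * h (g i))"
        by (simp add: lessThan_Suc_atMost[symmetric])
      also have "(\<Sum>i<N. B i * h (g i)) = (\<Sum>i<N. - (A j i * h (w i)))"
        by (rule sum.cong) (auto simp: B_def g_def)
      finally show ?thesis by (simp add: B_def g_def sum_negf)
    qed
    from this[of "\<lambda>f. conv a k2 f y"] this[of "\<lambda>f. f s" for s] calculation show ?thesis by (simp add: \<eta>_def[abs_def])
  qed
  have exp\<eta>: "exp y * conv a k2 (\<eta> j) y =
      \<tau> j * (conv a (\<lambda>s. exp s * (k2 s + deriv k2 s)) (w j) y + k2 0 * w j y)" if jy: "j < N" "y \<in> Y" for j y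
  proof -
    have hE: "(\<lambda>s. exp s * k2 s) holomorphic_on S" by (intro holomorphic_intros k2)
    have "exp y * conv a k2 (\<eta> j) y = conv a (\<lambda>s. exp s * k2 s) (\<lambda>s. exp s * \<eta> j s) y"
      by (rule exp_conv)
    also have "\<dots> = conv a (\<lambda>s. exp s * k2 s) (\<lambda>s. \<Sum>i\<in>{()}. \<tau> j * v j s) y"
      by (rule conv_cong[OF D jy(2)]) (use \<eta>Y[OF jy(1)] \<eta>a[OF jy(1)] in auto)
    also have "\<dots> = \<tau> j * conv a (\<lambda>s. exp s * k2 s) (v j) y"
      using conv_sum_right[OF D holomorphic_on_imp_continuous_on[OF hE] jy(2), of "{()}" "\<lambda>_. v j" "\<lambda>_. \<tau> j"] cv(1) jy by simp
    also have "conv a (\<lambda>s. exp s * k2 s) (v j) y = conv a (deriv (\<lambda>s. exp s * k2 s)) (w j) y + k2 0 * w j y"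
      using C2[OF hE jy] by simp
    also have "conv a (deriv (\<lambda>s. exp s * k2 s)) (w j) y = conv a (\<lambda>s. exp s * (k2 s + deriv k2 s)) (w j) y"
    proof (rule conv_cong[OF D jy(2) _ refl])
      fix s assume "s \<in> S"
      then have "(k2 has_field_derivative deriv k2 s) (at s)" using k2 op by (auto intro: holomorphic_derivI)
      then have "((\<lambda>s. exp s * k2 s) has_field_derivative exp s * (k2 s + deriv k2 s)) (at s)"
        by (auto intro!: derivative_eq_intros simp: algebra_simps)
      then show "deriv (\<lambda>s. exp s * k2 s) s = exp s * (k2 s + deriv k2 s)" by (rule DERIV_imp_deriv)
    qed
    finally show ?thesis .
  qed
  \<comment> \<open>The kernel equation, regrouped so that its right-hand side is the operator
    applied to \<open>X\<close> in the claim.\<close>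
  have kid: "exp s * (k2 s + deriv k2 s) = deriv (deriv k) s - (\<sigma> + 2) * deriv k s + c * k s" if s: "s \<in> S" for s
  proof -
    have "(deriv k has_field_derivative deriv (deriv k) s) (at s)" "(k has_field_derivative deriv k s) (at s)"
      using k k' op s by (auto intro: holomorphic_derivI)
    then have "(k2 has_field_derivative deriv (deriv k) s - (\<sigma> + 1) * deriv k s) (at s)"
      unfolding k2_def by (auto intro!: derivative_eq_intros)
    then have d: "deriv k2 s = deriv (deriv k) s - (\<sigma> + 1) * deriv k s" by (rule DERIV_imp_deriv)
    show ?thesis unfolding d unfolding k2_def using kode[OF s] by (simp add: algebra_simps)
  qed
  have Kconv: "conv a (\<lambda>s. exp s * (k2 s + deriv k2 s)) (w j) y =
      conv a (deriv (deriv k)) (w j) y - (\<sigma> + 2) * conv a (deriv k) (w j) y + c * conv a k (w j) y"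
  proof -
    have "conv a (\<lambda>s. exp s * (k2 s + deriv k2 s)) (w j) y =
        conv a (\<lambda>s. 1 * (1 * deriv (deriv k) s + (- (\<sigma> + 2)) * deriv k s) + c * k s) (w j) y"
      by (rule conv_cong[OF D y _ refl]) (simp only: kid, simp add: algebra_simps)
    also have "\<dots> = 1 * conv a (\<lambda>s. 1 * deriv (deriv k) s + (- (\<sigma> + 2)) * deriv k s) (w j) y + c * conv a k (w j) y"
      by (rule conv_linear_left[OF D _ ck(1) cw(1)[OF j] y]) (intro continuous_intros ck)
    also have "conv a (\<lambda>s. 1 * deriv (deriv k) s + (- (\<sigma> + 2)) * deriv k s) (w j) y =
        1 * conv a (deriv (deriv k)) (w j) y + (- (\<sigma> + 2)) * conv a (deriv k) (w j) y"
      by (rule conv_linear_left[OF D ck(3,2) cw(1)[OF j] y])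
    finally show ?thesis by (simp add: algebra_simps)
  qed
  have "(\<Sum>k<N. A j k * Z k y) = (\<Sum>k<N. A j k * (v k y + (c - \<sigma> - 1) * w k y + conv a k2 (w k) y))"
    by (rule sum.cong) (use Z_eq y in auto)
  also have "\<dots> = (\<Sum>k<N. A j k * v k y) + (c - \<sigma> - 1) * (\<Sum>k<N. A j k * w k y) + (\<Sum>k<N. A j k * conv a k2 (w k) y)"
    by (rule matrix_sum_linear)
  finally have zz: "deriv (Z j) y - (\<Sum>k<N. A j k * Z k y) =
      (deriv (v j) y - (\<Sum>k<N. A j k * v k y)) + (c - \<sigma> - 1) * \<eta> j y + conv a k2 (\<eta> j) y"
    unfolding dZ[OF j y] conv\<eta>[OF j y, symmetric] by (simp add: \<eta>_def algebra_simps)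
  have "exp y * (deriv (Z j) y - (\<Sum>k<N. A j k * Z k y)) =
      exp y * (deriv (v j) y - (\<Sum>k<N. A j k * v k y)) + (c - \<sigma> - 1) * (exp y * \<eta> j y) + exp y * conv a k2 (\<eta> j) y"
    unfolding zz by (simp add: algebra_simps)
  also have "\<dots> = \<tau> j * (deriv (v j) y - v j y + (c - \<sigma> - 1) * v j y +
      (conv a (deriv (deriv k)) (w j) y - (\<sigma> + 2) * conv a (deriv k) (w j) y + c * conv a k (w j) y) + k2 0 * w j y)"
    unfolding \<eta>d[OF j y] \<eta>Y[OF j y] exp\<eta>[OF j y] Kconv by (simp add: algebra_simps)
  also have "\<dots> = \<tau> j * (deriv (deriv (X j)) y - (\<sigma> + 2) * deriv (X j) y + c * X j y)"
    unfolding dX2[OF j y] dX[OF j y] unfolding X1_def X_def k2_def k(2) by (simp add: algebra_simps)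
  finally show "\<tau> j * (deriv (deriv (X j)) y - (\<sigma> + 2) * deriv (X j) y + c * X j y) =
      exp y * (deriv (Z j) y - (\<Sum>k<N. A j k * Z k y))" by simp
qed

section \<open>The systems in the logarithmic coordinate\<close>

definition euler_system ::
    "nat \<Rightarrow> (nat \<Rightarrow> complex \<Rightarrow> complex) \<Rightarrow> complex mat \<Rightarrow> complex set \<Rightarrow> (nat \<Rightarrow> complex \<Rightarrow> complex) \<Rightarrow> bool" where
  "euler_system n \<phi> M Y f \<longleftrightarrow> (\<forall>j<n. f j holomorphic_on Y) \<and>
     (\<forall>y\<in>Y. \<forall>j<n. \<phi> j y * deriv (f j) y = (\<Sum>k<n. M $$ (j, k) * f k y))"

text \<open>The factor of d/dy in (x - t_j) d/dx for x = t0 + exp(-y): here dx/dy = - exp(-y), and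
  t_j - t0 = 1 / tau_j. The lower rows belong to the singular point t0 itself and have the weight
  -1.\<close>

definition ext_weight :: "nat \<Rightarrow> (nat \<Rightarrow> complex) \<Rightarrow> nat \<Rightarrow> complex \<Rightarrow> complex" where
  "ext_weight N \<tau> j y = (if j < N then exp y / \<tau> j - 1 else - 1)"

text \<open>The gauge factor that brings the second-order equation of the upper half into the form
  of \<open>transmutation_equation\<close>.\<close>

definition lift_u :: "(nat \<Rightarrow> complex) \<Rightarrow> complex \<Rightarrow> (nat \<Rightarrow> complex \<Rightarrow> complex) \<Rightarrow> nat \<Rightarrow> complex \<Rightarrow> complex" where
  "lift_u \<tau> \<sigma> X j y = \<tau> j * exp (- (\<sigma> + 1) * y) * X j y"

text \<open>The upper block row of the system solved for P times the lower half; \<open>lift\<close>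
  multiplies by Q to recover the lower half.\<close>

definition lift_z ::
    "nat \<Rightarrow> complex mat \<Rightarrow> (nat \<Rightarrow> complex) \<Rightarrow> (nat \<Rightarrow> complex \<Rightarrow> complex) \<Rightarrow> nat \<Rightarrow> complex \<Rightarrow> complex" where
  "lift_z N A \<tau> u j y = (exp y / \<tau> j - 1) * deriv (u j) y - (\<Sum>k<N. A $$ (j, k) * u k y)"

definition lift ::
    "nat \<Rightarrow> complex mat \<Rightarrow> complex mat \<Rightarrow> (nat \<Rightarrow> complex) \<Rightarrow> complex \<Rightarrow> (nat \<Rightarrow> complex \<Rightarrow> complex) \<Rightarrow> nat \<Rightarrow> complex \<Rightarrow> complex" where
  "lift N A Q \<tau> \<sigma> X j y = (if j < N then lift_u \<tau> \<sigma> X j y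
     else (\<Sum>k<N. Q $$ (j - N, k) * lift_z N A \<tau> (lift_u \<tau> \<sigma> X) k y))"

lemma sum_lessThan_split: "(\<Sum>k<N + m. f k) = (\<Sum>k<N. f k) + (\<Sum>k<m. f (N + k) :: complex)" for N m :: nat
  by (induction m) (simp_all add: add.assoc)

lemma mult_mat_vec_sum:
  "M \<in> carrier_mat N n \<Longrightarrow> M *\<^sub>v vec n f = vec N (\<lambda>j. \<Sum>k<n. M $$ (j, k) * f k)" for f :: "nat \<Rightarrow> complex"
  by (intro eq_vecI) (auto simp: scalar_prod_def atLeast0LessThan intro!: sum.cong)

lemma mult_shift_mat_vec:
  fixes f :: "nat \<Rightarrow> complex"
  assumes "M \<in> carrier_mat N N"
  shows "(M - c \<cdot>\<^sub>m 1\<^sub>m N) *\<^sub>v vec N f = vec N (\<lambda>j. (\<Sum>k<N. M $$ (j, k) * f k) - c * f j)"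
proof -
  have "(\<Sum>k<N. (M - c \<cdot>\<^sub>m 1\<^sub>m N) $$ (j, k) * f k) = (\<Sum>k<N. M $$ (j, k) * f k) - c * f j" if "j < N" for j
  proof -
    have "(\<Sum>k<N. (M - c \<cdot>\<^sub>m 1\<^sub>m N) $$ (j, k) * f k) = (\<Sum>k<N. M $$ (j, k) * f k - (if k = j then c * f k else 0))"
      by (rule sum.cong) (use that assms in \<open>auto simp: algebra_simps\<close>)
    then show ?thesis using that by (simp add: sum_subtractf)
  qed
  then show ?thesis using assms by (subst mult_mat_vec_sum[of _ N]) (auto intro!: eq_vecI)
qed

text \<open>A' - c is conjugate to A - c, so Q moves to the left. This expresses the lower blocks of
  \<open>ext_A\<close> through A.\<close>

lemma conj_shift_mat:
  assumes A: "A \<in> carrier_mat N N" and P: "P \<in> carrier_mat N N" and Q: "Q \<in> carrier_mat N N" and PQ: "P * Q = 1\<^sub>m N"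
  shows "(Q * A * P - c \<cdot>\<^sub>m 1\<^sub>m N) * Q = Q * (A - c \<cdot>\<^sub>m 1\<^sub>m N :: complex mat)"
proof -
  have "Q * A * P * Q = Q * A * (P * Q)" using assms by (intro assoc_mult_mat[of _ N N _ N _ N]) auto
  also have "\<dots> = Q * A" using assms by simp
  finally have 1: "Q * A * P * Q = Q * A" .
  have "(Q * A * P - c \<cdot>\<^sub>m 1\<^sub>m N) * Q = Q * A * P * Q - c \<cdot>\<^sub>m 1\<^sub>m N * Q"
    using assms by (intro minus_mult_distrib_mat[of _ N N _ _ N]) auto
  moreover have "Q * (A - c \<cdot>\<^sub>m 1\<^sub>m N) = Q * A - Q * (c \<cdot>\<^sub>m 1\<^sub>m N)"
    using assms by (intro mult_minus_distrib_mat[of _ N N _ N]) auto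
  moreover have "c \<cdot>\<^sub>m 1\<^sub>m N * Q = Q * (c \<cdot>\<^sub>m 1\<^sub>m N)"
    using Q by (simp add: mult_smult_assoc_mat[of _ N N _ N] mult_smult_distrib[of _ N N _ N])
  ultimately show ?thesis by (simp add: 1)
qed

lemma ext_A_carrier:
  "A \<in> carrier_mat N N \<Longrightarrow> A' \<in> carrier_mat N N \<Longrightarrow> ext_A N A P Q A' \<rho>\<^sub>1 \<rho>\<^sub>2 \<in> carrier_mat (N + N) (N + N)"
  unfolding ext_A_def by (rule four_block_carrier_mat) auto

text \<open>With v = Q z the coupling term P v is z. By conjugation the lower rows become -Q applied
  to (A - rho1)(A - rho2) u + (A - rho1 - rho2) z, so that A' disappears from the system for u and
  z.\<close>

lemma ext_A_sum:
  fixes \<rho>\<^sub>1 \<rho>\<^sub>2 :: complex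
  assumes A: "A \<in> carrier_mat N N" and P: "P \<in> carrier_mat N N" and Q: "Q \<in> carrier_mat N N"
    and PQ: "P * Q = 1\<^sub>m N"
  assumes v: "\<And>k. k < N \<Longrightarrow> v k = (\<Sum>l<N. Q $$ (k, l) * z l)"
    and j: "j < N"
  defines "M \<equiv> ext_A N A P Q (Q * A * P) \<rho>\<^sub>1 \<rho>\<^sub>2"
  shows "(\<Sum>k<N. M $$ (j, k) * u k) + (\<Sum>k<N. M $$ (j, N + k) * v k) = (\<Sum>k<N. A $$ (j, k) * u k) + z j"
    and "(\<Sum>k<N. M $$ (N + j, k) * u k) + (\<Sum>k<N. M $$ (N + j, N + k) * v k) =
      - (\<Sum>k<N. Q $$ (j, k) * ((\<Sum>l<N. A $$ (k, l) * ((\<Sum>i<N. A $$ (l, i) * u i) - \<rho>\<^sub>2 * u l)) - \<rho>\<^sub>1 * ((\<Sum>i<N. A $$ (k, i) * u i) - \<rho>\<^sub>2 * u k)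
         + (\<Sum>l<N. A $$ (k, l) * z l) - (\<rho>\<^sub>1 + \<rho>\<^sub>2) * z k))"
proof -
  define A' where "A' = Q * A * P"
  have A': "A' \<in> carrier_mat N N" using A P Q by (simp add: A'_def)
  have vv: "vec N v = Q *\<^sub>v vec N z"
    using v Q by (subst mult_mat_vec_sum[of _ N]) (auto intro!: eq_vecI)
  have entries: "M $$ (j, k) = A $$ (j, k)" "M $$ (j, N + k) = P $$ (j, k)"
    "M $$ (N + j, k) = - (((A' - \<rho>\<^sub>1 \<cdot>\<^sub>m 1\<^sub>m N) * (A' - \<rho>\<^sub>2 \<cdot>\<^sub>m 1\<^sub>m N) * Q) $$ (j, k))"
    "M $$ (N + j, N + k) = - ((A' - (\<rho>\<^sub>1 + \<rho>\<^sub>2) \<cdot>\<^sub>m 1\<^sub>m N) $$ (j, k))" if "k < N" for k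
    using that j A A' P Q by (auto simp: M_def ext_A_def A'_def[symmetric] algebra_simps)
  have "(\<Sum>k<N. M $$ (j, N + k) * v k) = (P *\<^sub>v vec N v) $ j"
    using P j by (subst mult_mat_vec_sum[of _ N]) (auto simp: entries intro!: sum.cong)
  also have "P *\<^sub>v vec N v = (P * Q) *\<^sub>v vec N z"
    unfolding vv using P Q by (intro assoc_mult_mat_vec[symmetric, of _ N N _ N]) auto
  also have "\<dots> = vec N z" using PQ by simp
  finally show "(\<Sum>k<N. M $$ (j, k) * u k) + (\<Sum>k<N. M $$ (j, N + k) * v k) = (\<Sum>k<N. A $$ (j, k) * u k) + z j"
    using j by (simp add: entries)
  let ?B1 = "A - \<rho>\<^sub>1 \<cdot>\<^sub>m 1\<^sub>m N" and ?B2 = "A - \<rho>\<^sub>2 \<cdot>\<^sub>m 1\<^sub>m N" and ?B3 = "A - (\<rho>\<^sub>1 + \<rho>\<^sub>2) \<cdot>\<^sub>m 1\<^sub>m N"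
  have "(A' - \<rho>\<^sub>1 \<cdot>\<^sub>m 1\<^sub>m N) * (A' - \<rho>\<^sub>2 \<cdot>\<^sub>m 1\<^sub>m N) * Q = (A' - \<rho>\<^sub>1 \<cdot>\<^sub>m 1\<^sub>m N) * ((A' - \<rho>\<^sub>2 \<cdot>\<^sub>m 1\<^sub>m N) * Q)"
    using A' Q by (intro assoc_mult_mat[of _ N N _ N _ N]) auto
  also have "(A' - \<rho>\<^sub>2 \<cdot>\<^sub>m 1\<^sub>m N) * Q = Q * ?B2" unfolding A'_def by (rule conj_shift_mat[OF A P Q PQ])
  also have "(A' - \<rho>\<^sub>1 \<cdot>\<^sub>m 1\<^sub>m N) * (Q * ?B2) = (A' - \<rho>\<^sub>1 \<cdot>\<^sub>m 1\<^sub>m N) * Q * ?B2"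
    using A A' Q by (intro assoc_mult_mat[symmetric, of _ N N _ N _ N]) auto
  also have "(A' - \<rho>\<^sub>1 \<cdot>\<^sub>m 1\<^sub>m N) * Q = Q * ?B1" unfolding A'_def by (rule conj_shift_mat[OF A P Q PQ])
  finally have M21: "(A' - \<rho>\<^sub>1 \<cdot>\<^sub>m 1\<^sub>m N) * (A' - \<rho>\<^sub>2 \<cdot>\<^sub>m 1\<^sub>m N) * Q = Q * ?B1 * ?B2" .
  have "(\<Sum>k<N. M $$ (N + j, k) * u k) = - ((Q * ?B1 * ?B2) *\<^sub>v vec N u) $ j"
    using A Q j by (subst mult_mat_vec_sum[of _ N]) (auto simp: entries M21 sum_negf)
  also have "(Q * ?B1 * ?B2) *\<^sub>v vec N u = (Q * ?B1) *\<^sub>v (?B2 *\<^sub>v vec N u)"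
    using A Q by (intro assoc_mult_mat_vec[of _ N N _ N]) auto
  also have "\<dots> = Q *\<^sub>v (?B1 *\<^sub>v (?B2 *\<^sub>v vec N u))"
    using A Q by (intro assoc_mult_mat_vec[of _ N N _ N]) (auto intro!: mult_mat_vec_carrier[of _ N N])
  finally have 1: "(\<Sum>k<N. M $$ (N + j, k) * u k) = - (Q *\<^sub>v (?B1 *\<^sub>v (?B2 *\<^sub>v vec N u))) $ j" .
  have "(\<Sum>k<N. M $$ (N + j, N + k) * v k) = - ((A' - (\<rho>\<^sub>1 + \<rho>\<^sub>2) \<cdot>\<^sub>m 1\<^sub>m N) *\<^sub>v vec N v) $ j"
    using A' j by (subst mult_mat_vec_sum[of _ N]) (auto simp: entries left_diff_distrib simp flip: sum_negf intro!: sum.cong)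
  also have "(A' - (\<rho>\<^sub>1 + \<rho>\<^sub>2) \<cdot>\<^sub>m 1\<^sub>m N) *\<^sub>v vec N v = ((A' - (\<rho>\<^sub>1 + \<rho>\<^sub>2) \<cdot>\<^sub>m 1\<^sub>m N) * Q) *\<^sub>v vec N z"
    unfolding vv using A' Q by (intro assoc_mult_mat_vec[symmetric, of _ N N _ N]) auto
  also have "(A' - (\<rho>\<^sub>1 + \<rho>\<^sub>2) \<cdot>\<^sub>m 1\<^sub>m N) * Q = Q * ?B3" unfolding A'_def by (rule conj_shift_mat[OF A P Q PQ])
  also have "(Q * ?B3) *\<^sub>v vec N z = Q *\<^sub>v (?B3 *\<^sub>v vec N z)"
    using A Q by (intro assoc_mult_mat_vec[of _ N N _ N]) auto
  finally have 2: "(\<Sum>k<N. M $$ (N + j, N + k) * v k) = - (Q *\<^sub>v (?B3 *\<^sub>v vec N z)) $ j" .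
  show "(\<Sum>k<N. M $$ (N + j, k) * u k) + (\<Sum>k<N. M $$ (N + j, N + k) * v k) =
      - (\<Sum>k<N. Q $$ (j, k) * ((\<Sum>l<N. A $$ (k, l) * ((\<Sum>i<N. A $$ (l, i) * u i) - \<rho>\<^sub>2 * u l)) - \<rho>\<^sub>1 * ((\<Sum>i<N. A $$ (k, i) * u i) - \<rho>\<^sub>2 * u k)
         + (\<Sum>l<N. A $$ (k, l) * z l) - (\<rho>\<^sub>1 + \<rho>\<^sub>2) * z k))"
    unfolding 1 2 using A Q j
    by (simp add: mult_shift_mat_vec mult_mat_vec_sum ring_distribs sum.distrib sum_subtractf)
qed

text \<open>The upper rows hold by the choice of \<open>lift_z\<close>. The lower rows reduce to z'
  = (A - rho1)(A - rho2) u + (A - sigma) z, and with the gauge factor of \<open>lift_u\<close> this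
  is the hypothesis on \<open>X\<close> multiplied by exp(-(sigma + 1) y).\<close>

lemma lift_system:
  fixes \<rho>\<^sub>1 \<rho>\<^sub>2 :: complex
  assumes A: "A \<in> carrier_mat N N" and P: "P \<in> carrier_mat N N" and Q: "Q \<in> carrier_mat N N"
    and PQ: "P * Q = 1\<^sub>m N" and \<tau>: "\<And>j. j < N \<Longrightarrow> \<tau> j \<noteq> 0" and Y: "open Y"
    and X: "\<And>j. j < N \<Longrightarrow> X j holomorphic_on Y"
  defines "\<sigma> \<equiv> \<rho>\<^sub>1 + \<rho>\<^sub>2"
  defines "Z \<equiv> \<lambda>j y. deriv (X j) y - (\<sigma> + 1) * X j y"
  assumes eq: "\<And>j y. j < N \<Longrightarrow> y \<in> Y \<Longrightarrow>
      \<tau> j * (deriv (deriv (X j)) y - (\<sigma> + 2) * deriv (X j) y + (\<rho>\<^sub>1 + 1) * (\<rho>\<^sub>2 + 1) * X j y) =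
      exp y * (deriv (Z j) y - (\<Sum>k<N. A $$ (j, k) * Z k y))"
  shows "euler_system (2 * N) (ext_weight N \<tau>) (ext_A N A P Q (Q * A * P) \<rho>\<^sub>1 \<rho>\<^sub>2) Y (lift N A Q \<tau> \<sigma> X)"
proof -
  define u where "u = lift_u \<tau> \<sigma> X"
  define z where "z = lift_z N A \<tau> u"
  define E where "E = (\<lambda>y. exp (- (\<sigma> + 1) * y))"
  have E: "exp y * E y = exp (- \<sigma> * y)" for y
    unfolding E_def exp_add[symmetric] by (simp add: algebra_simps)
  have Xd: "(X j has_field_derivative deriv (X j) y) (at y)"
    "(deriv (X j) has_field_derivative deriv (deriv (X j)) y) (at y)" if "j < N" "y \<in> Y" for j y
    using X[OF that(1)] Y that by (auto intro!: holomorphic_derivI holomorphic_intros)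
  have Zd: "(Z j has_field_derivative deriv (deriv (X j)) y - (\<sigma> + 1) * deriv (X j) y) (at y)" if "j < N" "y \<in> Y" for j y
    unfolding Z_def using Xd[OF that] by (auto intro!: derivative_eq_intros)
  note dZ = DERIV_imp_deriv[OF Zd]
  have ud: "(u j has_field_derivative \<tau> j * E y * Z j y) (at y)" if "j < N" "y \<in> Y" for j y
    unfolding u_def lift_u_def[abs_def] Z_def E_def using Xd[OF that]
    by (auto intro!: derivative_eq_intros simp: algebra_simps)
  have z_eq: "z j y = exp (- \<sigma> * y) * Z j y - \<tau> j * E y * Z j y - (\<Sum>k<N. A $$ (j, k) * u k y)" if "j < N" "y \<in> Y" for j y
    unfolding z_def lift_z_def DERIV_imp_deriv[OF ud[OF that]] using \<tau>[OF that(1)] E[of y, symmetric]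
    by (simp add: field_simps)
  have zd: "(z j has_field_derivative exp (- \<sigma> * y) * (deriv (Z j) y - \<sigma> * Z j y) -
      \<tau> j * E y * (deriv (Z j) y - (\<sigma> + 1) * Z j y) - (\<Sum>k<N. A $$ (j, k) * (\<tau> k * E y * Z k y))) (at y)"
    if jy: "j < N" "y \<in> Y" for j y
  proof -
    have Ed: "(E has_field_derivative - (\<sigma> + 1) * E y) (at y)"
      unfolding E_def by (auto intro!: derivative_eq_intros)
    have "((\<lambda>y. exp (- \<sigma> * y) * Z j y - \<tau> j * E y * Z j y - (\<Sum>k<N. A $$ (j, k) * u k y)) has_field_derivative
      exp (- \<sigma> * y) * (deriv (Z j) y - \<sigma> * Z j y) -
      \<tau> j * E y * (deriv (Z j) y - (\<sigma> + 1) * Z j y) - (\<Sum>k<N. A $$ (j, k) * (\<tau> k * E y * Z k y))) (at y)"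
      using Zd[OF jy] ud[OF _ jy(2)] Ed unfolding dZ[OF jy]
      by (auto intro!: derivative_eq_intros simp: algebra_simps)
    moreover have "eventually (\<lambda>y. y \<in> Y) (nhds y)" using Y jy(2) by (rule eventually_nhds_in_open)
    then have "eventually (\<lambda>y. z j y = exp (- \<sigma> * y) * Z j y - \<tau> j * E y * Z j y - (\<Sum>k<N. A $$ (j, k) * u k y)) (nhds y)"
      by eventually_elim (use z_eq jy in auto)
    ultimately show ?thesis by (subst DERIV_cong_ev[OF refl _ refl]) auto
  qed
  have zODE: "deriv (z j) y = (\<Sum>l<N. A $$ (j, l) * ((\<Sum>i<N. A $$ (l, i) * u i y) - \<rho>\<^sub>2 * u l y)) - \<rho>\<^sub>1 * ((\<Sum>i<N. A $$ (j, i) * u i y) - \<rho>\<^sub>2 * u j y)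
         + (\<Sum>l<N. A $$ (j, l) * z l y) - \<sigma> * z j y" if jy: "j < N" "y \<in> Y" for j y
  proof -
    have s: "(\<Sum>l<N. A $$ (j, l) * z l y) = exp (- \<sigma> * y) * (\<Sum>l<N. A $$ (j, l) * Z l y) -
       (\<Sum>l<N. A $$ (j, l) * (\<tau> l * E y * Z l y)) - (\<Sum>l<N. A $$ (j, l) * (\<Sum>i<N. A $$ (l, i) * u i y))"
      using z_eq jy(2) by (simp add: right_diff_distrib sum_subtractf sum_distrib_left mult_ac)
    have e1: "E y * (\<tau> j * (deriv (deriv (X j)) y - (\<sigma> + 2) * deriv (X j) y + (\<rho>\<^sub>1 + 1) * (\<rho>\<^sub>2 + 1) * X j y)) =
      exp (- \<sigma> * y) * (deriv (Z j) y - (\<Sum>k<N. A $$ (j, k) * Z k y))"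
      unfolding eq[OF jy] E[symmetric] by (simp add: mult_ac)
    have e2: "E y * (\<tau> j * (deriv (deriv (X j)) y - (\<sigma> + 2) * deriv (X j) y + (\<rho>\<^sub>1 + 1) * (\<rho>\<^sub>2 + 1) * X j y)) =
      \<tau> j * E y * (deriv (Z j) y - (\<sigma> + 1) * Z j y) + \<sigma> * (\<tau> j * E y * Z j y) + \<rho>\<^sub>1 * \<rho>\<^sub>2 * u j y"
      unfolding dZ[OF jy] unfolding Z_def u_def lift_u_def E_def by (simp add: \<sigma>_def algebra_simps)
    have t: "(\<Sum>l<N. A $$ (j, l) * ((\<Sum>i<N. A $$ (l, i) * u i y) - \<rho>\<^sub>2 * u l y)) =
        (\<Sum>l<N. A $$ (j, l) * (\<Sum>i<N. A $$ (l, i) * u i y)) - \<rho>\<^sub>2 * (\<Sum>i<N. A $$ (j, i) * u i y)"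
      by (simp add: right_diff_distrib sum_subtractf sum_distrib_left mult.left_commute)
    \<comment> \<open>Here \<open>F\<close> stands for exp(-sigma y), \<open>e\<close> for tau E,
      and \<open>a1\<close>, \<open>a2\<close>, \<open>a3\<close> for the matrix sums over Z, over
      tau E Z and over A u.\<close>
    have alg: "F * (dz - \<sigma> * zz) - e * (dz - (\<sigma> + 1) * zz) - a2 =
        (a3 - \<rho>\<^sub>2 * b) - \<rho>\<^sub>1 * (b - \<rho>\<^sub>2 * v) + (F * a1 - a2 - a3) - \<sigma> * (F * zz - e * zz - b)"
      if "F * (dz - a1) = e * (dz - (\<sigma> + 1) * zz) + \<sigma> * (e * zz) + \<rho>\<^sub>1 * \<rho>\<^sub>2 * v" for F dz zz e a1 a2 a3 b v :: complex
    proof -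
      have "F * (dz - \<sigma> * zz) - e * (dz - (\<sigma> + 1) * zz) - a2 -
        ((a3 - \<rho>\<^sub>2 * b) - \<rho>\<^sub>1 * (b - \<rho>\<^sub>2 * v) + (F * a1 - a2 - a3) - \<sigma> * (F * zz - e * zz - b)) =
        F * (dz - a1) - (e * (dz - (\<sigma> + 1) * zz) + \<sigma> * (e * zz) + \<rho>\<^sub>1 * \<rho>\<^sub>2 * v)"
        by (simp add: \<sigma>_def algebra_simps)
      then show ?thesis unfolding that diff_self by (rule iffD2[OF eq_iff_diff_eq_0])
    qed
    show ?thesis
      unfolding DERIV_imp_deriv[OF zd[OF jy]] s z_eq[OF jy] t
      by (rule alg[OF trans[OF e1[symmetric] e2]])
  qed
  define V where "V = lift N A Q \<tau> \<sigma> X"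
  have V1: "V j = u j" if "j < N" for j by (rule ext) (simp add: V_def lift_def u_def that)
  have V2: "V (N + j) = (\<lambda>y. \<Sum>k<N. Q $$ (j, k) * z k y)" for j
    by (rule ext) (simp add: V_def lift_def u_def[symmetric] z_def)
  have V2d: "(V (N + j) has_field_derivative (\<Sum>k<N. Q $$ (j, k) * deriv (z k) y)) (at y)" if "y \<in> Y" for j y
  proof -
    have "(z k has_field_derivative deriv (z k) y) (at y)" if "k < N" for k
      unfolding DERIV_imp_deriv[OF zd[OF that \<open>y \<in> Y\<close>]] by (rule zd[OF that \<open>y \<in> Y\<close>])
    then show ?thesis unfolding V2 by (intro DERIV_sum DERIV_cmult) simp
  qed
  have hol: "V j holomorphic_on Y" if "j < 2 * N" for j
  proof (cases "j < N")
    case True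
    then show ?thesis using ud[OF True] Y by (auto simp: V1 holomorphic_on_open)
  next
    case False
    then have "V j = V (N + (j - N))" by simp
    then show ?thesis using V2d Y by (auto simp: holomorphic_on_open)
  qed
  have sys: "ext_weight N \<tau> j y * deriv (V j) y = (\<Sum>k<2 * N. ext_A N A P Q (Q * A * P) \<rho>\<^sub>1 \<rho>\<^sub>2 $$ (j, k) * V k y)"
    if y: "y \<in> Y" and j: "j < 2 * N" for y j
  proof -
    let ?M = "ext_A N A P Q (Q * A * P) \<rho>\<^sub>1 \<rho>\<^sub>2"
    have split: "(\<Sum>k<2 * N. ?M $$ (j, k) * V k y) = (\<Sum>k<N. ?M $$ (j, k) * u k y) + (\<Sum>k<N. ?M $$ (j, N + k) * V (N + k) y)"
      using sum_lessThan_split[of "\<lambda>k. ?M $$ (j, k) * V k y" N N] V1 by (simp add: mult_2)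
    have v: "V (N + k) y = (\<Sum>l<N. Q $$ (k, l) * z l y)" for k by (simp add: V2)
    show ?thesis
    proof (cases "j < N")
      case True
      have "ext_weight N \<tau> j y * deriv (V j) y = (\<Sum>k<N. A $$ (j, k) * u k y) + z j y"
        using True by (simp add: ext_weight_def V1 z_def lift_z_def)
      then show ?thesis
        unfolding split using ext_A_sum(1)[OF A P Q PQ v True, of \<rho>\<^sub>1 \<rho>\<^sub>2 "\<lambda>k. u k y"] by simp
    next
      case False
      define i where "i = j - N"
      have i: "i < N" "j = N + i" using False j by (auto simp: i_def)
      have "ext_weight N \<tau> j y * deriv (V j) y = - (\<Sum>k<N. Q $$ (i, k) * deriv (z k) y)"
        using False i DERIV_imp_deriv[OF V2d[OF y, of i]] by (simp add: ext_weight_def)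
      also have "\<dots> = - (\<Sum>k<N. Q $$ (i, k) * ((\<Sum>l<N. A $$ (k, l) * ((\<Sum>i<N. A $$ (l, i) * u i y) - \<rho>\<^sub>2 * u l y)) - \<rho>\<^sub>1 * ((\<Sum>i<N. A $$ (k, i) * u i y) - \<rho>\<^sub>2 * u k y)
         + (\<Sum>l<N. A $$ (k, l) * z l y) - \<sigma> * z k y))"
        using zODE[OF _ y] by simp
      also have "\<dots> = (\<Sum>k<N. ?M $$ (N + i, k) * u k y) + (\<Sum>k<N. ?M $$ (N + i, N + k) * V (N + k) y)"
        unfolding \<sigma>_def by (rule ext_A_sum(2)[OF A P Q PQ v i(1), of \<rho>\<^sub>1 \<rho>\<^sub>2 "\<lambda>k. u k y", symmetric])
      finally show ?thesis unfolding split by (simp only: i(2))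
    qed
  qed
  show ?thesis unfolding euler_system_def V_def[symmetric] using hol sys by blast
qed

text \<open>\<open>lift_z\<close> contains u', so the lift as a whole has the exponent beta - 1. The
  upper entries keep beta, which shows as a zero of the regular factor. Its derivative is the
  leading coefficient for beta; where tau_j = exp c, the gauge factor at c is exp(-sigma c).\<close>

lemma lift_branch:
  assumes Y: "side_domain Y c" and X: "\<And>j. j < N \<Longrightarrow> has_branch Y c \<beta> (X j) (H j)" and \<tau>: "\<And>j. j < N \<Longrightarrow> \<tau> j \<noteq> 0"
  obtains K where "\<And>j. j < 2 * N \<Longrightarrow> has_branch Y c (\<beta> - 1) (lift N A Q \<tau> \<sigma> X j) (K j)"
    "\<And>j. j < N \<Longrightarrow> \<tau> j = exp c \<Longrightarrow> K j c = 0 \<and> deriv (K j) c = exp (- \<sigma> * c) * H j c"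
proof -
  define u where "u = lift_u \<tau> \<sigma> X"
  define h where "h = (\<lambda>j y. \<tau> j * exp (- (\<sigma> + 1) * y) * H j y)"
  have u: "has_branch Y c \<beta> (u j) (h j)" if "j < N" for j
    unfolding u_def lift_u_def[abs_def] h_def
    by (rule has_branch_mult[OF X[OF that], of UNIV]) (auto intro!: holomorphic_intros)
  define k where "k = (\<lambda>j y. (y - c) * h j y)"
  have u': "has_branch Y c (\<beta> - 1) (u j) (k j)" if "j < N" for j
    unfolding k_def using u[OF that] by (intro has_branch_raise[OF Y]) simp
  have "\<exists>K. has_branch Y c (\<beta> - 1) (lift_z N A \<tau> u j) K" if "j < N" for j
  proof -
    have "has_branch Y c (\<beta> - 1) (\<lambda>y. (exp y / \<tau> j - 1) * deriv (u j) y) (\<lambda>y. (exp y / \<tau> j - 1) * (\<beta> * h j y + (y - c) * deriv (h j) y))"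
      by (rule has_branch_mult[OF has_branch_deriv[OF Y u[OF that]], of UNIV])
        (use \<tau>[OF that] in \<open>auto intro!: holomorphic_intros\<close>)
    moreover have "has_branch Y c (\<beta> - 1) (\<lambda>y. (-1) * (\<Sum>k<N. A $$ (j, k) * u k y)) (\<lambda>y. (-1) * (\<Sum>l<N. A $$ (j, l) * k l y))"
      by (intro has_branch_const_mult has_branch_sum u') simp
    ultimately have "has_branch Y c (\<beta> - 1) (\<lambda>y. (exp y / \<tau> j - 1) * deriv (u j) y + (-1) * (\<Sum>k<N. A $$ (j, k) * u k y))
      (\<lambda>y. (exp y / \<tau> j - 1) * (\<beta> * h j y + (y - c) * deriv (h j) y) + (-1) * (\<Sum>l<N. A $$ (j, l) * k l y))"
      by (rule has_branch_add)
    then show ?thesis by (auto simp: lift_z_def[abs_def])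
  qed
  then obtain L where L: "\<And>j. j < N \<Longrightarrow> has_branch Y c (\<beta> - 1) (lift_z N A \<tau> u j) (L j)" by metis
  define K where "K = (\<lambda>j. if j < N then k j else (\<lambda>y. \<Sum>l<N. Q $$ (j - N, l) * L l y))"
  show ?thesis
  proof
    fix j assume "j < 2 * N"
    show "has_branch Y c (\<beta> - 1) (lift N A Q \<tau> \<sigma> X j) (K j)"
    proof (cases "j < N")
      case True
      then show ?thesis using u'[OF True] by (simp add: lift_def[abs_def] K_def u_def)
    next
      case False
      have "has_branch Y c (\<beta> - 1) (\<lambda>y. \<Sum>l<N. Q $$ (j - N, l) * lift_z N A \<tau> u l y) (\<lambda>y. \<Sum>l<N. Q $$ (j - N, l) * L l y)"
        by (intro has_branch_sum has_branch_const_mult L) simp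
      then show ?thesis using False by (simp add: lift_def[abs_def] K_def u_def)
    qed
  next
    fix j assume j: "j < N" and \<tau>j: "\<tau> j = exp c"
    obtain \<epsilon> where e: "0 < \<epsilon>" "h j holomorphic_on ball c \<epsilon>"
      using u[OF j] by (rule has_branchE) blast
    have "(h j has_field_derivative deriv (h j) c) (at c)" using e by (auto intro: holomorphic_derivI)
    then have "(k j has_field_derivative h j c) (at c)"
      unfolding k_def by (auto intro!: derivative_eq_intros)
    then have "deriv (k j) c = h j c" by (rule DERIV_imp_deriv)
    moreover have "exp c * exp (- (\<sigma> + 1) * c) = exp (- \<sigma> * c)" by (simp add: exp_add[symmetric] algebra_simps)
    ultimately show "K j c = 0 \<and> deriv (K j) c = exp (- \<sigma> * c) * H j c"
      using j by (simp add: K_def k_def h_def \<tau>j)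
  qed
qed

lemma lift_holomorphic:
  assumes "open W" "\<And>j. j < N \<Longrightarrow> G j holomorphic_on W" "\<And>j. j < N \<Longrightarrow> \<tau> j \<noteq> 0" "j < 2 * N"
  shows "lift N A Q \<tau> \<sigma> G j holomorphic_on W"
proof -
  have u: "lift_u \<tau> \<sigma> G j holomorphic_on W" if "j < N" for j
    unfolding lift_u_def[abs_def] by (intro holomorphic_intros assms(2) that)
  have "lift_z N A \<tau> (lift_u \<tau> \<sigma> G) j holomorphic_on W" if "j < N" for j
    unfolding lift_z_def[abs_def] using assms(1,3) u that by (auto intro!: holomorphic_intros)
  then have "(\<lambda>y. \<Sum>k<N. Q $$ (j - N, k) * lift_z N A \<tau> (lift_u \<tau> \<sigma> G) k y) holomorphic_on W"
    by (intro holomorphic_intros) auto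
  then show ?thesis using u by (cases "j < N") (auto simp: lift_def[abs_def])
qed

lemma lift_linear:
  fixes c :: "'i \<Rightarrow> complex"
  assumes Y: "open Y" and I: "finite I"
    and hol: "\<And>i j. i \<in> I \<Longrightarrow> j < N \<Longrightarrow> X i j holomorphic_on Y" "\<And>j. j < N \<Longrightarrow> G j holomorphic_on Y"
    and rel: "\<And>j y. j < N \<Longrightarrow> y \<in> Y \<Longrightarrow> X0 j y = (\<Sum>i\<in>I. c i * X i j y) + G j y"
    and y: "y \<in> Y"
  shows "lift N A Q \<tau> \<sigma> X0 j y = (\<Sum>i\<in>I. c i * lift N A Q \<tau> \<sigma> (X i) j y) + lift N A Q \<tau> \<sigma> G j y"
proof -
  have u: "lift_u \<tau> \<sigma> X0 j y = (\<Sum>i\<in>I. c i * lift_u \<tau> \<sigma> (X i) j y) + lift_u \<tau> \<sigma> G j y" if "j < N" "y \<in> Y" for j y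
    using rel[OF that] by (simp add: lift_u_def distrib_left sum_distrib_left mult_ac)
  have du: "deriv (lift_u \<tau> \<sigma> X0 j) y = (\<Sum>i\<in>I. c i * deriv (lift_u \<tau> \<sigma> (X i) j) y) + deriv (lift_u \<tau> \<sigma> G j) y" if j: "j < N" for j
  proof -
    have h: "lift_u \<tau> \<sigma> F j holomorphic_on Y" if "F j holomorphic_on Y" for F
      unfolding lift_u_def[abs_def] by (intro holomorphic_intros that)
    have "deriv (lift_u \<tau> \<sigma> X0 j) y = deriv (\<lambda>y. (\<Sum>i\<in>I. c i * lift_u \<tau> \<sigma> (X i) j y) + lift_u \<tau> \<sigma> G j y) y"
      by (rule deriv_cong_ev[OF eventually_mono[OF eventually_nhds_in_open[OF Y y]] refl]) (use u j in auto)
    also have "((\<lambda>y. (\<Sum>i\<in>I. c i * lift_u \<tau> \<sigma> (X i) j y) + lift_u \<tau> \<sigma> G j y) has_field_derivative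
        (\<Sum>i\<in>I. c i * deriv (lift_u \<tau> \<sigma> (X i) j) y) + deriv (lift_u \<tau> \<sigma> G j) y) (at y)"
      by (intro DERIV_add DERIV_sum DERIV_cmult holomorphic_derivI[OF h Y y] hol j)
    then have "deriv (\<lambda>y. (\<Sum>i\<in>I. c i * lift_u \<tau> \<sigma> (X i) j y) + lift_u \<tau> \<sigma> G j y) y =
        (\<Sum>i\<in>I. c i * deriv (lift_u \<tau> \<sigma> (X i) j) y) + deriv (lift_u \<tau> \<sigma> G j) y"
      by (rule DERIV_imp_deriv)
    finally show ?thesis .
  qed
  have sw: "(\<Sum>k<N. M k * (\<Sum>i\<in>I. c i * F i k)) = (\<Sum>i\<in>I. c i * (\<Sum>k<N. M k * F i k))" for M and F :: "'i \<Rightarrow> nat \<Rightarrow> complex"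
    unfolding sum_distrib_left by (subst sum.swap) (simp add: mult_ac)
  have z: "lift_z N A \<tau> (lift_u \<tau> \<sigma> X0) j y =
      (\<Sum>i\<in>I. c i * lift_z N A \<tau> (lift_u \<tau> \<sigma> (X i)) j y) + lift_z N A \<tau> (lift_u \<tau> \<sigma> G) j y" if j: "j < N" for j
  proof -
    have "(\<Sum>k<N. A $$ (j, k) * lift_u \<tau> \<sigma> X0 k y) =
       (\<Sum>k<N. A $$ (j, k) * (\<Sum>i\<in>I. c i * lift_u \<tau> \<sigma> (X i) k y)) + (\<Sum>k<N. A $$ (j, k) * lift_u \<tau> \<sigma> G k y)"
      using u y by (simp add: distrib_left sum.distrib)
    then show ?thesis
      unfolding lift_z_def du[OF j] sw
      by (simp add: distrib_left right_diff_distrib sum_subtractf sum_distrib_left mult_ac)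
  qed
  have "(\<Sum>k<N. Q $$ (j - N, k) * lift_z N A \<tau> (lift_u \<tau> \<sigma> X0) k y) =
      (\<Sum>k<N. Q $$ (j - N, k) * (\<Sum>i\<in>I. c i * lift_z N A \<tau> (lift_u \<tau> \<sigma> (X i)) k y)) +
      (\<Sum>k<N. Q $$ (j - N, k) * lift_z N A \<tau> (lift_u \<tau> \<sigma> G) k y)"
    using z by (simp add: distrib_left sum.distrib)
  then show ?thesis using u[OF _ y] unfolding sw by (cases "j < N") (simp_all add: lift_def)
qed

text \<open>The underlying system with parameter 0 in the coordinate zeta = eta0 + exp y, where
  (zeta - t'_j) d/dzeta becomes (1 - tau_j exp(-y)) d/dy. Nonintegrality of the exponent survives
  integer shifts and provides the nonzero exponent that \<open>has_branch_integrate\<close> asks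
  for.\<close>

definition germ ::
    "nat \<Rightarrow> (nat \<Rightarrow> complex) \<Rightarrow> complex mat \<Rightarrow> complex set \<Rightarrow> complex \<Rightarrow> complex \<Rightarrow> (nat \<Rightarrow> complex \<Rightarrow> complex) \<Rightarrow> (nat \<Rightarrow> complex \<Rightarrow> complex) \<Rightarrow> bool" where
  "germ N \<tau> A Y c l h w \<longleftrightarrow> euler_system N (\<lambda>j y. 1 - \<tau> j * exp (- y)) A Y w \<and>
     (\<forall>j<N. has_branch Y c l (w j) (h j)) \<and> l \<notin> \<int>"

text \<open>
  Writing the branch with exponent \<open>l - 1\<close> makes the definition stable under the differentiations
  that shift \<open>l\<close>; the leading coefficient for the exponent \<open>l\<close> is then \<open>deriv (K j) c\<close>.
\<close>
definition lifted ::
    "nat \<Rightarrow> (nat \<Rightarrow> complex) \<Rightarrow> complex mat \<Rightarrow> complex mat \<Rightarrow> complex mat \<Rightarrow> complex \<Rightarrow> complex \<Rightarrow> complex set \<Rightarrow> complex \<Rightarrow> complex \<Rightarrow>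
     (nat \<Rightarrow> complex \<Rightarrow> complex) \<Rightarrow> (nat \<Rightarrow> complex \<Rightarrow> complex) \<Rightarrow> bool" where
  "lifted N \<tau> P Q A \<rho>\<^sub>1 \<rho>\<^sub>2 Y c l h V \<longleftrightarrow>
     euler_system (2 * N) (ext_weight N \<tau>) (ext_A N A P Q (Q * A * P) \<rho>\<^sub>1 \<rho>\<^sub>2) Y V \<and>
     (\<exists>K. (\<forall>j<2*N. has_branch Y c (l - 1) (V j) (K j)) \<and>
          (\<forall>j<N. \<tau> j = exp c \<longrightarrow> K j c = 0 \<and> deriv (K j) c = exp (- (\<rho>\<^sub>1 + \<rho>\<^sub>2) * c) * h j c))"

definition connected_at ::
    "nat \<Rightarrow> complex set \<Rightarrow> complex \<Rightarrow> 'i set \<Rightarrow> ('i \<Rightarrow> complex) \<Rightarrow> (nat \<Rightarrow> complex \<Rightarrow> complex) \<Rightarrow> ('i \<Rightarrow> nat \<Rightarrow> complex \<Rightarrow> complex) \<Rightarrow> bool" where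
  "connected_at n Y b I c f\<^sub>0 f \<longleftrightarrow> (\<exists>W g. open W \<and> b \<in> W \<and> (\<forall>j<n. g j holomorphic_on (Y \<union> W)) \<and>
     (\<forall>y\<in>Y. \<forall>j<n. f\<^sub>0 j y = (\<Sum>i\<in>I. c i * f i j y) + g j y))"

text \<open>If W solves the system with A + 1, then dW/dzeta solves the one with A. Conversely the
  system recovers W from w = dW/dzeta algebraically, as (A + 1)^(-1) (zeta - T') w, without a
  constant of integration. As the y-derivative of W is exp y w, the new leading coefficient follows
  from \<open>has_branch_integrate\<close>.\<close>

lemma germ_shift:
  assumes A: "A \<in> carrier_mat N N" and B: "B \<in> carrier_mat N N"
    and BA: "B * (A + 1\<^sub>m N) = 1\<^sub>m N" "(A + 1\<^sub>m N) * B = 1\<^sub>m N"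
    and Y: "side_domain Y c" and w: "germ N \<tau> A Y c l h w"
  defines "W \<equiv> \<lambda>j y. \<Sum>k<N. B $$ (j, k) * ((exp y - \<tau> k) * w k y)"
  obtains h' where "germ N \<tau> (A + 1\<^sub>m N) Y c (l + 1) h' W" "\<And>j. j < N \<Longrightarrow> (l + 1) * h' j c = exp c * h j c"
proof -
  have op: "open Y" using Y by (simp add: side_domain_def)
  have sys: "j < N \<Longrightarrow> w j holomorphic_on Y" "j < N \<Longrightarrow> y \<in> Y \<Longrightarrow> (1 - \<tau> j * exp (- y)) * deriv (w j) y = (\<Sum>k<N. A $$ (j, k) * w k y)"
    and br: "j < N \<Longrightarrow> has_branch Y c l (w j) (h j)" and l: "l \<notin> \<int>" for j y
    using w by (auto simp: germ_def euler_system_def)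
  define x where "x = (\<lambda>k y. (exp y - \<tau> k) * w k y)"
  have Wx: "W j y = (\<Sum>k<N. B $$ (j, k) * x k y)" for j y by (simp add: W_def x_def)
  have xd: "(x j has_field_derivative exp y * (\<Sum>k<N. (A + 1\<^sub>m N) $$ (j, k) * w k y)) (at y)" if jy: "j < N" "y \<in> Y" for j y
  proof -
    have "(w j has_field_derivative deriv (w j) y) (at y)" using sys(1) op jy by (auto intro: holomorphic_derivI)
    then have "(x j has_field_derivative exp y * w j y + (exp y - \<tau> j) * deriv (w j) y) (at y)"
      unfolding x_def by (auto intro!: derivative_eq_intros)
    also have "(exp y - \<tau> j) * deriv (w j) y = exp y * ((1 - \<tau> j * exp (- y)) * deriv (w j) y)"
      by (simp add: exp_minus field_simps)
    also have "\<dots> = exp y * (\<Sum>k<N. A $$ (j, k) * w k y)" unfolding sys(2)[OF jy] ..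
    also have "exp y * w j y + \<dots> = exp y * (\<Sum>k<N. (A + 1\<^sub>m N) $$ (j, k) * w k y)"
    proof -
      have "(\<Sum>k<N. (A + 1\<^sub>m N) $$ (j, k) * w k y) = (\<Sum>k<N. A $$ (j, k) * w k y + (if k = j then w k y else 0))"
        by (rule sum.cong) (use A jy in \<open>auto simp: algebra_simps\<close>)
      then show ?thesis using jy by (simp add: sum.distrib algebra_simps)
    qed
    finally show ?thesis .
  qed
  have inv: "(\<Sum>k<N. M $$ (j, k) * (\<Sum>i<N. M' $$ (k, i) * f i)) = f j"
    if "M \<in> carrier_mat N N" "M' \<in> carrier_mat N N" "M * M' = 1\<^sub>m N" "j < N" for M M' :: "complex mat" and f j
  proof -
    have "M *\<^sub>v (M' *\<^sub>v vec N f) = (M * M') *\<^sub>v vec N f"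
      using that by (intro assoc_mult_mat_vec[symmetric, of _ N N _ N]) auto
    then have "M *\<^sub>v (M' *\<^sub>v vec N f) = vec N f" using that by simp
    moreover have "(M *\<^sub>v (M' *\<^sub>v vec N f)) $ j = (\<Sum>k<N. M $$ (j, k) * (\<Sum>i<N. M' $$ (k, i) * f i))"
      using that by (simp add: mult_mat_vec_sum)
    ultimately show ?thesis using that by simp
  qed
  have A1: "A + 1\<^sub>m N \<in> carrier_mat N N" using A by simp
  have Wd: "(W j has_field_derivative exp y * w j y) (at y)" if jy: "j < N" "y \<in> Y" for j y
  proof -
    have "((\<lambda>y. \<Sum>k<N. B $$ (j, k) * x k y) has_field_derivative
       (\<Sum>k<N. B $$ (j, k) * (exp y * (\<Sum>i<N. (A + 1\<^sub>m N) $$ (k, i) * w i y)))) (at y)"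
      by (intro DERIV_sum DERIV_cmult xd jy) simp
    moreover have "(\<Sum>k<N. B $$ (j, k) * (exp y * (\<Sum>i<N. (A + 1\<^sub>m N) $$ (k, i) * w i y))) =
        exp y * (\<Sum>k<N. B $$ (j, k) * (\<Sum>i<N. (A + 1\<^sub>m N) $$ (k, i) * w i y))"
      by (subst sum_distrib_left) (rule sum.cong, auto)
    ultimately show ?thesis unfolding Wx[abs_def] using inv[OF B A1 BA(1) jy(1), of "\<lambda>i. w i y"] by simp
  qed
  have eul: "euler_system N (\<lambda>j y. 1 - \<tau> j * exp (- y)) (A + 1\<^sub>m N) Y W"
    unfolding euler_system_def
  proof (intro conjI allI impI ballI)
    fix j assume j: "j < N"
    show "W j holomorphic_on Y" using Wd[OF j] op by (auto simp: holomorphic_on_open)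
    fix y assume y: "y \<in> Y"
    have "(1 - \<tau> j * exp (- y)) * deriv (W j) y = x j y"
      unfolding DERIV_imp_deriv[OF Wd[OF j y]] x_def by (simp add: exp_minus field_simps)
    then show "(1 - \<tau> j * exp (- y)) * deriv (W j) y = (\<Sum>k<N. (A + 1\<^sub>m N) $$ (j, k) * W k y)"
      unfolding Wx using inv[OF A1 B BA(2) j, of "\<lambda>i. x i y"] by simp
  qed
  have "\<exists>G. has_branch Y c (l + 1) (W j) G \<and> (l + 1) * G c = exp c * h j c" if j: "j < N" for j
  proof -
    have 1: "has_branch Y c l (W j) (\<lambda>y. \<Sum>k<N. B $$ (j, k) * ((exp y - \<tau> k) * h k y))"
      unfolding W_def
      by (intro has_branch_sum has_branch_const_mult, rule has_branch_mult[OF br, of _ UNIV]) (auto intro!: holomorphic_intros)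
    have "has_branch Y c l (\<lambda>y. exp y * w j y) (\<lambda>y. exp y * h j y)"
      by (rule has_branch_mult[OF br[OF j], of UNIV]) (auto intro!: holomorphic_intros)
    then have 2: "has_branch Y c l (deriv (W j)) (\<lambda>y. exp y * h j y)"
      by (subst has_branch_cong[where g = "\<lambda>y. exp y * w j y"]) (auto simp: DERIV_imp_deriv[OF Wd[OF j]])
    have "l \<noteq> 0" using l by auto
    from has_branch_integrate[OF Y 1 2 this] show ?thesis by metis
  qed
  then obtain h' where h': "\<And>j. j < N \<Longrightarrow> has_branch Y c (l + 1) (W j) (h' j) \<and> (l + 1) * h' j c = exp c * h j c" by metis
  moreover have "l + 1 \<notin> \<int>"
  proof
    assume "l + 1 \<in> \<int>"
    from Ints_diff[OF this Ints_1] show False using l by simp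
  qed
  ultimately have "germ N \<tau> (A + 1\<^sub>m N) Y c (l + 1) h' W" using eul by (simp add: germ_def)
  then show ?thesis using that h' by blast
qed

text \<open>The differences A' - rho1 and A' - rho2 are unchanged, while A and rho1 + rho2 - A' each
  grow by the identity.\<close>

lemma ext_A_shift:
  assumes A: "A \<in> carrier_mat N N" and P: "P \<in> carrier_mat N N" and Q: "Q \<in> carrier_mat N N" and QP: "Q * P = 1\<^sub>m N"
  shows "ext_A N (A + 1\<^sub>m N) P Q (Q * (A + 1\<^sub>m N) * P) (\<rho>\<^sub>1 + 1) (\<rho>\<^sub>2 + 1) =
    ext_A N A P Q (Q * A * P) \<rho>\<^sub>1 \<rho>\<^sub>2 + 1\<^sub>m (N + N)"
proof -
  have "Q * (A + 1\<^sub>m N) = Q * A + Q * 1\<^sub>m N" using A Q by (intro mult_add_distrib_mat[of _ N N _ N]) auto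
  also have "\<dots> = Q * A + Q" using Q by simp
  also have "(Q * A + Q) * P = Q * A * P + Q * P" using A P Q by (intro add_mult_distrib_mat[of _ N N _ _ N]) auto
  finally have 1: "Q * (A + 1\<^sub>m N) * P = Q * A * P + 1\<^sub>m N" using QP by simp
  have A': "Q * A * P \<in> carrier_mat N N" using A P Q by simp
  have 2: "Q * A * P + 1\<^sub>m N - (c + 1) \<cdot>\<^sub>m 1\<^sub>m N = Q * A * P - c \<cdot>\<^sub>m 1\<^sub>m N" for c
    using A' by (intro eq_matI) (auto simp: algebra_simps)
  show ?thesis unfolding 1 ext_A_def 2
    using A A' P Q by (intro eq_matI) (auto simp: algebra_simps)
qed

text \<open>The counterpart of \<open>germ_shift\<close> in the variable x: because dy/dx = - exp y,
  the new function is -dV/dx, and differentiation removes the identity added to the matrix. The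
  factor l + 1 from differentiating the branch cancels against the one in the relation between
  \<open>h\<close> and \<open>h'\<close>.\<close>

lemma lifted_shift:
  assumes A: "A \<in> carrier_mat N N" and P: "P \<in> carrier_mat N N" and Q: "Q \<in> carrier_mat N N" and QP: "Q * P = 1\<^sub>m N"
    and \<tau>: "\<And>j. j < N \<Longrightarrow> \<tau> j \<noteq> 0" and Y: "side_domain Y c"
    and V: "lifted N \<tau> P Q (A + 1\<^sub>m N) (\<rho>\<^sub>1 + 1) (\<rho>\<^sub>2 + 1) Y c (l + 1) h' V"
    and h: "\<And>j. j < N \<Longrightarrow> (l + 1) * h' j c = exp c * h j c"
  shows "lifted N \<tau> P Q A \<rho>\<^sub>1 \<rho>\<^sub>2 Y c l h (\<lambda>j y. exp y * deriv (V j) y)"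
proof -
  have op: "open Y" using Y by (simp add: side_domain_def)
  let ?M = "ext_A N A P Q (Q * A * P) \<rho>\<^sub>1 \<rho>\<^sub>2"
  have Mc: "?M \<in> carrier_mat (N + N) (N + N)" using A P Q by (intro ext_A_carrier) auto
  have Vhol: "V j holomorphic_on Y" and Vsys: "y \<in> Y \<Longrightarrow> ext_weight N \<tau> j y * deriv (V j) y = (\<Sum>k<2*N. ?M $$ (j, k) * V k y) + V j y"
    if j: "j < 2 * N" for j y
  proof -
    show "V j holomorphic_on Y" using V j by (simp add: lifted_def euler_system_def)
    assume "y \<in> Y"
    then have "ext_weight N \<tau> j y * deriv (V j) y = (\<Sum>k<2*N. (?M + 1\<^sub>m (N + N)) $$ (j, k) * V k y)"
      using V j unfolding lifted_def euler_system_def ext_A_shift[OF A P Q QP] by blast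
    also have "\<dots> = (\<Sum>k<2*N. ?M $$ (j, k) * V k y + (if k = j then V k y else 0))"
      by (rule sum.cong) (use Mc j in \<open>auto simp: algebra_simps\<close>)
    also have "\<dots> = (\<Sum>k<2*N. ?M $$ (j, k) * V k y) + V j y"
      using j by (simp add: sum.distrib)
    finally show "ext_weight N \<tau> j y * deriv (V j) y = (\<Sum>k<2*N. ?M $$ (j, k) * V k y) + V j y" .
  qed
  have Vd: "(V j has_field_derivative deriv (V j) y) (at y)"
    "(deriv (V j) has_field_derivative deriv (deriv (V j)) y) (at y)" if "j < 2 * N" "y \<in> Y" for j y
    using Vhol[OF that(1)] op that by (auto intro!: holomorphic_derivI holomorphic_intros)
  have "euler_system (2 * N) (ext_weight N \<tau>) ?M Y (\<lambda>j y. exp y * deriv (V j) y)"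
    unfolding euler_system_def
  proof (intro conjI allI impI ballI)
    fix j assume j: "j < 2 * N"
    show "(\<lambda>y. exp y * deriv (V j) y) holomorphic_on Y"
      using Vhol[OF j] op by (auto intro!: holomorphic_intros)
    fix y assume y: "y \<in> Y"
    define \<phi>' where "\<phi>' = (if j < N then exp y / \<tau> j else 0)"
    have \<phi>d: "(ext_weight N \<tau> j has_field_derivative \<phi>') (at y)"
      unfolding ext_weight_def[abs_def] \<phi>'_def using \<tau>[of j] by (auto intro!: derivative_eq_intros)
    \<comment> \<open>In the upper rows the derivative of the weight is exp y / tau_j, in the lower
      rows it is 0; both are the weight plus 1. The extra 1 cancels the identity matrix.\<close>
    have \<phi>: "\<phi>' = ext_weight N \<tau> j y + 1" by (simp add: \<phi>'_def ext_weight_def)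
    have 1: "((\<lambda>y. ext_weight N \<tau> j y * deriv (V j) y) has_field_derivative
       ext_weight N \<tau> j y * deriv (deriv (V j)) y + \<phi>' * deriv (V j) y) (at y)"
      by (rule DERIV_mult'[OF \<phi>d Vd(2)[OF j y]])
    have 2: "((\<lambda>y. (\<Sum>k<2*N. ?M $$ (j, k) * V k y) + V j y) has_field_derivative
       (\<Sum>k<2*N. ?M $$ (j, k) * deriv (V k) y) + deriv (V j) y) (at y)"
      by (intro DERIV_add DERIV_sum DERIV_cmult Vd j y) simp
    have "ext_weight N \<tau> j y * deriv (deriv (V j)) y + \<phi>' * deriv (V j) y = (\<Sum>k<2*N. ?M $$ (j, k) * deriv (V k) y) + deriv (V j) y"
    proof (rule DERIV_unique[OF 1])
      show "((\<lambda>y. ext_weight N \<tau> j y * deriv (V j) y) has_field_derivative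
       (\<Sum>k<2*N. ?M $$ (j, k) * deriv (V k) y) + deriv (V j) y) (at y)"
        by (rule DERIV_cong_ev[OF refl _ refl, THEN iffD2, OF eventually_mono[OF eventually_nhds_in_open[OF op y]] 2])
          (rule Vsys[OF j])
    qed
    then have s: "ext_weight N \<tau> j y * (deriv (V j) y + deriv (deriv (V j)) y) = (\<Sum>k<2*N. ?M $$ (j, k) * deriv (V k) y)"
      unfolding \<phi> by (simp add: algebra_simps)
    have "((\<lambda>y. exp y * deriv (V j) y) has_field_derivative exp y * (deriv (V j) y + deriv (deriv (V j)) y)) (at y)"
      using Vd[OF j y] by (auto intro!: derivative_eq_intros simp: algebra_simps)
    then have "ext_weight N \<tau> j y * deriv (\<lambda>y. exp y * deriv (V j) y) y =
        exp y * (ext_weight N \<tau> j y * (deriv (V j) y + deriv (deriv (V j)) y))"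
      by (simp add: DERIV_imp_deriv)
    also have "\<dots> = (\<Sum>k<2*N. ?M $$ (j, k) * (exp y * deriv (V k) y))"
      unfolding s by (simp add: sum_distrib_left mult.left_commute)
    finally show "ext_weight N \<tau> j y * deriv (\<lambda>y. exp y * deriv (V j) y) y = (\<Sum>k<2*N. ?M $$ (j, k) * (exp y * deriv (V k) y))" .
  qed
  moreover obtain K where K: "\<And>j. j < 2*N \<Longrightarrow> has_branch Y c l (V j) (K j)"
    "\<And>j. j < N \<Longrightarrow> \<tau> j = exp c \<Longrightarrow> K j c = 0 \<and> deriv (K j) c = exp (- (\<rho>\<^sub>1 + \<rho>\<^sub>2 + 2) * c) * h' j c"
    using V unfolding lifted_def by (auto simp: algebra_simps)
  define L where "L = (\<lambda>j y. exp y * (l * K j y + (y - c) * deriv (K j) y))"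
  have "has_branch Y c (l - 1) (\<lambda>y. exp y * deriv (V j) y) (L j)" if "j < 2 * N" for j
    unfolding L_def by (rule has_branch_mult[OF has_branch_deriv[OF Y K(1)[OF that]], of UNIV]) (auto intro!: holomorphic_intros)
  moreover have "L j c = 0 \<and> deriv (L j) c = exp (- (\<rho>\<^sub>1 + \<rho>\<^sub>2) * c) * h j c" if j: "j < N" "\<tau> j = exp c" for j
  proof -
    obtain \<epsilon> where e: "0 < \<epsilon>" "K j holomorphic_on ball c \<epsilon>"
      using K(1)[of j] j(1) by (auto elim: has_branchE)
    then have "(K j has_field_derivative deriv (K j) c) (at c)" "(deriv (K j) has_field_derivative deriv (deriv (K j)) c) (at c)"
      by (auto intro!: holomorphic_derivI[of _ "ball c \<epsilon>"] holomorphic_intros)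
    then have "(L j has_field_derivative exp c * ((l + 1) * deriv (K j) c)) (at c)"
      unfolding L_def using K(2)[OF j] by (auto intro!: derivative_eq_intros simp: algebra_simps)
    then have "deriv (L j) c = exp c * ((l + 1) * deriv (K j) c)" by (rule DERIV_imp_deriv)
    also have "\<dots> = exp c * exp (- (\<rho>\<^sub>1 + \<rho>\<^sub>2 + 2) * c) * ((l + 1) * h' j c)" using K(2)[OF j] by simp
    also have "\<dots> = (exp c * exp (- (\<rho>\<^sub>1 + \<rho>\<^sub>2 + 2) * c) * exp c) * h j c" unfolding h[OF j(1)] by simp
    also have "exp c * exp (- (\<rho>\<^sub>1 + \<rho>\<^sub>2 + 2) * c) * exp c = exp (- (\<rho>\<^sub>1 + \<rho>\<^sub>2) * c)"
      unfolding exp_add[symmetric] by (simp add: algebra_simps)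
    finally show ?thesis using K(2)[OF j] by (simp add: L_def)
  qed
  ultimately show ?thesis unfolding lifted_def by blast
qed

lemma connected_at_deriv:
  assumes op: "open Y" and f: "\<And>j. j < n \<Longrightarrow> f\<^sub>0 j holomorphic_on Y" "\<And>i j. i \<in> I \<Longrightarrow> j < n \<Longrightarrow> f i j holomorphic_on Y"
    and c: "connected_at n Y b I c f\<^sub>0 f"
  shows "connected_at n Y b I c (\<lambda>j y. exp y * deriv (f\<^sub>0 j) y) (\<lambda>i j y. exp y * deriv (f i j) y)"
proof -
  obtain W g where W: "open W" "b \<in> W" "\<And>j. j < n \<Longrightarrow> g j holomorphic_on (Y \<union> W)"
    "\<And>y j. y \<in> Y \<Longrightarrow> j < n \<Longrightarrow> f\<^sub>0 j y = (\<Sum>i\<in>I. c i * f i j y) + g j y"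
    using c unfolding connected_at_def by blast
  have "exp y * deriv (f\<^sub>0 j) y = (\<Sum>i\<in>I. c i * (exp y * deriv (f i j) y)) + exp y * deriv (g j) y"
    if y: "y \<in> Y" and j: "j < n" for y j
  proof -
    have "((\<lambda>y. (\<Sum>i\<in>I. c i * f i j y) + g j y) has_field_derivative (\<Sum>i\<in>I. c i * deriv (f i j) y) + deriv (g j) y) (at y)"
      using W(3)[OF j] W(1) op y j by (intro DERIV_add DERIV_sum DERIV_cmult holomorphic_derivI[OF f(2) op y] holomorphic_derivI[of _ "Y \<union> W"]) auto
    then have "(f\<^sub>0 j has_field_derivative (\<Sum>i\<in>I. c i * deriv (f i j) y) + deriv (g j) y) (at y)"
      by (rule DERIV_cong_ev[OF refl _ refl, THEN iffD2, OF eventually_mono[OF eventually_nhds_in_open[OF op y]], rotated])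
        (rule W(4)[OF _ j])
    then show ?thesis by (simp add: DERIV_imp_deriv distrib_left sum_distrib_left mult.left_commute)
  qed
  moreover have "(\<lambda>y. exp y * deriv (g j) y) holomorphic_on (Y \<union> W)" if "j < n" for j
    using W(3)[OF that] W(1) op by (auto intro!: holomorphic_intros)
  ultimately show ?thesis unfolding connected_at_def using W(1,2)
    by (intro exI[of _ W] exI[of _ "\<lambda>j y. exp y * deriv (g j) y"]) auto
qed

lemma connected_at_matrix:
  assumes c: "connected_at N Y b I c f\<^sub>0 f"
  shows "connected_at N Y b I c (\<lambda>j y. \<Sum>k<N. B $$ (j, k) * ((exp y - \<tau> k) * f\<^sub>0 k y))
    (\<lambda>i j y. \<Sum>k<N. B $$ (j, k) * ((exp y - \<tau> k) * f i k y))"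
proof -
  obtain W g where W: "open W" "b \<in> W" "\<And>j. j < N \<Longrightarrow> g j holomorphic_on (Y \<union> W)"
    "\<And>y j. y \<in> Y \<Longrightarrow> j < N \<Longrightarrow> f\<^sub>0 j y = (\<Sum>i\<in>I. c i * f i j y) + g j y"
    using c unfolding connected_at_def by blast
  have "(\<Sum>k<N. B $$ (j, k) * ((exp y - \<tau> k) * f\<^sub>0 k y)) =
     (\<Sum>i\<in>I. c i * (\<Sum>k<N. B $$ (j, k) * ((exp y - \<tau> k) * f i k y))) + (\<Sum>k<N. B $$ (j, k) * ((exp y - \<tau> k) * g k y))"
    if y: "y \<in> Y" for y j
  proof -
    have "(\<Sum>k<N. B $$ (j, k) * ((exp y - \<tau> k) * f\<^sub>0 k y)) =
      (\<Sum>k<N. (\<Sum>i\<in>I. c i * (B $$ (j, k) * ((exp y - \<tau> k) * f i k y))) + B $$ (j, k) * ((exp y - \<tau> k) * g k y))"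
      using W(4)[OF y] by (intro sum.cong refl) (simp add: distrib_left sum_distrib_left mult_ac)
    then show ?thesis by (simp add: sum.distrib sum_distrib_left) (rule sum.swap)
  qed
  moreover have "(\<lambda>y. \<Sum>k<N. B $$ (j, k) * ((exp y - \<tau> k) * g k y)) holomorphic_on (Y \<union> W)" for j
  proof -
    obtain T where T: "Y \<union> W = T" by blast
    show ?thesis using W(3) unfolding T by (intro holomorphic_intros) auto
  qed
  ultimately show ?thesis unfolding connected_at_def using W(1,2)
    by (intro exI[of _ W] exI[of _ "\<lambda>j y. \<Sum>k<N. B $$ (j, k) * ((exp y - \<tau> k) * g k y)"]) auto
qed

lemma conv_add_right:
  assumes "conv_domain S a Y" "continuous_on S f" "y \<in> Y" "continuous_on (insert a Y) g" "continuous_on (insert a Y) h"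
  shows "conv a f (\<lambda>s. g s + h s) y = conv a f g y + conv a f h y"
  using conv_sum_right[OF assms(1-3), of "UNIV :: bool set" "\<lambda>b. if b then g else h" "\<lambda>_. 1"] assms(4,5)
  by (simp add: UNIV_bool add.commute)

section \<open>Connection relations on a strip\<close>

definition kernel_domain :: "complex set" where "kernel_domain = {t. \<bar>Im t\<bar> < 2 * pi}"

text \<open>It is left open which of the two points lies on the upper edge. So exchanging them gives
  another instance, and continuation in both directions is treated at once.\<close>

locale strip =
  fixes Y :: "complex set" and a b :: complex and lo hi :: real
  assumes Y_eq: "Y = {y. lo < Im y \<and> Im y < hi}" and lohi: "lo < hi" "hi - lo < 2 * pi"
    and ends: "Im a = lo \<and> Im b = hi \<or> Im a = hi \<and> Im b = lo"
begin

lemma swap: "strip Y b a lo hi"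
  using Y_eq lohi ends by unfold_locales auto

lemma Y_Int: "Y = {y. lo < Im y} \<inter> {y. Im y < hi}" by (auto simp: Y_eq)

lemma open_Y: "open Y"
  unfolding Y_Int by (intro open_Int open_halfspace_Im_lt open_halfspace_Im_gt)

lemma convex_Y: "convex Y"
  unfolding Y_Int by (intro convex_Int convex_halfspace_Im_lt convex_halfspace_Im_gt)

lemma connected_Y: "connected Y"
  using convex_Y by (rule convex_connected)

lemma open_kernel_domain: "open kernel_domain"
proof -
  have eq: "kernel_domain = {t. - (2 * pi) < Im t} \<inter> {t. Im t < 2 * pi}" by (auto simp: kernel_domain_def)
  show ?thesis unfolding eq by (intro open_Int open_halfspace_Im_lt open_halfspace_Im_gt)
qed

lemma zero_in_kernel_domain: "0 \<in> kernel_domain" by (simp add: kernel_domain_def)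

lemma notin_Y: "a \<notin> Y" "b \<notin> Y" and Im_ne: "Im a \<noteq> Im b" and ne: "a \<noteq> b"
  using ends lohi by (auto simp: Y_eq)

lemma side_a: "side_domain Y a"
  unfolding side_domain_def
proof (intro conjI ballI)
  show "open Y" by (rule open_Y)
  show "Im y \<noteq> Im a" if "y \<in> Y" for y using that ends by (auto simp: Y_eq)
  show "a \<in> closure Y"
    unfolding closure_approachable
  proof (intro allI impI)
    fix e :: real assume e: "0 < e"
    define d where "d = min (e / 2) ((hi - lo) / 2)"
    have d: "0 < d" "d < e" "d < hi - lo" using e lohi by (auto simp: d_def min_def)
    define y where "y = (if Im a = lo then a + \<i> * of_real d else a - \<i> * of_real d)"
    have "dist y a = d" using d by (simp add: y_def dist_norm norm_mult)
    moreover have "y \<in> Y" using d ends by (auto simp: Y_eq y_def)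
    ultimately show "\<exists>y\<in>Y. dist y a < e" using d by auto
  qed
qed

text \<open>An open segment in the closed strip touches an edge only if both of its ends lie on that
  edge, and each edge carries just one point of the set.\<close>

lemma convex_E: "convex (insert a (insert b Y))"
  unfolding convex_contains_open_segment
proof (intro ballI subsetI)
  fix u v w assume u: "u \<in> insert a (insert b Y)" and v: "v \<in> insert a (insert b Y)" and w: "w \<in> open_segment u v"
  then obtain r where r: "0 < r" "r < 1" "w = (1 - r) *\<^sub>R u + r *\<^sub>R v" and uv: "u \<noteq> v"
    by (auto simp: in_segment)
  have rng: "lo \<le> Im u" "Im u \<le> hi" "lo \<le> Im v" "Im v \<le> hi"
    using u v ends lohi by (auto simp: Y_eq)
  have 1: "\<not> (Im u = lo \<and> Im v = lo)" "\<not> (Im u = hi \<and> Im v = hi)"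
    using u v uv ends lohi by (auto simp: Y_eq)
  have Im: "Im w = (1 - r) * Im u + r * Im v" using r by simp
  have "Im w - lo = (1 - r) * (Im u - lo) + r * (Im v - lo)" "hi - Im w = (1 - r) * (hi - Im u) + r * (hi - Im v)"
    unfolding Im by (simp_all add: algebra_simps)
  moreover have "0 < (1 - r) * p + r * q" if "0 \<le> p" "0 \<le> q" "\<not> (p = 0 \<and> q = 0)" for p q :: real
  proof (cases "p = 0")
    case True
    then show ?thesis using that r by simp
  next
    case False
    then have "0 < (1 - r) * p" using that r by simp
    moreover have "0 \<le> r * q" using that r by simp
    ultimately show ?thesis by simp
  qed
  ultimately have "0 < Im w - lo" "0 < hi - Im w" using rng 1 by auto
  then show "w \<in> insert a (insert b Y)" by (auto simp: Y_eq)
qed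

lemma E_diff: "y \<in> Y \<Longrightarrow> s \<in> insert a (insert b Y) \<Longrightarrow> y - s \<in> kernel_domain"
  using ends lohi by (auto simp: Y_eq kernel_domain_def)

text \<open>The ball is added so that the convolution of a function holomorphic across the base
  point can be seen to be holomorphic across it as well.\<close>

lemma conv_domain_ball:
  assumes "0 \<le> \<epsilon>" "\<epsilon> \<le> 2 * pi - (hi - lo)" "\<epsilon> \<le> hi - lo"
  shows "conv_domain kernel_domain a (Y \<union> ball a \<epsilon>)"
  unfolding conv_domain_def
proof (intro conjI ballI allI impI)
  show "open kernel_domain" by (rule open_kernel_domain)
  show "open (Y \<union> ball a \<epsilon>)" by (intro open_Un open_Y open_ball)
  fix y and r :: real assume y: "y \<in> Y \<union> ball a \<epsilon>"
  show "of_real r * (y - a) \<in> kernel_domain" if r: "0 \<le> r" "r \<le> 1"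
  proof -
    have "\<bar>Im (y - a)\<bar> < 2 * pi"
    proof (cases "y \<in> Y")
      case True
      then show ?thesis using ends lohi by (auto simp: Y_eq)
    next
      case False
      then have "norm (y - a) < \<epsilon>" using y by (simp add: dist_norm norm_minus_commute)
      then show ?thesis using abs_Im_le_cmod[of "y - a"] assms lohi by linarith
    qed
    moreover have "\<bar>r * Im (y - a)\<bar> \<le> 1 * \<bar>Im (y - a)\<bar>"
      unfolding abs_mult using r by (intro mult_right_mono) auto
    ultimately show ?thesis by (simp add: kernel_domain_def)
  qed
  show "a + of_real r * (y - a) \<in> Y \<union> ball a \<epsilon>" if r: "0 < r" "r \<le> 1"
  proof (cases "y \<in> Y")
    case True
    have Im: "Im (a + of_real r * (y - a)) = Im a + r * (Im y - Im a)" by simp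
    consider "Im a = lo" "lo < Im y" "Im y < hi" | "Im a = hi" "lo < Im y" "Im y < hi"
      using ends True by (auto simp: Y_eq)
    then have "a + of_real r * (y - a) \<in> Y"
    proof cases
      case 1
      have "0 < r * (Im y - lo)" "r * (Im y - lo) \<le> Im y - lo"
        using r 1 mult_right_mono[of r 1 "Im y - lo"] by simp_all
      moreover have "Im (a + of_real r * (y - a)) = lo + r * (Im y - lo)" unfolding Im 1(1) ..
      ultimately show ?thesis using 1 unfolding Y_eq mem_Collect_eq by linarith
    next
      case 2
      have "0 < r * (hi - Im y)" "r * (hi - Im y) \<le> hi - Im y"
        using r 2 mult_right_mono[of r 1 "hi - Im y"] by simp_all
      moreover have "Im (a + of_real r * (y - a)) = hi - r * (hi - Im y)"
        unfolding Im 2(1) by (simp add: algebra_simps)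
      ultimately show ?thesis using 2 unfolding Y_eq mem_Collect_eq by linarith
    qed
    then show ?thesis by simp
  next
    case False
    then have y: "norm (y - a) < \<epsilon>" using y by (simp add: dist_norm norm_minus_commute)
    have "r * norm (y - a) \<le> 1 * norm (y - a)" using r by (intro mult_right_mono) auto
    then have "norm (of_real r * (y - a)) < \<epsilon>" using y r by (simp add: norm_mult)
    then show ?thesis by (simp add: dist_norm)
  qed
qed

lemma conv_domain_Y: "conv_domain kernel_domain a Y"
  using conv_domain_ball[of 0] lohi by simp

text \<open>
  The base case: for exponents with \<open>Re l > 1\<close> the solutions and their derivatives extend
  continuously by \<open>0\<close> to the singular point, so that the convolution needs no regularisation.
\<close>
lemma lifted_conv:
  assumes A: "A \<in> carrier_mat N N" and P: "P \<in> carrier_mat N N" and Q: "Q \<in> carrier_mat N N"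
    and PQ: "P * Q = 1\<^sub>m N" and \<tau>: "\<And>j. j < N \<Longrightarrow> \<tau> j \<noteq> 0"
    and k: "k holomorphic_on kernel_domain" "k 0 = (\<rho>\<^sub>1 + 1) * (\<rho>\<^sub>2 + 1)"
    and kode: "\<And>t. t \<in> kernel_domain \<Longrightarrow> (exp t - 1) * deriv (deriv k) t =
        (exp t * (\<rho>\<^sub>1 + \<rho>\<^sub>2) - (\<rho>\<^sub>1 + \<rho>\<^sub>2 + 2)) * deriv k t +
        ((\<rho>\<^sub>1 + 1) * (\<rho>\<^sub>2 + 1) + (\<rho>\<^sub>1 + \<rho>\<^sub>2 + 1) * exp t) * k t"
    and w: "germ N \<tau> A Y a l h w" and l: "Re l > 1"
  defines "v \<equiv> \<lambda>j. (w j)(a := 0)"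
  defines "X \<equiv> \<lambda>j y. v j y + conv a k (v j) y"
  shows "lifted N \<tau> P Q A \<rho>\<^sub>1 \<rho>\<^sub>2 Y a l h (lift N A Q \<tau> (\<rho>\<^sub>1 + \<rho>\<^sub>2) X)"
    and "j < N \<Longrightarrow> X j holomorphic_on Y"
    and "j < N \<Longrightarrow> continuous_on (insert a Y) (v j)"
    and "j < N \<Longrightarrow> (w j \<longlongrightarrow> 0) (at a within Y)"
proof -
  have whol: "w j holomorphic_on Y"
    and sys: "y \<in> Y \<Longrightarrow> (1 - \<tau> j * exp (- y)) * deriv (w j) y = (\<Sum>k<N. A $$ (j, k) * w k y)"
    and br: "has_branch Y a l (w j) (h j)" if "j < N" for j y
    using w that by (auto simp: germ_def euler_system_def)
  define v' where "v' = (\<lambda>j. (deriv (w j))(a := 0))"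
  have t0: "(w j \<longlongrightarrow> 0) (at a within Y)" if "j < N" for j
    by (rule has_branch_tendsto_0[OF br[OF that]]) (use l notin_Y in auto)
  then show "j < N \<Longrightarrow> (w j \<longlongrightarrow> 0) (at a within Y)" .
  have t1: "(deriv (w j) \<longlongrightarrow> 0) (at a within Y)" if "j < N" for j
    by (rule has_branch_tendsto_0[OF has_branch_deriv[OF side_a br[OF that]]]) (use l notin_Y in auto)
  have cv: "continuous_on (insert a Y) (v j)" if "j < N" for j
    unfolding v_def by (intro continuous_on_insert_extend holomorphic_on_imp_continuous_on whol that t0 open_Y notin_Y)
  then show "j < N \<Longrightarrow> continuous_on (insert a Y) (v j)" .
  have cv': "continuous_on (insert a Y) (v' j)" if "j < N" for j
    unfolding v'_def by (intro continuous_on_insert_extend holomorphic_on_imp_continuous_on holomorphic_deriv whol that t1 open_Y notin_Y)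
  have eqY: "v j y = w j y" if "y \<in> Y" for j y using that notin_Y by (auto simp: v_def)
  have vhol: "v j holomorphic_on Y" if "j < N" for j
    using whol[OF that] by (rule holomorphic_transform) (simp add: eqY)
  have dv: "deriv (v j) y = deriv (w j) y" if "y \<in> Y" for j y
    by (rule deriv_cong_ev[OF eventually_mono[OF eventually_nhds_in_open[OF open_Y that]] refl]) (rule eqY)
  have dv': "deriv (v j) y = v' j y" if "y \<in> Y" for j y
    using dv[OF that] that notin_Y by (auto simp: v'_def)
  have vsys: "(1 - \<tau> j * exp (- y)) * v' j y = (\<Sum>k<N. A $$ (j, k) * v k y)" if "j < N" "y \<in> Y" for j y
    using sys[OF that] dv[OF that(2)] dv'[OF that(2)] eqY[OF that(2)] by simp
  have va: "v j a = 0" "v' j a = 0" for j by (simp_all add: v_def v'_def)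
  have Xhol: "X j holomorphic_on Y" if "j < N" for j
  proof -
    obtain y where "y \<in> Y" using side_domain_meets_ball[OF side_a, of 1] by auto
    show ?thesis
      unfolding X_def
      by (rule transmutation_equation(2)[where S = kernel_domain and N = N and w = v and v = v' and \<sigma> = "\<rho>\<^sub>1 + \<rho>\<^sub>2"
            and A = "\<lambda>j k. A $$ (j, k)" and \<tau> = \<tau>, OF conv_domain_Y zero_in_kernel_domain k])
        (assumption | rule kode vhol cv cv' va dv' vsys that \<open>y \<in> Y\<close>)+
  qed
  then show "j < N \<Longrightarrow> X j holomorphic_on Y" .
  have eul: "euler_system (2 * N) (ext_weight N \<tau>) (ext_A N A P Q (Q * A * P) \<rho>\<^sub>1 \<rho>\<^sub>2) Y (lift N A Q \<tau> (\<rho>\<^sub>1 + \<rho>\<^sub>2) X)"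
  proof (rule lift_system[OF A P Q PQ \<tau> open_Y Xhol])
    fix j y assume jy: "j < N" "y \<in> Y"
    show "\<tau> j * (deriv (deriv (X j)) y - (\<rho>\<^sub>1 + \<rho>\<^sub>2 + 2) * deriv (X j) y + (\<rho>\<^sub>1 + 1) * (\<rho>\<^sub>2 + 1) * X j y) =
      exp y * (deriv (\<lambda>y. deriv (X j) y - (\<rho>\<^sub>1 + \<rho>\<^sub>2 + 1) * X j y) y -
        (\<Sum>k<N. A $$ (j, k) * (deriv (X k) y - (\<rho>\<^sub>1 + \<rho>\<^sub>2 + 1) * X k y)))"
      unfolding X_def
      by (rule transmutation_equation(1)[where S = kernel_domain and N = N and w = v and v = v' and \<sigma> = "\<rho>\<^sub>1 + \<rho>\<^sub>2"
            and A = "\<lambda>j k. A $$ (j, k)" and \<tau> = \<tau>, OF conv_domain_Y zero_in_kernel_domain k])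
        (assumption | rule kode vhol cv cv' va dv' vsys jy)+
  qed
  \<comment> \<open>The convolution contributes a regular factor that vanishes at \<open>a\<close>,
    so \<open>X\<close> inherits the leading coefficient of \<open>w\<close>.\<close>
  have "\<exists>H. has_branch Y a l (X j) H \<and> H a = h j a" if j: "j < N" for j
  proof -
    have b: "has_branch Y a l (v j) (h j)" using br[OF j] by (subst has_branch_cong[OF eqY])
    obtain H where "has_branch Y a l (conv a k (v j)) H" "H a = 0"
      by (rule conv_branch[OF conv_domain_Y side_a k(1) zero_in_kernel_domain b _ va(1)]) (use l in auto)
    then show ?thesis unfolding X_def using has_branch_add[OF b] by fastforce
  qed
  then obtain H where H: "\<And>j. j < N \<Longrightarrow> has_branch Y a l (X j) (H j) \<and> H j a = h j a" by metis
  obtain K where K: "\<And>j. j < 2 * N \<Longrightarrow> has_branch Y a (l - 1) (lift N A Q \<tau> (\<rho>\<^sub>1 + \<rho>\<^sub>2) X j) (K j)"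
    "\<And>j. j < N \<Longrightarrow> \<tau> j = exp a \<Longrightarrow> K j a = 0 \<and> deriv (K j) a = exp (- (\<rho>\<^sub>1 + \<rho>\<^sub>2) * a) * H j a"
    by (rule lift_branch[OF side_a, of N l X H \<tau> A Q "\<rho>\<^sub>1 + \<rho>\<^sub>2"]) (use H \<tau> in auto)
  then show "lifted N \<tau> P Q A \<rho>\<^sub>1 \<rho>\<^sub>2 Y a l h (lift N A Q \<tau> (\<rho>\<^sub>1 + \<rho>\<^sub>2) X)"
    unfolding lifted_def using eul H by auto
qed

end

text \<open>The remainder consists of three pieces: \<open>g\<close> itself, its convolution from
  \<open>b\<close>, and the integral over the segment from \<open>a\<close> to \<open>b\<close> that
  the change of base point produces. Each of them continues across \<open>b\<close>, and
  \<open>lift\<close> is linear and preserves holomorphy.\<close>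

lemma (in strip) connection_base:
  fixes I :: "'i set" and \<rho>\<^sub>1 \<rho>\<^sub>2 :: complex
  assumes A: "A \<in> carrier_mat N N" and P: "P \<in> carrier_mat N N" and Q: "Q \<in> carrier_mat N N"
    and PQ: "P * Q = 1\<^sub>m N" and \<tau>: "\<And>j. j < N \<Longrightarrow> \<tau> j \<noteq> 0" and I: "finite I"
    and w0: "germ N \<tau> A Y a l\<^sub>0 h\<^sub>0 w\<^sub>0" "Re l\<^sub>0 > 1"
    and w: "\<And>i. i \<in> I \<Longrightarrow> germ N \<tau> A Y b (l i) (h i) (w i)" "\<And>i. i \<in> I \<Longrightarrow> Re (l i) > 1"
    and rel: "connected_at N Y b I c w\<^sub>0 w"
  shows "\<exists>V\<^sub>0 V. lifted N \<tau> P Q A \<rho>\<^sub>1 \<rho>\<^sub>2 Y a l\<^sub>0 h\<^sub>0 V\<^sub>0 \<and>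
    (\<forall>i\<in>I. lifted N \<tau> P Q A \<rho>\<^sub>1 \<rho>\<^sub>2 Y b (l i) (h i) (V i)) \<and> connected_at (2 * N) Y b I c V\<^sub>0 V"
proof -
  interpret b: strip Y b a lo hi by (rule swap)
  obtain k where k: "k holomorphic_on kernel_domain" "k 0 = (\<rho>\<^sub>1 + 1) * (\<rho>\<^sub>2 + 1)"
    and kode: "\<And>t. t \<in> kernel_domain \<Longrightarrow> (exp t - 1) * deriv (deriv k) t =
        (exp t * (\<rho>\<^sub>1 + \<rho>\<^sub>2) - (\<rho>\<^sub>1 + \<rho>\<^sub>2 + 2)) * deriv k t +
        ((\<rho>\<^sub>1 + 1) * (\<rho>\<^sub>2 + 1) + (\<rho>\<^sub>1 + \<rho>\<^sub>2 + 1) * exp t) * k t"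
    by (rule transmutation_kernel[of \<rho>\<^sub>1 \<rho>\<^sub>2, folded kernel_domain_def]) blast
  have ck: "continuous_on kernel_domain k" using k(1) by (rule holomorphic_on_imp_continuous_on)
  define v0 where "v0 = (\<lambda>j. (w\<^sub>0 j)(a := 0))"
  define v where "v = (\<lambda>i j. (w i j)(b := 0))"
  define X0 where "X0 = (\<lambda>j y. v0 j y + conv a k (v0 j) y)"
  define X where "X = (\<lambda>i j y. v i j y + conv b k (v i j) y)"
  have L0: "lifted N \<tau> P Q A \<rho>\<^sub>1 \<rho>\<^sub>2 Y a l\<^sub>0 h\<^sub>0 (lift N A Q \<tau> (\<rho>\<^sub>1 + \<rho>\<^sub>2) X0)"
    unfolding X0_def v0_def by (rule lifted_conv(1)[OF A P Q PQ _ k _ w0]; (rule \<tau> kode)?; assumption)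
  have L0c: "continuous_on (insert a Y) (v0 j)" if "j < N" for j
    unfolding v0_def by (rule lifted_conv(3)[OF A P Q PQ _ k _ w0 that]; (rule \<tau> kode)?; assumption)
  note bL = b.lifted_conv[OF A P Q PQ _ k]
  have L1: "lifted N \<tau> P Q A \<rho>\<^sub>1 \<rho>\<^sub>2 Y b (l i) (h i) (lift N A Q \<tau> (\<rho>\<^sub>1 + \<rho>\<^sub>2) (X i))" if i: "i \<in> I" for i
    unfolding X_def v_def by (rule bL(1)[OF _ _ w(1)[OF i] w(2)[OF i]]; (rule \<tau> kode)?; assumption)
  have L2: "X i j holomorphic_on Y" if i: "i \<in> I" and j: "j < N" for i j
    unfolding X_def v_def by (rule bL(2)[OF _ _ w(1)[OF i] w(2)[OF i] j]; (rule \<tau> kode)?; assumption)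
  have L3: "continuous_on (insert b Y) (v i j)" if i: "i \<in> I" and j: "j < N" for i j
    unfolding v_def by (rule bL(3)[OF _ _ w(1)[OF i] w(2)[OF i] j]; (rule \<tau> kode)?; assumption)
  obtain V g where V: "open V" "b \<in> V" "\<And>j. j < N \<Longrightarrow> g j holomorphic_on (Y \<union> V)"
    "\<And>y j. y \<in> Y \<Longrightarrow> j < N \<Longrightarrow> w\<^sub>0 j y = (\<Sum>i\<in>I. c i * w i j y) + g j y"
    using rel unfolding connected_at_def by blast
  obtain d where d: "0 < d" "ball b d \<subseteq> V" using openE[OF V(1,2)] by blast
  \<comment> \<open>So small that \<open>g\<close> is still holomorphic on the ball and that points
    of the ball differ from points of the segment from \<open>a\<close> to \<open>b\<close> by less
    than 2 pi in imaginary part.\<close>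
  define \<epsilon> where "\<epsilon> = min d (min (2 * pi - (hi - lo)) (hi - lo))"
  have \<epsilon>: "0 < \<epsilon>" "\<epsilon> \<le> d" "\<epsilon> \<le> 2 * pi - (hi - lo)" "\<epsilon> \<le> hi - lo" using d lohi by (auto simp: \<epsilon>_def)
  define W where "W = Y \<union> ball b \<epsilon>"
  have W: "open W" "b \<in> W" "Y \<subseteq> W" "insert b W = W" using \<epsilon> open_Y by (auto simp: W_def)
  have DW: "conv_domain kernel_domain b W"
    unfolding W_def using b.conv_domain_ball[of \<epsilon>] \<epsilon> by simp
  have DY: "conv_domain kernel_domain b Y" using b.conv_domain_Y by simp
  have ghol: "g j holomorphic_on W" if "j < N" for j
  proof (rule holomorphic_on_subset[OF V(3)[OF that]])
    have "ball b \<epsilon> \<subseteq> V" using subset_ball[OF \<epsilon>(2)] d(2) by (rule subset_trans)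
    then show "W \<subseteq> Y \<union> V" by (auto simp: W_def)
  qed
  have gcont: "continuous_on (insert b Y) (g j)" if "j < N" for j
    by (rule continuous_on_subset[OF holomorphic_on_imp_continuous_on[OF ghol[OF that]]]) (use W in auto)
  define x where "x = (\<lambda>j. (v0 j)(b := g j b))"
  have x_v0: "x j s = v0 j s" if "s \<in> insert a Y" for j s using that notin_Y ne by (auto simp: x_def)
  have x_b: "x j s = (\<Sum>i\<in>I. c i * v i j s) + g j s" if "s \<in> insert b Y" "j < N" for j s
    using that V(4)[of s j] notin_Y ne by (auto simp: x_def v_def v0_def)
  have xc: "continuous_on (insert a (insert b Y)) (x j)" if j: "j < N" for j
  proof -
    have 1: "continuous_on (insert b Y) (\<lambda>s. (\<Sum>i\<in>I. c i * v i j s) + g j s)"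
      by (intro continuous_intros gcont j L3)
    have 2: "continuous_on (insert b Y) (x j)"
      by (rule continuous_on_cong[THEN iffD1, OF refl _ 1]) (simp add: x_b j)
    have 3: "continuous_on (insert a Y) (x j)"
      by (rule continuous_on_cong[THEN iffD1, OF refl _ L0c[OF j]]) (simp add: x_v0)
    show ?thesis
      unfolding continuous_on_eq_continuous_within
    proof
      fix s assume s: "s \<in> insert a (insert b Y)"
      \<comment> \<open>Continuity is local, and each point has a neighbourhood that misses one of
        the two end points.\<close>
      have nb: "\<exists>U. open U \<and> s \<in> U \<and> (U \<inter> insert a (insert b Y) \<subseteq> insert a Y \<and> s \<in> insert a Y \<or>
         U \<inter> insert a (insert b Y) \<subseteq> insert b Y \<and> s \<in> insert b Y)"
      proof (cases "s = b")
        case True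
        then show ?thesis using ne by (intro exI[of _ "- {a}"]) (auto intro: open_Compl)
      next
        case False
        then show ?thesis using s by (intro exI[of _ "- {b}"]) (auto intro: open_Compl)
      qed
      then obtain U T where U: "open U" "s \<in> U" "U \<inter> insert a (insert b Y) \<subseteq> T" "s \<in> T" "T = insert a Y \<or> T = insert b Y"
        by blast
      have "continuous (at s within T) (x j)"
        using U(4,5) 2 3 by (auto simp: continuous_on_eq_continuous_within)
      then have "continuous (at s within U \<inter> insert a (insert b Y)) (x j)"
        using U(3) by (rule continuous_within_subset)
      moreover have "at s within U \<inter> insert a (insert b Y) = at s within insert a (insert b Y)"
        by (rule at_within_nhd[OF U(2,1)]) auto
      ultimately show "continuous (at s within insert a (insert b Y)) (x j)" by simp
    qed
  qed
  have xhol: "x j holomorphic_on Y" if j: "j < N" for j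
  proof -
    have "w\<^sub>0 j holomorphic_on Y" using w0(1) j by (auto simp: germ_def euler_system_def)
    then show ?thesis by (rule holomorphic_transform) (use notin_Y in \<open>auto simp: x_def v0_def\<close>)
  qed
  define J where "J = (\<lambda>j y. (b - a) * integral {0..1} (\<lambda>r. k (y - (a + of_real r * (b - a))) * x j (a + of_real r * (b - a))))"
  define G where "G = (\<lambda>j y. g j y + J j y + conv b k (g j) y)"
  have seg: "a + of_real r * (b - a) \<in> insert a (insert b Y)" if "r \<in> {0..1}" for r :: real
  proof -
    have "a + of_real r * (b - a) \<in> closed_segment a b"
      using that by (auto simp: in_segment scaleR_conv_of_real algebra_simps intro!: exI[of _ r])
    then show ?thesis using convex_E by (meson convex_contains_segment insertI1 insertI2 subsetD)
  qed
  have segS: "y - (a + of_real r * (b - a)) \<in> kernel_domain" if y: "y \<in> W" and r: "r \<in> {0..1}" for y and r :: real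
  proof -
    have Im: "lo \<le> Im (a + of_real r * (b - a))" "Im (a + of_real r * (b - a)) \<le> hi"
    proof -
      have "lo \<le> Im u \<and> Im u \<le> hi" if "u \<in> insert a (insert b Y)" for u
        using that ends lohi by (auto simp: Y_eq)
      from this[OF seg[OF r]]
      show "lo \<le> Im (a + of_real r * (b - a))" "Im (a + of_real r * (b - a)) \<le> hi" by blast+
    qed
    have "lo - \<epsilon> < Im y" "Im y < hi + \<epsilon>"
    proof -
      have "lo - \<epsilon> < Im y \<and> Im y < hi + \<epsilon>"
      proof (cases "y \<in> Y")
        case True
        then show ?thesis using \<epsilon> by (auto simp: Y_eq)
      next
        case False
        then have "norm (y - b) < \<epsilon>" using y by (simp add: W_def dist_norm norm_minus_commute)
        then have "\<bar>Im y - Im b\<bar> < \<epsilon>" using abs_Im_le_cmod[of "y - b"] by simp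
        then show ?thesis using ends lohi by auto
      qed
      then show "lo - \<epsilon> < Im y" "Im y < hi + \<epsilon>" by auto
    qed
    then show ?thesis using Im \<epsilon> by (simp add: kernel_domain_def)
  qed
  have segc: "continuous_on {0..1} (\<lambda>r::real. x j (a + of_real r * (b - a)))" if j: "j < N" for j
  proof -
    have i: "(\<lambda>r::real. a + of_real r * (b - a)) ` {0..1} \<subseteq> insert a (insert b Y)" by (intro image_subsetI seg)
    show ?thesis by (rule continuous_on_compose2[OF xc[OF j] _ i]) (intro continuous_intros)
  qed
  have k': "deriv k holomorphic_on kernel_domain" using k(1) open_kernel_domain by (intro holomorphic_intros)
  have ck': "continuous_on kernel_domain (deriv k)" using k' by (rule holomorphic_on_imp_continuous_on)
  \<comment> \<open>The path is fixed, so only \<open>k\<close> is differentiated; by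
    \<open>segS\<close> its argument stays in the kernel domain even for \<open>y\<close> beyond
    \<open>b\<close>.\<close>
  have Jhol: "J j holomorphic_on W" if j: "j < N" for j
  proof -
    have "(\<lambda>y. integral {0..1} (\<lambda>r. k (y - (a + of_real r * (b - a))) * x j (a + of_real r * (b - a)))) holomorphic_on W"
    proof (rule holomorphic_param_integral[OF W(1), where F' = "\<lambda>y r. deriv k (y - (a + of_real r * (b - a))) * x j (a + of_real r * (b - a))"])
      fix y and r :: real assume yr: "y \<in> W" "r \<in> {0..1}"
      have "(k has_field_derivative deriv k (y - (a + of_real r * (b - a)))) (at (y - (a + of_real r * (b - a))))"
        by (rule holomorphic_derivI[OF k(1) open_kernel_domain segS[OF yr]])
      then have "((\<lambda>y. k (y - (a + of_real r * (b - a)))) has_field_derivative deriv k (y - (a + of_real r * (b - a)))) (at y)"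
      proof -
        assume *: "(k has_field_derivative deriv k (y - (a + of_real r * (b - a)))) (at (y - (a + of_real r * (b - a))))"
        have "((\<lambda>y. y - (a + of_real r * (b - a))) has_field_derivative 1) (at y)" by (auto intro!: derivative_eq_intros)
        from DERIV_chain2[OF * this] show ?thesis by simp
      qed
      then show "((\<lambda>y. k (y - (a + of_real r * (b - a))) * x j (a + of_real r * (b - a))) has_field_derivative
          deriv k (y - (a + of_real r * (b - a))) * x j (a + of_real r * (b - a))) (at y)"
        by (rule DERIV_cmult_right)
    next
      fix y assume y: "y \<in> W"
      have i: "(\<lambda>r::real. y - (a + of_real r * (b - a))) ` {0..1} \<subseteq> kernel_domain" by (intro image_subsetI segS y)
      show "continuous_on {0..1} (\<lambda>r. k (y - (a + of_real r * (b - a))) * x j (a + of_real r * (b - a)))"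
        by (intro continuous_on_mult segc j continuous_on_compose2[OF ck _ i] continuous_intros)
    next
      have i: "(\<lambda>p::complex \<times> real. fst p - (a + of_real (snd p) * (b - a))) ` (W \<times> {0..1}) \<subseteq> kernel_domain"
        by (intro image_subsetI segS) auto
      have i2: "snd ` (W \<times> {0..1}) \<subseteq> {0..1::real}" by auto
      have "continuous_on (W \<times> {0..1}) (\<lambda>p::complex \<times> real. x j (a + of_real (snd p) * (b - a)))"
        by (rule continuous_on_compose2[OF segc[OF j] _ i2]) (intro continuous_intros)
      then show "continuous_on (W \<times> {0..1}) (\<lambda>p. deriv k (fst p - (a + of_real (snd p) * (b - a))) * x j (a + of_real (snd p) * (b - a)))"
        by (intro continuous_on_mult continuous_on_compose2[OF ck' _ i] continuous_intros)
    qed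
    then show ?thesis unfolding J_def by (intro holomorphic_intros)
  qed
  have Chol: "conv b k (g j) holomorphic_on W" if j: "j < N" for j
  proof -
    have gd: "(g j has_field_derivative deriv (g j) y) (at y)" if "y \<in> W" for y
      by (rule holomorphic_derivI[OF ghol[OF j] W(1) that])
    have "continuous_on (insert b W) (g j)" "continuous_on (insert b W) (deriv (g j))"
      unfolding W(4) using ghol[OF j] W(1) by (auto intro!: holomorphic_on_imp_continuous_on holomorphic_deriv)
    from conv_derivative(1)[OF DW k(1) this gd] show ?thesis
      using W(1) by (metis (no_types, lifting) holomorphic_on_open)
  qed
  have Ghol: "G j holomorphic_on W" if "j < N" for j
    unfolding G_def by (intro holomorphic_intros ghol Jhol Chol that)
  have X_rel: "X0 j y = (\<Sum>i\<in>I. c i * X i j y) + G j y" if j: "j < N" and y: "y \<in> Y" for j y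
  proof -
    have 1: "conv a k (v0 j) y = conv a k (x j) y"
      by (rule conv_cong[OF conv_domain_Y y refl]) (simp add: x_v0)
    have 2: "conv a k (x j) y - conv b k (x j) y = J j y"
      unfolding J_def
      by (rule conv_change_base[OF side_a b.side_a Im_ne convex_E E_diff[OF y] k(1) xc[OF j] xhol[OF j] y])
    have vc: "continuous_on (insert b Y) (\<lambda>s. \<Sum>i\<in>I. c i * v i j s)"
      by (intro continuous_intros L3 j)
    have "conv b k (x j) y = conv b k (\<lambda>s. (\<Sum>i\<in>I. c i * v i j s) + g j s) y"
      by (rule conv_cong[OF DY y refl]) (simp add: x_b j)
    also have "\<dots> = conv b k (\<lambda>s. \<Sum>i\<in>I. c i * v i j s) y + conv b k (g j) y"
      by (rule conv_add_right[OF DY ck y vc gcont[OF j]])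
    also have "conv b k (\<lambda>s. \<Sum>i\<in>I. c i * v i j s) y = (\<Sum>i\<in>I. c i * conv b k (v i j) y)"
      by (rule conv_sum_right[OF DY ck y]) (rule L3[OF _ j])
    finally have 3: "conv b k (x j) y = (\<Sum>i\<in>I. c i * conv b k (v i j) y) + conv b k (g j) y" .
    have 4: "v0 j y = (\<Sum>i\<in>I. c i * v i j y) + g j y"
      using x_b[of y j] x_v0[of y j] y j by simp
    have 5: "(\<Sum>i\<in>I. c i * X i j y) = (\<Sum>i\<in>I. c i * v i j y) + (\<Sum>i\<in>I. c i * conv b k (v i j) y)"
      unfolding X_def by (simp only: distrib_left sum.distrib)
    have 6: "conv a k (v0 j) y = J j y + (\<Sum>i\<in>I. c i * conv b k (v i j) y) + conv b k (g j) y"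
      using 1 2 3 by (simp add: algebra_simps)
    show ?thesis unfolding 5 X0_def G_def 4 6 by (simp only: add_ac)
  qed
  let ?U = "lift N A Q \<tau> (\<rho>\<^sub>1 + \<rho>\<^sub>2) X0" and ?V = "\<lambda>i. lift N A Q \<tau> (\<rho>\<^sub>1 + \<rho>\<^sub>2) (X i)"
  have "connected_at (2 * N) Y b I c ?U ?V"
    unfolding connected_at_def
  proof (intro exI conjI allI impI ballI)
    show "open W" "b \<in> W" by fact+
    fix j assume j: "j < 2 * N"
    have "lift N A Q \<tau> (\<rho>\<^sub>1 + \<rho>\<^sub>2) G j holomorphic_on W"
      by (rule lift_holomorphic[OF W(1) Ghol \<tau> j])
    then show "lift N A Q \<tau> (\<rho>\<^sub>1 + \<rho>\<^sub>2) G j holomorphic_on Y \<union> W"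
      using W(3) by (simp add: Un_absorb1)
  next
    fix y j assume y: "y \<in> Y"
    show "?U j y = (\<Sum>i\<in>I. c i * ?V i j y) + lift N A Q \<tau> (\<rho>\<^sub>1 + \<rho>\<^sub>2) G j y"
      by (rule lift_linear[OF open_Y I L2 holomorphic_on_subset[OF Ghol W(3)] X_rel y])
  qed
  then show ?thesis using L0 L1 by (intro exI[of _ ?U] exI[of _ ?V]) simp
qed

text \<open>\<open>n\<close> counts the shifts needed until all exponents have real part above 1.
  Each step raises the germs by \<open>germ_shift\<close> and lowers the lifted solutions again by
  \<open>lifted_shift\<close>. Both operations are linear and keep remainders holomorphic at
  \<open>b\<close>, so the coefficients are untouched. Invertibility of A + 1, A + 2, ... is what
  raising requires.\<close>

lemma (in strip) connection_lift:
  fixes I :: "'i set" and n :: nat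
  assumes P: "P \<in> carrier_mat N N" and Q: "Q \<in> carrier_mat N N"
    and PQ: "P * Q = 1\<^sub>m N" "Q * P = 1\<^sub>m N" and \<tau>: "\<And>j. j < N \<Longrightarrow> \<tau> j \<noteq> 0" and I: "finite I"
  shows "A \<in> carrier_mat N N \<Longrightarrow>
    (\<And>s::nat. \<exists>B\<in>carrier_mat N N. B * (A + of_nat (Suc s) \<cdot>\<^sub>m 1\<^sub>m N) = 1\<^sub>m N \<and> (A + of_nat (Suc s) \<cdot>\<^sub>m 1\<^sub>m N) * B = 1\<^sub>m N) \<Longrightarrow>
    germ N \<tau> A Y a l\<^sub>0 h\<^sub>0 w\<^sub>0 \<Longrightarrow> Re l\<^sub>0 + n > 1 \<Longrightarrow>
    (\<And>i. i \<in> I \<Longrightarrow> germ N \<tau> A Y b (l i) (h i) (w i)) \<Longrightarrow> (\<And>i. i \<in> I \<Longrightarrow> Re (l i) + n > 1) \<Longrightarrow>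
    connected_at N Y b I c w\<^sub>0 w \<Longrightarrow>
    \<exists>V\<^sub>0 V. lifted N \<tau> P Q A \<rho>\<^sub>1 \<rho>\<^sub>2 Y a l\<^sub>0 h\<^sub>0 V\<^sub>0 \<and>
    (\<forall>i\<in>I. lifted N \<tau> P Q A \<rho>\<^sub>1 \<rho>\<^sub>2 Y b (l i) (h i) (V i)) \<and> connected_at (2 * N) Y b I c V\<^sub>0 V"
proof (induction n arbitrary: A \<rho>\<^sub>1 \<rho>\<^sub>2 l\<^sub>0 h\<^sub>0 w\<^sub>0 l h w)
  case 0
  show ?case
    by (rule connection_base[OF 0(1) P Q PQ(1) \<tau> I 0(3) _ 0(5) _ 0(7)]) (use 0 in auto)
next
  case (Suc n)
  interpret b: strip Y b a lo hi by (rule swap)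
  have A1: "A + 1\<^sub>m N \<in> carrier_mat N N" using Suc.prems(1) by simp
  obtain B where B: "B \<in> carrier_mat N N" "B * (A + 1\<^sub>m N) = 1\<^sub>m N" "(A + 1\<^sub>m N) * B = 1\<^sub>m N"
  proof -
    have "of_nat (Suc 0) \<cdot>\<^sub>m 1\<^sub>m N = (1\<^sub>m N :: complex mat)" by (intro eq_matI) auto
    then show ?thesis using Suc.prems(2)[of 0] that by auto
  qed
  define T where "T = (\<lambda>w j y. \<Sum>k<N. B $$ (j, k) * ((exp y - \<tau> k) * w k y :: complex))"
  obtain h0' where h0': "germ N \<tau> (A + 1\<^sub>m N) Y a (l\<^sub>0 + 1) h0' (T w\<^sub>0)" "\<And>j. j < N \<Longrightarrow> (l\<^sub>0 + 1) * h0' j a = exp a * h\<^sub>0 j a"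
    unfolding T_def by (rule germ_shift[OF Suc.prems(1) B side_a Suc.prems(3)]) blast
  have "\<exists>h'. germ N \<tau> (A + 1\<^sub>m N) Y b (l i + 1) h' (T (w i)) \<and> (\<forall>j<N. (l i + 1) * h' j b = exp b * h i j b)" if "i \<in> I" for i
    unfolding T_def by (rule germ_shift[OF Suc.prems(1) B b.side_a Suc.prems(5)[OF that]]) blast
  then obtain h' where h': "\<And>i. i \<in> I \<Longrightarrow> germ N \<tau> (A + 1\<^sub>m N) Y b (l i + 1) (h' i) (T (w i))"
    "\<And>i j. i \<in> I \<Longrightarrow> j < N \<Longrightarrow> (l i + 1) * h' i j b = exp b * h i j b" by metis
  have rel: "connected_at N Y b I c (T w\<^sub>0) (\<lambda>i. T (w i))"
    unfolding T_def by (rule connected_at_matrix[OF Suc.prems(7)])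
  have sh: "A + 1\<^sub>m N + of_nat (Suc s) \<cdot>\<^sub>m 1\<^sub>m N = A + of_nat (Suc (Suc s)) \<cdot>\<^sub>m 1\<^sub>m N" for s
    using Suc.prems(1) by (intro eq_matI) (auto simp: algebra_simps)
  have "\<exists>V\<^sub>0 V. lifted N \<tau> P Q (A + 1\<^sub>m N) (\<rho>\<^sub>1 + 1) (\<rho>\<^sub>2 + 1) Y a (l\<^sub>0 + 1) h0' V\<^sub>0 \<and>
    (\<forall>i\<in>I. lifted N \<tau> P Q (A + 1\<^sub>m N) (\<rho>\<^sub>1 + 1) (\<rho>\<^sub>2 + 1) Y b (l i + 1) (h' i) (V i)) \<and> connected_at (2 * N) Y b I c V\<^sub>0 V"
    by (rule Suc.IH[OF A1 _ h0'(1) _ h'(1) _ rel]) (use Suc.prems(2,4,6) in \<open>auto simp: sh simp del: of_nat_Suc\<close>, auto simp: algebra_simps)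
  then obtain V\<^sub>0 V where V: "lifted N \<tau> P Q (A + 1\<^sub>m N) (\<rho>\<^sub>1 + 1) (\<rho>\<^sub>2 + 1) Y a (l\<^sub>0 + 1) h0' V\<^sub>0"
    "\<And>i. i \<in> I \<Longrightarrow> lifted N \<tau> P Q (A + 1\<^sub>m N) (\<rho>\<^sub>1 + 1) (\<rho>\<^sub>2 + 1) Y b (l i + 1) (h' i) (V i)"
    "connected_at (2 * N) Y b I c V\<^sub>0 V" by blast
  have "connected_at (2 * N) Y b I c (\<lambda>j y. exp y * deriv (V\<^sub>0 j) y) (\<lambda>i j y. exp y * deriv (V i j) y)"
    by (rule connected_at_deriv[OF open_Y _ _ V(3)]) (use V(1,2) in \<open>auto simp: lifted_def euler_system_def\<close>)
  moreover have "lifted N \<tau> P Q A \<rho>\<^sub>1 \<rho>\<^sub>2 Y a l\<^sub>0 h\<^sub>0 (\<lambda>j y. exp y * deriv (V\<^sub>0 j) y)"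
    by (rule lifted_shift[OF Suc.prems(1) P Q PQ(2) _ side_a V(1)]; rule \<tau> h0'(2); assumption)
  moreover have "lifted N \<tau> P Q A \<rho>\<^sub>1 \<rho>\<^sub>2 Y b (l i) (h i) (\<lambda>j y. exp y * deriv (V i j) y)" if "i \<in> I" for i
    by (rule lifted_shift[OF Suc.prems(1) P Q PQ(2) _ b.side_a V(2)[OF that]]; rule \<tau> h'(2)[OF that]; assumption)
  ultimately show ?case by (intro exI[of _ "\<lambda>j y. exp y * deriv (V\<^sub>0 j) y"] exI[of _ "\<lambda>i j y. exp y * deriv (V i j) y"]) auto
qed

section \<open>Local solutions in the original coordinates\<close>

text \<open>Positions \<open>j\<close> count from 0, blocks from 1.\<close>

definition block_of :: "(nat \<Rightarrow> nat) \<Rightarrow> nat \<Rightarrow> nat" where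
  "block_of d j = (LEAST k. j < (\<Sum>k'=1..k. d k'))"

lemma block_of_bounds:
  assumes "j < (\<Sum>k=1..s. d k)"
  shows "block_of d j \<in> {1..s}" "(\<Sum>k=1..<block_of d j. d k) \<le> j"
    "j < (\<Sum>k=1..<block_of d j. d k) + d (block_of d j)"
proof -
  let ?k = "block_of d j"
  have 1: "j < (\<Sum>k'=1..?k. d k')" unfolding block_of_def by (rule LeastI[of _ s]) (rule assms)
  have 2: "?k \<le> s" unfolding block_of_def by (rule Least_le) (rule assms)
  obtain k where k: "?k = Suc k" using 1 by (cases "?k") auto
  have "\<not> j < (\<Sum>k'=1..k. d k')"
    using not_less_Least[of k "\<lambda>k. j < (\<Sum>k'=1..k. d k')"] k unfolding block_of_def by simp
  then show "?k \<in> {1..s}" "(\<Sum>k=1..<?k. d k) \<le> j" "j < (\<Sum>k=1..<?k. d k) + d ?k"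
    using 1 2 unfolding k by (simp_all add: atLeastLessThanSuc_atLeastAtMost)
qed

lemma block_of_eqI:
  assumes "1 \<le> k" "(\<Sum>k'=1..<k. d k') \<le> j" "j < (\<Sum>k'=1..<k. d k') + d k"
  shows "block_of d j = k"
  unfolding block_of_def
proof (rule Least_equality)
  obtain i where i: "k = Suc i" using assms(1) by (cases k) auto
  show "j < (\<Sum>k'=1..k. d k')" using assms(3) unfolding i by (simp add: atLeastLessThanSuc_atLeastAtMost)
  fix n assume n: "j < (\<Sum>k'=1..n. d k')"
  show "k \<le> n"
  proof (rule ccontr)
    assume "\<not> k \<le> n"
    then have "(\<Sum>k'=1..n. d k') \<le> (\<Sum>k'=1..<k. d k')" by (intro sum_mono2) auto
    then show False using n assms(2) by simp
  qed
qed

lemma scalar_blocks_entries: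
  "scalar_blocks s c d \<in> carrier_mat (\<Sum>k=1..s. d k) (\<Sum>k=1..s. d k)"
  "i < (\<Sum>k=1..s. d k) \<Longrightarrow> j < (\<Sum>k=1..s. d k) \<Longrightarrow>
    scalar_blocks s c d $$ (i, j) = (if i = j then c (block_of d i) else 0)"
proof -
  have "scalar_blocks s c d \<in> carrier_mat (\<Sum>k=1..s. d k) (\<Sum>k=1..s. d k) \<and>
    (\<forall>i j. i < (\<Sum>k=1..s. d k) \<longrightarrow> j < (\<Sum>k=1..s. d k) \<longrightarrow>
    scalar_blocks s c d $$ (i, j) = (if i = j then c (block_of d i) else 0))"
  proof (induction s)
    case (Suc s)
    let ?n = "\<Sum>k=1..s. d k" and ?M = "scalar_blocks s c d"
    have M: "?M \<in> carrier_mat ?n ?n" using Suc by simp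
    have eq: "scalar_blocks (Suc s) c d =
        four_block_mat ?M (0\<^sub>m ?n (d (Suc s))) (0\<^sub>m (d (Suc s)) ?n) (c (Suc s) \<cdot>\<^sub>m 1\<^sub>m (d (Suc s)))"
    proof -
      have "[1..<Suc (Suc s)] = [1..<Suc s] @ [Suc s]" by simp
      then have "scalar_blocks (Suc s) c d = diag_block_mat (map (\<lambda>k. c k \<cdot>\<^sub>m 1\<^sub>m (d k)) [1..<Suc s] @ [c (Suc s) \<cdot>\<^sub>m 1\<^sub>m (d (Suc s))])"
        unfolding scalar_blocks_def by (simp only: map_append list.map)
      then show ?thesis using M unfolding diag_block_mat_last Let_def scalar_blocks_def[symmetric] by simp
    qed
    have last: "block_of d i = Suc s" if "?n \<le> i" "i < ?n + d (Suc s)" for i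
      by (rule block_of_eqI) (use that in \<open>simp_all add: atLeastLessThanSuc_atLeastAtMost\<close>)
    have "scalar_blocks (Suc s) c d $$ (i, j) = (if i = j then c (block_of d i) else 0)"
      if ij: "i < ?n + d (Suc s)" "j < ?n + d (Suc s)" for i j
    proof (cases "i < ?n \<and> j < ?n")
      case True
      then show ?thesis
        unfolding eq by (subst index_mat_four_block(1)) (use Suc carrier_matD[OF M] ij in \<open>auto\<close>)
    next
      case False
      then show ?thesis
        unfolding eq by (subst index_mat_four_block(1)) (use carrier_matD[OF M] ij last[of i] in \<open>auto simp: not_less\<close>)
    qed
    moreover have "scalar_blocks (Suc s) c d \<in> carrier_mat (?n + d (Suc s)) (?n + d (Suc s))"
      unfolding eq by (rule four_block_carrier_mat[OF M]) simp
    ultimately show ?case by simp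
  qed (simp add: scalar_blocks_def)
  then show "scalar_blocks s c d \<in> carrier_mat (\<Sum>k=1..s. d k) (\<Sum>k=1..s. d k)"
    "i < (\<Sum>k=1..s. d k) \<Longrightarrow> j < (\<Sum>k=1..s. d k) \<Longrightarrow>
    scalar_blocks s c d $$ (i, j) = (if i = j then c (block_of d i) else 0)" by auto
qed

lemma solves_on_component:
  assumes f: "solves_on N T M D f" and T: "T \<in> carrier_mat N N" and M: "M \<in> carrier_mat N N"
    and diag: "\<And>i j. i < N \<Longrightarrow> j < N \<Longrightarrow> T $$ (i, j) = (if i = j then d i else 0)"
    and x: "x \<in> D" and j: "j < N"
  shows "(x - d j) * deriv (\<lambda>y. f y $ j) x = (\<Sum>k<N. M $$ (j, k) * f x $ k)"
proof -
  have fx: "f x \<in> carrier_vec N" using f x by (simp add: solves_on_def)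
  then have fx': "f x = vec N (\<lambda>k. f x $ k)" by auto
  have "((x \<cdot>\<^sub>m 1\<^sub>m N - T) *\<^sub>v vec N (\<lambda>j. deriv (\<lambda>y. f y $ j) x)) $ j = (M *\<^sub>v f x) $ j"
    using f x by (simp add: solves_on_def)
  also have "(M *\<^sub>v f x) $ j = (\<Sum>k<N. M $$ (j, k) * f x $ k)"
    by (subst fx') (use j in \<open>simp only: mult_mat_vec_sum[OF M] index_vec\<close>)
  also have "((x \<cdot>\<^sub>m 1\<^sub>m N - T) *\<^sub>v vec N (\<lambda>j. deriv (\<lambda>y. f y $ j) x)) $ j =
      (\<Sum>k<N. (x \<cdot>\<^sub>m 1\<^sub>m N - T) $$ (j, k) * deriv (\<lambda>y. f y $ k) x)"
    using j by (subst mult_mat_vec_sum[of _ N]) (use T in auto)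
  also have "\<dots> = (\<Sum>k<N. if k = j then (x - d j) * deriv (\<lambda>y. f y $ j) x else 0)"
    by (rule sum.cong) (use T j diag in auto)
  also have "\<dots> = (x - d j) * deriv (\<lambda>y. f y $ j) x" using j by simp
  finally show ?thesis .
qed

section \<open>Prescribed arguments and principal logarithms\<close>

lemma pow_arg_exp:
  assumes "exp L = z"
  shows "is_Arg z (Im L)" "pow_arg (Im L) z \<beta> = exp (\<beta> * L)"
proof -
  have n: "norm z = exp (Re L)" using assms by (metis norm_exp_eq_Re)
  have "exp L = of_real (exp (Re L)) * exp (\<i> * of_real (Im L))"
    using complex_eq[of L] by (metis exp_add exp_of_real)
  then show "is_Arg z (Im L)" using assms n by (simp add: is_Arg_def)
  show "pow_arg (Im L) z \<beta> = exp (\<beta> * L)" using n by (simp add: pow_arg_def)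
qed

text \<open>Write exp s - 1 = s psi(s) with psi(0) = 1. Near 0 the numbers s and exp s - 1 have
  imaginary parts of the same sign and psi(s) has positive real part, so the arguments of s and
  psi(s) add up within the principal range and Lambda = Ln psi.\<close>

lemma Ln_exp_minus_one:
  obtains \<epsilon> \<Lambda> where "0 < \<epsilon>" "\<Lambda> holomorphic_on ball 0 \<epsilon>" "\<Lambda> 0 = (0::complex)"
    "\<And>s. s \<in> ball 0 \<epsilon> \<Longrightarrow> Im s \<noteq> 0 \<Longrightarrow> exp s - 1 \<noteq> 0 \<and> Ln (exp s - 1) = Ln s + \<Lambda> s"
    "\<And>s. s \<in> ball 0 \<epsilon> \<Longrightarrow> 0 < Im s \<Longrightarrow> 0 < Im (Ln (exp s - 1)) \<and> Im (Ln (exp s - 1)) < pi"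
    "\<And>s. s \<in> ball 0 \<epsilon> \<Longrightarrow> Im s < 0 \<Longrightarrow> - pi < Im (Ln (exp s - 1)) \<and> Im (Ln (exp s - 1)) < 0"
proof -
  obtain E where E: "E holomorphic_on UNIV" "\<And>t. 1 - exp (- t) = t * E t" "E 0 = (1::complex)"
    using exp_minus_one_factor by metis
  define \<psi> where "\<psi> = (\<lambda>s. E (- s))"
  have \<psi>: "exp s - 1 = s * \<psi> s" for s using E(2)[of "- s"] by (simp add: \<psi>_def algebra_simps)
  have \<psi>hol: "\<psi> holomorphic_on UNIV"
    unfolding \<psi>_def by (rule holomorphic_on_compose_gen[OF _ E(1), unfolded o_def]) (auto intro!: holomorphic_intros)
  have "isCont \<psi> 0"
    using \<psi>hol holomorphic_on_imp_continuous_on continuous_on_eq_continuous_at open_UNIV by blast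
  from this[unfolded continuous_at_eps_delta, rule_format, of 1]
  obtain d where d: "0 < d" "\<And>s. dist s 0 < d \<Longrightarrow> dist (\<psi> s) (\<psi> 0) < 1" by auto
  define \<epsilon> where "\<epsilon> = min d 1"
  have \<epsilon>: "0 < \<epsilon>" "\<epsilon> \<le> 1" "\<epsilon> \<le> d" using d by (auto simp: \<epsilon>_def)
  have \<psi>0: "\<psi> 0 = 1" by (simp add: \<psi>_def E)
  have Re: "0 < Re (\<psi> s)" if "s \<in> ball 0 \<epsilon>" for s
  proof -
    have "norm (\<psi> s - 1) < 1" using d(2)[of s] that \<epsilon> by (simp add: \<psi>0 dist_norm)
    then show ?thesis using abs_Re_le_cmod[of "\<psi> s - 1"] by simp
  qed
  have nz: "\<psi> s \<notin> \<real>\<^sub>\<le>\<^sub>0" if "s \<in> ball 0 \<epsilon>" for s using Re[OF that] by (auto simp: complex_nonpos_Reals_iff)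
  have Im_eq: "Im (exp s - 1) = exp (Re s) * sin (Im s)" for s :: complex by (simp add: Im_exp)
  have small: "\<bar>Im s\<bar> < pi" if "s \<in> ball 0 \<epsilon>" for s :: complex
    using abs_Im_le_cmod[of s] that \<epsilon> pi_gt3 by simp
  have pos: "0 < Im (exp s - 1)" if "s \<in> ball 0 \<epsilon>" "0 < Im s" for s
    unfolding Im_eq using small[OF that(1)] that by (intro mult_pos_pos sin_gt_zero) auto
  have neg: "Im (exp s - 1) < 0" if "s \<in> ball 0 \<epsilon>" "Im s < 0" for s
  proof -
    have "0 < sin (- Im s)" using small[OF that(1)] that by (intro sin_gt_zero) auto
    then show ?thesis unfolding Im_eq by (simp add: mult_pos_neg)
  qed
  have pos': "0 < Im (Ln z) \<and> Im (Ln z) < pi" if "0 < Im z" for z using Im_Ln_pos_lt_imp[OF that] .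
  have neg': "- pi < Im (Ln z) \<and> Im (Ln z) < 0" if "Im z < 0" for z
  proof -
    have z: "z \<noteq> 0" using that by auto
    then show ?thesis using mpi_less_Im_Ln[OF z] Im_Ln_le_pi[OF z] Im_Ln_pos_le[OF z] that by linarith
  qed
  have Ln\<psi>: "\<bar>Im (Ln (\<psi> s))\<bar> < pi / 2" if "s \<in> ball 0 \<epsilon>" for s
    using Re_Ln_pos_lt_imp[OF Re[OF that]] by simp
  have main: "exp s - 1 \<noteq> 0 \<and> Ln (exp s - 1) = Ln s + Ln (\<psi> s)" if s: "s \<in> ball 0 \<epsilon>" "Im s \<noteq> 0" for s
  proof -
    have ne: "s \<noteq> 0" "\<psi> s \<noteq> 0" using s nz[OF s(1)] by auto
    let ?L = "Ln s + Ln (\<psi> s)"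
    have e: "exp ?L = exp s - 1" using ne by (simp add: exp_add \<psi>)
    have Im: "Im (exp ?L) = exp (Re ?L) * sin (Im ?L)" by (rule Im_exp)
    \<comment> \<open>If the sum of the two arguments left this range, its sine would have the wrong
      sign.\<close>
    have "- pi < Im ?L \<and> Im ?L \<le> pi"
    proof (cases "0 < Im s")
      case True
      have "0 < sin (Im ?L)" using pos[OF s(1) True] unfolding e[symmetric] Im by (simp add: zero_less_mult_iff)
      moreover have IL: "Im ?L = Im (Ln s) + Im (Ln (\<psi> s))" by simp
      moreover have "Im ?L < 2 * pi" "- pi < Im ?L" using pos'[OF True] Ln\<psi>[OF s(1)] unfolding IL abs_less_iff by linarith+
      ultimately show ?thesis using sin_lt_zero[of "Im ?L"] by linarith
    next
      case False
      then have F: "Im s < 0" using s by simp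
      have "sin (Im ?L) < 0" using neg[OF s(1) F] unfolding e[symmetric] Im by (simp add: mult_less_0_iff)
      then have sp: "0 < sin (- Im ?L)" using sin_minus[of "Im ?L"] by linarith
      have IL: "Im ?L = Im (Ln s) + Im (Ln (\<psi> s))" by simp
      have "- Im ?L < 2 * pi" "- Im ?L > - pi" using neg'[OF F] Ln\<psi>[OF s(1)] unfolding IL abs_less_iff by linarith+
      moreover have "- Im ?L \<noteq> pi" using sp sin_pi by (metis less_irrefl)
      moreover have "\<not> (pi < - Im ?L \<and> - Im ?L < 2 * pi)" using sp sin_lt_zero[of "- Im ?L"] by linarith
      ultimately show ?thesis by linarith
    qed
    then have "Ln (exp ?L) = ?L" by (intro Ln_exp) auto
    then show ?thesis unfolding e using ne \<psi>[of s] by simp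
  qed
  show ?thesis
  proof (rule that[of \<epsilon> "\<lambda>s. Ln (\<psi> s)"])
    show "(\<lambda>s. Ln (\<psi> s)) holomorphic_on ball 0 \<epsilon>"
      by (rule holomorphic_on_Ln'[OF nz holomorphic_on_subset[OF \<psi>hol]]) auto
    fix s :: complex assume s: "s \<in> ball 0 \<epsilon>"
    show "exp s - 1 \<noteq> 0 \<and> Ln (exp s - 1) = Ln s + Ln (\<psi> s)" if "Im s \<noteq> 0" using main[OF s that] .
    show "0 < Im (Ln (exp s - 1)) \<and> Im (Ln (exp s - 1)) < pi" if "0 < Im s" by (rule pos'[OF pos[OF s that]])
    show "- pi < Im (Ln (exp s - 1)) \<and> Im (Ln (exp s - 1)) < 0" if "Im s < 0" by (rule neg'[OF neg[OF s that]])
  qed (use \<epsilon> \<psi>0 in auto)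
qed

text \<open>\<open>L\<close> is the logarithm of \<open>x y - p\<close> with imaginary part in
  \<open>I\<close>, so the prescribed power is exp(alpha L). Splitting off \<open>Ln (y - c)\<close>
  leaves the standard power in \<open>y\<close> and puts \<open>exp (\<alpha> * \<Lambda> c)\<close>
  into the leading coefficient.\<close>

lemma local_solution_branch:
  assumes f: "local_solution N T M p \<alpha> j\<^sub>0 I B D f" and x: "x holomorphic_on UNIV" "x c = p"
    and \<epsilon>: "0 < \<epsilon>" and \<Lambda>: "\<Lambda> holomorphic_on ball c \<epsilon>"
    and L: "\<And>y. y \<in> Y \<Longrightarrow> y \<in> ball c \<epsilon> \<Longrightarrow> x y \<in> B \<and> x y \<noteq> p \<and> exp (L y) = x y - p \<and> Im (L y) \<in> I \<and> L y = Ln (y - c) + \<Lambda> y"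
    and j: "j < N"
  obtains h where "has_branch Y c \<alpha> (\<lambda>y. f (x y) $ j) h" "h c = exp (\<alpha> * \<Lambda> c) * (if j = j\<^sub>0 then 1 else 0)"
proof -
  obtain e G where e': "0 < e" "G 0 = unit_vec N j\<^sub>0" "\<forall>j<N. \<forall>z\<in>ball 0 e. summable (\<lambda>m. G m $ j * z ^ m)"
    "\<forall>x\<in>B \<inter> ball p e - {p}. \<forall>\<phi>\<in>I. is_Arg (x - p) \<phi> \<longrightarrow>
       (\<forall>j<N. f x $ j = pow_arg \<phi> (x - p) \<alpha> * (\<Sum>m. G m $ j * (x - p) ^ m))"
    using f unfolding local_solution_def by (elim exE conjE) (rule that; assumption)
  have e: "0 < e" "G 0 = unit_vec N j\<^sub>0" "\<And>z. z \<in> ball 0 e \<Longrightarrow> summable (\<lambda>m. G m $ j * z ^ m)"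
    using e'(1,2) e'(3)[rule_format, OF j] by simp_all
  have exp: "f x $ j = pow_arg \<phi> (x - p) \<alpha> * (\<Sum>m. G m $ j * (x - p) ^ m)"
    if "x \<in> B \<inter> ball p e - {p}" "\<phi> \<in> I" "is_Arg (x - p) \<phi>" for x \<phi>
    by (rule e'(4)[rule_format, OF that j])
  define S where "S = (\<lambda>z. \<Sum>m. G m $ j * (z - p) ^ m)"
  have Shol: "S holomorphic_on ball p e"
  proof (rule power_series_holomorphic)
    fix w assume "w \<in> ball p e"
    then have "w - p \<in> ball 0 e" by (simp add: dist_norm norm_minus_commute)
    from e(3)[OF this] show "(\<lambda>n. G n $ j * (w - p) ^ n) sums S w" unfolding S_def by (rule summable_sums)
  qed
  have S0: "S p = (if j = j\<^sub>0 then 1 else 0)"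
    using e(2) j by (simp add: S_def unit_vec_def)
  have "isCont x c" using x(1) holomorphic_on_imp_continuous_on continuous_on_eq_continuous_at open_UNIV by blast
  from this[unfolded continuous_at_eps_delta x(2), rule_format, of e] e(1)
  obtain d where d: "0 < d" "\<And>y. dist y c < d \<Longrightarrow> dist (x y) p < e" by auto
  define \<eta> where "\<eta> = min \<epsilon> d"
  have \<eta>: "0 < \<eta>" "ball c \<eta> \<subseteq> ball c \<epsilon>" "ball c \<eta> \<subseteq> ball c d" using \<epsilon> d by (auto simp: \<eta>_def)
  have xb: "x y \<in> ball p e" if "y \<in> ball c \<eta>" for y
    using d(2)[of y] that \<eta>(3) by (auto simp: dist_commute)
  have "(\<lambda>y. S (x y)) holomorphic_on ball c \<eta>"
    by (rule holomorphic_on_compose_gen[OF holomorphic_on_subset[OF x(1)] Shol, unfolded o_def]) (use xb in auto)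
  then have "(\<lambda>y. exp (\<alpha> * \<Lambda> y) * S (x y)) holomorphic_on ball c \<eta>"
    by (intro holomorphic_intros holomorphic_on_subset[OF \<Lambda> \<eta>(2)])
  then have "has_branch Y c \<alpha> (\<lambda>y. f (x y) $ j) (\<lambda>y. exp (\<alpha> * \<Lambda> y) * S (x y))"
  proof (rule has_branchI[OF \<eta>(1)])
    fix y assume y: "y \<in> Y" "y \<in> ball c \<eta>"
    note l = L[OF y(1) subsetD[OF \<eta>(2) y(2)]]
    have eL: "exp (L y) = x y - p" and Ly: "L y = Ln (y - c) + \<Lambda> y" and m: "x y \<in> B" "x y \<noteq> p" "Im (L y) \<in> I"
      using l by blast+
    have "f (x y) $ j = pow_arg (Im (L y)) (x y - p) \<alpha> * S (x y)"
      unfolding S_def by (rule exp[OF _ m(3) pow_arg_exp(1)[OF eL]]) (use m xb[OF y(2)] in blast)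
    then show "f (x y) $ j = exp (\<alpha> * Ln (y - c)) * (exp (\<alpha> * \<Lambda> y) * S (x y))"
      unfolding pow_arg_exp(2)[OF eL] unfolding Ly by (simp add: ring_distribs exp_add)
  qed
  then show ?thesis using that S0 x(2) by simp
qed

lemma euler_system_compose:
  assumes sol: "solves_on N T M D f" and T: "T \<in> carrier_mat N N" and M: "M \<in> carrier_mat N N"
    and diag: "\<And>i j. i < N \<Longrightarrow> j < N \<Longrightarrow> T $$ (i, j) = (if i = j then d i else 0)"
    and D: "open D" and Y: "open Y" and x: "\<And>y. y \<in> Y \<Longrightarrow> x y \<in> D \<and> (x has_field_derivative x' y) (at y)"
    and \<phi>: "\<And>j y. j < N \<Longrightarrow> y \<in> Y \<Longrightarrow> \<phi> j y * x' y = x y - d j"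
  shows "euler_system N \<phi> M Y (\<lambda>j y. f (x y) $ j)"
proof -
  have hol: "(\<lambda>z. f z $ j) holomorphic_on D" if "j < N" for j using sol that by (simp add: solves_on_def)
  have der: "((\<lambda>y. f (x y) $ j) has_field_derivative deriv (\<lambda>z. f z $ j) (x y) * x' y) (at y)" if "j < N" "y \<in> Y" for j y
  proof (rule DERIV_chain2[where f = "\<lambda>z. f z $ j" and g = x])
    show "((\<lambda>z. f z $ j) has_field_derivative deriv (\<lambda>z. f z $ j) (x y)) (at (x y))"
      by (rule holomorphic_derivI[OF hol[OF that(1)] D]) (use x[OF that(2)] in simp)
    show "(x has_field_derivative x' y) (at y)" using x[OF that(2)] by simp
  qed
  show ?thesis
    unfolding euler_system_def
  proof (intro conjI allI impI ballI)
    fix j assume j: "j < N"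
    show "(\<lambda>y. f (x y) $ j) holomorphic_on Y" using der[OF j] Y by (auto simp: holomorphic_on_open)
    fix y assume y: "y \<in> Y"
    have "\<phi> j y * deriv (\<lambda>y. f (x y) $ j) y = (x y - d j) * deriv (\<lambda>z. f z $ j) (x y)"
      unfolding DERIV_imp_deriv[OF der[OF j y]] \<phi>[OF j y, symmetric] by (simp add: mult_ac)
    also have "\<dots> = (\<Sum>k<N. M $$ (j, k) * f (x y) $ k)"
      by (rule solves_on_component[OF sol T M diag _ j]) (use x[OF y] in auto)
    finally show "\<phi> j y * deriv (\<lambda>y. f (x y) $ j) y = (\<Sum>k<N. M $$ (j, k) * f (x y) $ k)" .
  qed
qed

text \<open>\<open>fuchs_branch_unique\<close> is applied to V - kappa V' with the exponent l - 1. A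
  resonance l - 1 + m = A_jj makes A_jj - l an integer, so genericity leaves only A_jj = l and m =
  1. The coefficient in question is then the difference of the leading coefficients, which is zero
  by \<open>lead\<close>.\<close>

lemma lifted_unique:
  assumes Y: "side_domain Y a" "connected Y" and A: "A \<in> carrier_mat N N" and \<tau>: "\<And>j. j < N \<Longrightarrow> \<tau> j \<noteq> 0"
    and P: "P \<in> carrier_mat N N" and Q: "Q \<in> carrier_mat N N"
    and V': "lifted N \<tau> P Q A \<rho>\<^sub>1 \<rho>\<^sub>2 Y a l h V'"
    and V: "euler_system (2 * N) (ext_weight N \<tau>) (ext_A N A P Q (Q * A * P) \<rho>\<^sub>1 \<rho>\<^sub>2) Y V"
    and br: "\<And>j. j < 2 * N \<Longrightarrow> has_branch Y a l (V j) (H j)"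
    and lead: "\<And>j. j < N \<Longrightarrow> \<tau> j = exp a \<Longrightarrow> H j a = \<kappa> * (exp (- (\<rho>\<^sub>1 + \<rho>\<^sub>2) * a) * h j a)"
    and offdiag: "\<And>j k. j < N \<Longrightarrow> k < N \<Longrightarrow> \<tau> j = exp a \<Longrightarrow> \<tau> k = exp a \<Longrightarrow> j \<noteq> k \<Longrightarrow> A $$ (j, k) = 0"
    and diag: "\<And>j. j < N \<Longrightarrow> \<tau> j = exp a \<Longrightarrow> A $$ (j, j) = l \<or> A $$ (j, j) - l \<notin> \<int>"
    and l: "l \<notin> \<int>" and j: "j < 2 * N" and y: "y \<in> Y"
  shows "V j y = \<kappa> * V' j y"
proof -
  let ?M = "ext_A N A P Q (Q * A * P) \<rho>\<^sub>1 \<rho>\<^sub>2"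
  have op: "open Y" using Y(1) by (simp add: side_domain_def)
  have V'e: "euler_system (2 * N) (ext_weight N \<tau>) ?M Y V'" using V' by (simp add: lifted_def)
  obtain K where K: "\<And>j. j < 2 * N \<Longrightarrow> has_branch Y a (l - 1) (V' j) (K j)"
    "\<And>j. j < N \<Longrightarrow> \<tau> j = exp a \<Longrightarrow> K j a = 0 \<and> deriv (K j) a = exp (- (\<rho>\<^sub>1 + \<rho>\<^sub>2) * a) * h j a"
    using V' unfolding lifted_def by blast
  define F where "F = (\<lambda>j y. V j y + (- \<kappa>) * V' j y)"
  \<comment> \<open>The factor \<open>y - a\<close> adapts \<open>H\<close>, which belongs to the
    exponent \<open>l\<close>, to the exponent \<open>l - 1\<close> used for
    \<open>V'\<close>.\<close>
  define R where "R = (\<lambda>j y. (y - a) * H j y + (- \<kappa>) * K j y)"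
  have hol: "V j holomorphic_on Y" "V' j holomorphic_on Y" if "j < 2 * N" for j
    using V V'e that by (auto simp: euler_system_def)
  have z: "ext_weight N \<tau> j a = 0 \<longleftrightarrow> j < N \<and> \<tau> j = exp a" if "j < 2 * N" for j
    using \<tau>[of j] by (auto simp: ext_weight_def field_simps)
  have entry: "?M $$ (j, k) = A $$ (j, k)" if "j < N" "k < N" for j k
    using that A P Q by (simp add: ext_A_def)
  have "F j y = 0"
  proof (rule fuchs_branch_unique[where a = a and f = F and H = R and S = "2 * N" and \<phi> = "ext_weight N \<tau>" and
        M = "\<lambda>j k. ?M $$ (j, k)" and \<alpha> = "l - 1" and Y = Y, OF Y])
    show "F j holomorphic_on Y" if "j < 2 * N" for j
      unfolding F_def by (intro holomorphic_intros hol that)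
    show "ext_weight N \<tau> j y * deriv (F j) y = (\<Sum>k<2 * N. ?M $$ (j, k) * F k y)" if "y \<in> Y" "j < 2 * N" for y j
    proof -
      have "(F j has_field_derivative deriv (V j) y + (- \<kappa>) * deriv (V' j) y) (at y)"
        unfolding F_def by (intro DERIV_add DERIV_cmult holomorphic_derivI[OF _ op] hol that)
      then have "ext_weight N \<tau> j y * deriv (F j) y = ext_weight N \<tau> j y * deriv (V j) y + (- \<kappa>) * (ext_weight N \<tau> j y * deriv (V' j) y)"
        by (simp add: DERIV_imp_deriv algebra_simps)
      also have "ext_weight N \<tau> j y * deriv (V j) y = (\<Sum>k<2 * N. ?M $$ (j, k) * V k y)"
        using V that by (simp add: euler_system_def)
      also have "ext_weight N \<tau> j y * deriv (V' j) y = (\<Sum>k<2 * N. ?M $$ (j, k) * V' k y)"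
        using V'e that by (simp add: euler_system_def)
      finally show ?thesis by (simp add: F_def sum_distrib_left sum_subtractf sum_negf algebra_simps)
    qed
    show "has_branch Y a (l - 1) (F j) (R j)" if "j < 2 * N" for j
      unfolding F_def R_def
      by (intro has_branch_add has_branch_const_mult K that has_branch_raise[OF Y(1)]) (use br[OF that] in simp)
    show "ext_weight N \<tau> j holomorphic_on UNIV" if "j < 2 * N" for j
      unfolding ext_weight_def[abs_def] using \<tau>[of j] by (cases "j < N") (auto intro!: holomorphic_intros)
    show "deriv (ext_weight N \<tau> j) a = 1" if "j < 2 * N" "ext_weight N \<tau> j a = 0" for j
    proof -
      have jN: "j < N" "\<tau> j = exp a" using z[OF that(1)] that(2) by auto
      have "(ext_weight N \<tau> j has_field_derivative exp a / \<tau> j) (at a)"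
        unfolding ext_weight_def[abs_def] using jN \<tau>[OF jN(1)] by (auto intro!: derivative_eq_intros)
      then show ?thesis using jN by (simp add: DERIV_imp_deriv)
    qed
    show "?M $$ (j, k) = 0" if "j < 2 * N" "k < 2 * N" "ext_weight N \<tau> j a = 0" "ext_weight N \<tau> k a = 0" "j \<noteq> k" for j k
      using z that entry offdiag by auto
    show "l - 1 + of_nat m \<noteq> 0" for m
    proof
      assume "l - 1 + of_nat m = 0"
      then have "l = 1 - of_nat m" by (simp add: algebra_simps add_eq_0_iff2)
      then show False using l by simp
    qed
    show "(deriv ^^ m) (R j) a = 0" if jm: "j < 2 * N" "ext_weight N \<tau> j a = 0" "l - 1 + of_nat m = ?M $$ (j, j)" for j m
    proof -
      have jN: "j < N" "\<tau> j = exp a" using z[OF jm(1)] jm(2) by auto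
      have "A $$ (j, j) - l = of_nat m - 1" using jm(3) entry[OF jN(1,1)] by (simp add: algebra_simps)
      then have "A $$ (j, j) - l \<in> \<int>" by simp
      then have "A $$ (j, j) = l" using diag[OF jN] by auto
      then have "of_nat m = (1::complex)" using \<open>A $$ (j, j) - l = of_nat m - 1\<close> by simp
      then have m: "m = 1" using of_nat_eq_1_iff by blast
      obtain \<epsilon> where e: "0 < \<epsilon>" "H j holomorphic_on ball a \<epsilon>" using br[OF jm(1)] by (rule has_branchE) blast
      obtain \<epsilon>' where e': "0 < \<epsilon>'" "K j holomorphic_on ball a \<epsilon>'" using K(1)[OF jm(1)] by (rule has_branchE) blast
      have "(H j has_field_derivative deriv (H j) a) (at a)" "(K j has_field_derivative deriv (K j) a) (at a)"
        using e e' by (auto intro: holomorphic_derivI)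
      then have "(R j has_field_derivative H j a + (- \<kappa>) * deriv (K j) a) (at a)"
        unfolding R_def by (auto intro!: derivative_eq_intros)
      then have "deriv (R j) a = H j a + (- \<kappa>) * deriv (K j) a" by (rule DERIV_imp_deriv)
      then show ?thesis using K(2)[OF jN] lead[OF jN] by (simp add: m)
    qed
  qed (rule j, rule y)
  then show ?thesis by (simp add: F_def)
qed

text \<open>One has exp y - exp a = exp a (exp(y - a) - 1), and the principal logarithm of the last
  factor has imaginary part in (-pi, 0) below \<open>a\<close> and in (0, pi) above it. Hence the
  prescribed range (Im a - 2 pi, Im a) requires a correction by -2 pi i precisely when
  \<open>Y\<close> lies above \<open>a\<close>.\<close>

lemma underlying_branch:
  assumes f: "local_solution N T M (\<eta> + exp a) \<alpha> j\<^sub>0 {Im a - 2 * pi<..<Im a} B D f"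
    and side: "\<And>y. y \<in> Y \<Longrightarrow> (if low then Im y < Im a else Im a < Im y)"
    and B: "\<And>y. y \<in> Y \<Longrightarrow> \<eta> + exp y \<in> B" and j: "j < N"
  obtains h where "has_branch Y a \<alpha> (\<lambda>y. f (\<eta> + exp y) $ j) h"
    "h a = exp (\<alpha> * (a + (if low then 0 else - 2 * of_real pi * \<i>))) * (if j = j\<^sub>0 then 1 else 0)"
proof -
  obtain \<epsilon> \<Lambda> where e: "0 < \<epsilon>" "\<Lambda> holomorphic_on ball 0 \<epsilon>" "\<Lambda> 0 = (0::complex)"
    and Ln: "\<And>s. s \<in> ball 0 \<epsilon> \<Longrightarrow> Im s \<noteq> 0 \<Longrightarrow> exp s - 1 \<noteq> 0 \<and> Ln (exp s - 1) = Ln s + \<Lambda> s"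
    and pos: "\<And>s. s \<in> ball 0 \<epsilon> \<Longrightarrow> 0 < Im s \<Longrightarrow> 0 < Im (Ln (exp s - 1)) \<and> Im (Ln (exp s - 1)) < pi"
    and neg: "\<And>s. s \<in> ball 0 \<epsilon> \<Longrightarrow> Im s < 0 \<Longrightarrow> - pi < Im (Ln (exp s - 1)) \<and> Im (Ln (exp s - 1)) < 0"
    by (rule Ln_exp_minus_one) blast
  define c0 where "c0 = (if low then 0 else - 2 * of_real pi * \<i>)"
  have ec0: "exp c0 = 1"
  proof -
    have "- 2 * of_real pi * \<i> = - (2 * of_real pi * \<i>)" by simp
    then have "exp (- 2 * of_real pi * \<i>) = 1" by (simp only: exp_minus exp_two_pi_i inverse_1)
    then show ?thesis by (simp add: c0_def)
  qed
  define L where "L = (\<lambda>y. a + c0 + Ln (exp (y - a) - 1))"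
  have \<Lambda>hol: "(\<lambda>y. a + c0 + \<Lambda> (y - a)) holomorphic_on ball a \<epsilon>"
    by (intro holomorphic_intros holomorphic_on_compose_gen[OF _ e(2), unfolded o_def]) (auto simp: dist_norm norm_minus_commute)
  have fact: "exp a * (exp (y - a) - 1) = exp y - exp a" for y
    by (simp add: exp_diff algebra_simps)
  have key: "\<eta> + exp y \<in> B \<and> \<eta> + exp y \<noteq> \<eta> + exp a \<and> exp (L y) = \<eta> + exp y - (\<eta> + exp a) \<and>
       Im (L y) \<in> {Im a - 2 * pi<..<Im a} \<and> L y = Ln (y - a) + (a + c0 + \<Lambda> (y - a))"
    if y: "y \<in> Y" "y \<in> ball a \<epsilon>" for y
  proof -
    have s: "y - a \<in> ball 0 \<epsilon>" using y(2) by (simp add: dist_norm norm_minus_commute)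
    have ne: "Im (y - a) \<noteq> 0" using side[OF y(1)] by (auto split: if_splits)
    note l = Ln[OF s ne]
    have eL: "exp (L y) = exp y - exp a"
      unfolding L_def exp_add using conjunct1[OF l] by (simp add: ec0 fact)
    have "exp y - exp a \<noteq> 0" using l unfolding fact[symmetric] by simp
    moreover have "Im (L y) \<in> {Im a - 2 * pi<..<Im a}"
      using side[OF y(1)] neg[OF s] pos[OF s] pi_gt_zero by (auto simp: L_def c0_def split: if_splits)
    ultimately show ?thesis using B[OF y(1)] eL l by (simp add: L_def)
  qed
  obtain h where h: "has_branch Y a \<alpha> (\<lambda>y. f (\<eta> + exp y) $ j) h"
    "h a = exp (\<alpha> * (a + c0 + \<Lambda> (a - a))) * (if j = j\<^sub>0 then 1 else 0)"
    by (rule local_solution_branch[OF f, where x = "\<lambda>y. \<eta> + exp y" and c = a and L = L, OF _ refl e(1) \<Lambda>hol key j])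
       (auto intro!: holomorphic_intros)
  then show ?thesis using that e(3) by (simp add: c0_def)
qed

text \<open>Here the last factor is exp(a - y) - 1, and its principal logarithm meets the prescribed
  ranges of length pi without correction. Instead, passing from Ln(a - y) to Ln(y - a) costs plus or
  minus pi i, according to the side of \<open>a\<close>.\<close>

lemma extended_branch:
  assumes f: "local_solution N T M (t\<^sub>0 + exp (- a)) \<alpha> j\<^sub>0 (if low then {- Im a<..<- Im a + pi} else {- Im a - pi<..<- Im a}) B D f"
    and side: "\<And>y. y \<in> Y \<Longrightarrow> (if low then Im y < Im a else Im a < Im y)"
    and B: "0 < d" "\<And>y. y \<in> Y \<Longrightarrow> y \<in> ball a d \<Longrightarrow> t\<^sub>0 + exp (- y) \<in> B" and j: "j < N"
  obtains h where "has_branch Y a \<alpha> (\<lambda>y. f (t\<^sub>0 + exp (- y)) $ j) h"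
    "h a = exp (\<alpha> * (- a + (if low then of_real pi * \<i> else - of_real pi * \<i>))) * (if j = j\<^sub>0 then 1 else 0)"
proof -
  obtain \<epsilon> \<Lambda> where e: "0 < \<epsilon>" "\<Lambda> holomorphic_on ball 0 \<epsilon>" "\<Lambda> 0 = (0::complex)"
    and Ln: "\<And>s. s \<in> ball 0 \<epsilon> \<Longrightarrow> Im s \<noteq> 0 \<Longrightarrow> exp s - 1 \<noteq> 0 \<and> Ln (exp s - 1) = Ln s + \<Lambda> s"
    and pos: "\<And>s. s \<in> ball 0 \<epsilon> \<Longrightarrow> 0 < Im s \<Longrightarrow> 0 < Im (Ln (exp s - 1)) \<and> Im (Ln (exp s - 1)) < pi"
    and neg: "\<And>s. s \<in> ball 0 \<epsilon> \<Longrightarrow> Im s < 0 \<Longrightarrow> - pi < Im (Ln (exp s - 1)) \<and> Im (Ln (exp s - 1)) < 0"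
    by (rule Ln_exp_minus_one) blast
  define c1 where "c1 = (if low then of_real pi * \<i> else - of_real pi * \<i>)"
  define L where "L = (\<lambda>y. - a + Ln (exp (a - y) - 1))"
  define \<eta> where "\<eta> = min \<epsilon> d"
  have \<eta>: "0 < \<eta>" "ball a \<eta> \<subseteq> ball a \<epsilon>" "ball a \<eta> \<subseteq> ball a d" using e B by (auto simp: \<eta>_def)
  have "(\<lambda>y. - a + c1 + \<Lambda> (a - y)) holomorphic_on ball a \<epsilon>"
    by (intro holomorphic_intros holomorphic_on_compose_gen[OF _ e(2), unfolded o_def]) (auto simp: dist_norm norm_minus_commute)
  then have \<Lambda>hol: "(\<lambda>y. - a + c1 + \<Lambda> (a - y)) holomorphic_on ball a \<eta>"
    by (rule holomorphic_on_subset[OF _ \<eta>(2)])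
  have fact: "exp (- a) * (exp (a - y) - 1) = exp (- y) - exp (- a)" for y
    by (simp add: exp_diff exp_minus field_simps)
  have key: "t\<^sub>0 + exp (- y) \<in> B \<and> t\<^sub>0 + exp (- y) \<noteq> t\<^sub>0 + exp (- a) \<and> exp (L y) = t\<^sub>0 + exp (- y) - (t\<^sub>0 + exp (- a)) \<and>
       Im (L y) \<in> (if low then {- Im a<..<- Im a + pi} else {- Im a - pi<..<- Im a}) \<and> L y = Ln (y - a) + (- a + c1 + \<Lambda> (a - y))"
    if y: "y \<in> Y" "y \<in> ball a \<eta>" for y
  proof -
    have s: "a - y \<in> ball 0 \<epsilon>" using subsetD[OF \<eta>(2) y(2)] by (simp add: dist_norm norm_minus_commute)
    have ne: "Im (a - y) \<noteq> 0" using side[OF y(1)] by (auto split: if_splits)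
    note l = Ln[OF s ne]
    have eL: "exp (L y) = exp (- y) - exp (- a)"
      unfolding L_def exp_add using conjunct1[OF l] by (simp add: fact)
    have "exp (- y) - exp (- a) \<noteq> 0" using l unfolding fact[symmetric] by simp
    moreover have "Im (L y) \<in> (if low then {- Im a<..<- Im a + pi} else {- Im a - pi<..<- Im a})"
      using side[OF y(1)] neg[OF s] pos[OF s] by (auto simp: L_def split: if_splits)
    moreover have "Ln (a - y) = Ln (y - a) + c1"
    proof -
      have "y - a \<noteq> 0" using ne by auto
      from Ln_minus[OF this] side[OF y(1)] show ?thesis
        by (auto simp: c1_def mult.commute split: if_splits)
    qed
    ultimately show ?thesis using B(2)[OF y(1) subsetD[OF \<eta>(3) y(2)]] eL l by (simp add: L_def)
  qed
  obtain h where h: "has_branch Y a \<alpha> (\<lambda>y. f (t\<^sub>0 + exp (- y)) $ j) h"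
    "h a = exp (\<alpha> * (- a + c1 + \<Lambda> (a - a))) * (if j = j\<^sub>0 then 1 else 0)"
    by (rule local_solution_branch[OF f, where x = "\<lambda>y. t\<^sub>0 + exp (- y)" and c = a and L = L, OF _ refl \<eta>(1) \<Lambda>hol key j])
       (auto intro!: holomorphic_intros)
  then show ?thesis using that e(3) by (simp add: c1_def)
qed

text \<open>The logarithm cut along the ray opposite to the bisector inverts y -> t0 + exp(-y). The
  opening is below 2 pi, so its domain \<open>U\<close> contains the closed sector without the
  vertex. In particular \<open>g\<close> is defined around the edge points at which connection
  relations are stated.\<close>

lemma sector_strip:
  assumes ab: "\<alpha> < \<beta>" "\<beta> - \<alpha> < 2 * pi"
  obtains U g where "open U" "g holomorphic_on U" "open (sector t\<^sub>0 \<alpha> \<beta>)" "sector t\<^sub>0 \<alpha> \<beta> \<subseteq> U"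
    "\<And>x. x \<in> sector t\<^sub>0 \<alpha> \<beta> \<Longrightarrow> - \<beta> < Im (g x) \<and> Im (g x) < - \<alpha> \<and> t\<^sub>0 + exp (- g x) = x"
    "\<And>y. - \<beta> < Im y \<Longrightarrow> Im y < - \<alpha> \<Longrightarrow> t\<^sub>0 + exp (- y) \<in> sector t\<^sub>0 \<alpha> \<beta>"
    "\<And>y. - \<beta> \<le> Im y \<Longrightarrow> Im y \<le> - \<alpha> \<Longrightarrow> t\<^sub>0 + exp (- y) \<in> U \<and> g (t\<^sub>0 + exp (- y)) = y"
proof -
  define m where "m = (\<alpha> + \<beta>) / 2"
  define c where "c = \<i> * of_real m"
  define U where "U = {x. exp (- c) * (x - t\<^sub>0) \<notin> \<real>\<^sub>\<le>\<^sub>0}"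
  define g where "g = (\<lambda>x. - (Ln (exp (- c) * (x - t\<^sub>0)) + c))"
  have opU: "open U"
  proof -
    have "U = (\<lambda>x. exp (- c) * (x - t\<^sub>0)) -` (- \<real>\<^sub>\<le>\<^sub>0)" by (auto simp: U_def)
    moreover have "open ((\<lambda>x. exp (- c) * (x - t\<^sub>0)) -` (- \<real>\<^sub>\<le>\<^sub>0))"
      by (rule continuous_open_vimage) (auto intro!: continuous_intros)
    ultimately show ?thesis by simp
  qed
  have ghol: "g holomorphic_on U"
    unfolding g_def by (intro holomorphic_intros) (auto simp: U_def)
  have inv: "t\<^sub>0 + exp (- y) \<in> U \<and> g (t\<^sub>0 + exp (- y)) = y" if y: "- \<beta> \<le> Im y" "Im y \<le> - \<alpha>" for y
  proof -
    let ?w = "- (y + c)"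
    have Im: "- pi < Im ?w" "Im ?w < pi"
      using y ab by (simp_all add: c_def m_def field_simps)
    have e: "exp (- c) * (t\<^sub>0 + exp (- y) - t\<^sub>0) = exp ?w" by (simp add: exp_add[symmetric] algebra_simps)
    have "exp ?w \<notin> \<real>\<^sub>\<le>\<^sub>0"
    proof
      assume n: "exp ?w \<in> \<real>\<^sub>\<le>\<^sub>0"
      have "sin (Im ?w) = 0" using n by (simp add: complex_nonpos_Reals_iff Im_exp)
      then have "Im ?w = 0" using sin_eq_0_pi[of "Im ?w"] Im by auto
      then have "Re (exp ?w) > 0" by (simp only: Re_exp cos_zero mult_1_right exp_gt_zero)
      then show False using n by (simp add: complex_nonpos_Reals_iff)
    qed
    moreover have "Ln (exp ?w) = ?w" using Im by (intro Ln_exp) auto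
    ultimately show ?thesis unfolding U_def g_def mem_Collect_eq e by simp
  qed
  have into: "t\<^sub>0 + exp (- y) \<in> sector t\<^sub>0 \<alpha> \<beta>" if "- \<beta> < Im y" "Im y < - \<alpha>" for y
  proof -
    have "is_Arg (exp (- y)) (Im (- y))" by (rule pow_arg_exp(1)[OF refl])
    then show ?thesis using that unfolding sector_def by (auto intro!: exI[of _ "- Im y"])
  qed
  have param: "- \<beta> < Im (g x) \<and> Im (g x) < - \<alpha> \<and> t\<^sub>0 + exp (- g x) = x \<and> x \<in> U" if x: "x \<in> sector t\<^sub>0 \<alpha> \<beta>" for x
  proof -
    obtain \<phi> where \<phi>: "x \<noteq> t\<^sub>0" "is_Arg (x - t\<^sub>0) \<phi>" "\<alpha> < \<phi>" "\<phi> < \<beta>" using x by (auto simp: sector_def)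
    define y where "y = - Complex (ln (norm (x - t\<^sub>0))) \<phi>"
    have "exp (- y) = of_real (norm (x - t\<^sub>0)) * exp (\<i> * of_real \<phi>)"
      using \<phi>(1) by (simp add: y_def Complex_eq exp_add exp_of_real)
    then have x_eq: "x = t\<^sub>0 + exp (- y)" using \<phi>(2) by (simp add: is_Arg_def)
    have "- \<beta> < Im y" "Im y < - \<alpha>" using \<phi> by (simp_all add: y_def)
    then show ?thesis unfolding x_eq using inv[of y] by simp
  qed
  have op: "open (sector t\<^sub>0 \<alpha> \<beta>)"
  proof -
    have "sector t\<^sub>0 \<alpha> \<beta> = U \<inter> g -` ({y. - \<beta> < Im y} \<inter> {y. Im y < - \<alpha>})"
    proof (intro equalityI subsetI)
      fix x assume "x \<in> sector t\<^sub>0 \<alpha> \<beta>"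
      then show "x \<in> U \<inter> g -` ({y. - \<beta> < Im y} \<inter> {y. Im y < - \<alpha>})" using param[of x] by simp
    next
      fix x assume x: "x \<in> U \<inter> g -` ({y. - \<beta> < Im y} \<inter> {y. Im y < - \<alpha>})"
      then have "exp (- c) * (x - t\<^sub>0) \<noteq> 0" by (auto simp: U_def)
      then have "exp (- g x) = x - t\<^sub>0" by (simp add: g_def exp_add exp_minus)
      then show "x \<in> sector t\<^sub>0 \<alpha> \<beta>" using into[of "g x"] x by simp
    qed
    moreover have "open (U \<inter> g -` ({y. - \<beta> < Im y} \<inter> {y. Im y < - \<alpha>}))"
      by (intro continuous_open_preimage holomorphic_on_imp_continuous_on[OF ghol] opU open_Int
          open_halfspace_Im_gt open_halfspace_Im_lt)
    ultimately show ?thesis by simp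
  qed
  show ?thesis
    by (rule that[OF opU ghol op _ _ into inv]) (use param in auto)
qed

text \<open>The bounds on \<open>\<delta>\<close> and on the opening make the two ranges of the
  argument overlap.\<close>

lemma sector_union:
  assumes "2 * \<delta> < \<beta> - \<alpha>" "0 < \<delta>" "\<beta> - \<alpha> < 2 * pi"
  shows "sector t\<^sub>0 \<alpha> (min (\<beta> - \<delta>) (\<alpha> + pi)) \<union> sector t\<^sub>0 (max (\<alpha> + \<delta>) (\<beta> - pi)) \<beta> = sector t\<^sub>0 \<alpha> \<beta>"
proof -
  have "\<delta> < pi" using assms by simp
  then have "\<alpha> < \<phi> \<and> \<phi> < min (\<beta> - \<delta>) (\<alpha> + pi) \<or> max (\<alpha> + \<delta>) (\<beta> - pi) < \<phi> \<and> \<phi> < \<beta> \<longleftrightarrow> \<alpha> < \<phi> \<and> \<phi> < \<beta>" for \<phi>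
    using assms by linarith
  then show ?thesis unfolding sector_def by blast
qed

lemma open_slit_plane:
  assumes "\<And>i. i \<in> {1..p} \<Longrightarrow> t' i \<noteq> \<eta>\<^sub>0"
  shows "open (slit_plane p \<eta>\<^sub>0 t')"
proof -
  have "closed {\<eta>\<^sub>0 + (t' i - \<eta>\<^sub>0) * of_real s | s. s \<ge> 1}" if "i \<in> {1..p}" for i
  proof -
    let ?d = "t' i - \<eta>\<^sub>0"
    have d: "?d \<noteq> 0" using assms[OF that] by simp
    have "{\<eta>\<^sub>0 + ?d * of_real s | s. s \<ge> 1} = {z. Im ((z - \<eta>\<^sub>0) / ?d) = 0} \<inter> {z. 1 \<le> Re ((z - \<eta>\<^sub>0) / ?d)}"
    proof (intro equalityI subsetI)
      fix z assume "z \<in> {z. Im ((z - \<eta>\<^sub>0) / ?d) = 0} \<inter> {z. 1 \<le> Re ((z - \<eta>\<^sub>0) / ?d)}"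
      then have "(z - \<eta>\<^sub>0) / ?d = of_real (Re ((z - \<eta>\<^sub>0) / ?d))" "1 \<le> Re ((z - \<eta>\<^sub>0) / ?d)"
        by (auto simp: complex_eq_iff)
      then show "z \<in> {\<eta>\<^sub>0 + ?d * of_real s | s. s \<ge> 1}"
        using d by (intro CollectI exI[of _ "Re ((z - \<eta>\<^sub>0) / ?d)"]) (auto simp: field_simps)
    qed (use d in auto)
    then show ?thesis by (auto intro!: closed_Int closed_Collect_eq closed_Collect_le continuous_intros simp: d)
  qed
  then show ?thesis unfolding slit_plane_def by (intro open_Diff closed_UN) auto
qed

lemma exists_nat_shift:
  "finite F \<Longrightarrow> \<exists>n::nat. \<forall>z\<in>F. Re z + n > 1"
proof (induction F rule: finite_induct)
  case (insert x F)
  then obtain n :: nat where n: "\<And>z. z \<in> F \<Longrightarrow> Re z + n > 1" by blast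
  obtain m :: nat where m: "1 - Re x < m" using reals_Archimedean2 by blast
  have "Re z + real (max n m) > 1" if "z \<in> insert x F" for z
    using that n[of z] m by (auto simp: of_nat_max)
  then show ?case by blast
qed simp

text \<open>A + c is conjugate to the diagonal matrix with the entries mu_k + c, and the inverse of
  that matrix is conjugated back.\<close>

lemma shifted_inverse:
  assumes A: "A \<in> carrier_mat N N" and P: "P \<in> carrier_mat N N" and Q: "Q \<in> carrier_mat N N"
    and PQ: "P * Q = 1\<^sub>m N" and QP: "Q * P = 1\<^sub>m N"
    and diag: "Q * A * P = scalar_blocks q \<mu> m" and c: "\<And>k. k \<in> {1..q} \<Longrightarrow> \<mu> k + c \<noteq> 0"
  shows "\<exists>B\<in>carrier_mat N N. B * (A + c \<cdot>\<^sub>m 1\<^sub>m N) = 1\<^sub>m N \<and> (A + c \<cdot>\<^sub>m 1\<^sub>m N) * B = 1\<^sub>m N"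
proof -
  define A' where "A' = Q * A * P"
  have A': "A' \<in> carrier_mat N N" using A P Q by (simp add: A'_def)
  have N: "(\<Sum>k=1..q. m k) = N" using scalar_blocks_entries(1)[of q \<mu> m] A' by (auto simp: A'_def diag)
  define E where "E = mat N N (\<lambda>(i, j). if i = j then 1 / (\<mu> (block_of m i) + c) else 0)"
  have E: "E \<in> carrier_mat N N" by (simp add: E_def)
  define G where "G = A + c \<cdot>\<^sub>m 1\<^sub>m N"
  have G: "G \<in> carrier_mat N N" using A by (simp add: G_def)
  have nz: "\<mu> (block_of m i) + c \<noteq> 0" if "i < N" for i
    by (rule c, rule block_of_bounds(1), unfold N, rule that)
  have A'e: "A' $$ (i, j) = (if i = j then \<mu> (block_of m i) else 0)" if "i < N" "j < N" for i j
    unfolding A'_def diag by (rule scalar_blocks_entries(2); unfold N, rule that)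
  have "(A' + c \<cdot>\<^sub>m 1\<^sub>m N) * E = 1\<^sub>m N"
  proof (rule eq_matI)
    fix i j assume ij: "i < dim_row (1\<^sub>m N)" "j < dim_col (1\<^sub>m N)"
    have "((A' + c \<cdot>\<^sub>m 1\<^sub>m N) * E) $$ (i, j) = (\<Sum>k<N. (A' + c \<cdot>\<^sub>m 1\<^sub>m N) $$ (i, k) * E $$ (k, j))"
      using ij A' E by (auto simp: scalar_prod_def atLeast0LessThan intro!: sum.cong)
    also have "\<dots> = (\<Sum>k<N. if k = i then (if i = j then 1 else 0) else 0)"
      by (rule sum.cong) (use ij A' A'e nz in \<open>auto simp: E_def\<close>)
    finally show "((A' + c \<cdot>\<^sub>m 1\<^sub>m N) * E) $$ (i, j) = 1\<^sub>m N $$ (i, j)" using ij by simp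
  qed (use A' E in auto)
  moreover have "Q * G * P = A' + c \<cdot>\<^sub>m 1\<^sub>m N"
  proof -
    have "Q * G = Q * A + Q * (c \<cdot>\<^sub>m 1\<^sub>m N)" unfolding G_def using A Q by (intro mult_add_distrib_mat[of _ N N _ N]) auto
    also have "Q * (c \<cdot>\<^sub>m 1\<^sub>m N) = c \<cdot>\<^sub>m Q" using Q by (simp add: mult_smult_distrib[of _ N N _ N])
    also have "(Q * A + c \<cdot>\<^sub>m Q) * P = Q * A * P + c \<cdot>\<^sub>m Q * P"
      using A P Q by (intro add_mult_distrib_mat[of _ N N _ _ N]) auto
    also have "c \<cdot>\<^sub>m Q * P = c \<cdot>\<^sub>m 1\<^sub>m N" using P Q QP by (simp add: mult_smult_assoc_mat[of _ N N _ N])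
    finally show ?thesis by (simp add: A'_def)
  qed
  ultimately have 1: "Q * G * P * E = 1\<^sub>m N" by simp
  define B where "B = P * E * Q"
  have B: "B \<in> carrier_mat N N" using P E Q by (simp add: B_def)
  have "Q * (G * B) = Q * G * B" using Q G B by (simp add: assoc_mult_mat[of _ N N _ N _ N])
  also have "\<dots> = Q * G * P * E * Q"
    unfolding B_def using Q G P E by (simp add: assoc_mult_mat[of _ N N _ N _ N])
  also have "\<dots> = Q" using Q by (simp add: 1)
  finally have "P * (Q * (G * B)) = P * Q" by simp
  then have "P * Q * (G * B) = P * Q" using P Q G B by (simp add: assoc_mult_mat[of _ N N _ N _ N])
  then have GB: "G * B = 1\<^sub>m N" using PQ G B by simp
  then have "B * G = 1\<^sub>m N" by (rule mat_mult_left_right_inverse[OF G B])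
  then show ?thesis using GB B unfolding G_def by blast
qed

theorem theorem7p5:
  fixes p q N :: nat
    and n r m :: "nat \<Rightarrow> nat"
    and l :: "nat \<Rightarrow> nat \<Rightarrow> nat"
    and t t' \<mu> :: "nat \<Rightarrow> complex"
    and lam :: "nat \<Rightarrow> nat \<Rightarrow> complex"
    and T T' A A' P Q :: "complex mat"
    and \<rho>\<^sub>1 \<rho>\<^sub>2 \<eta>\<^sub>0 :: complex
    and \<theta> \<theta>' :: "nat \<Rightarrow> real"
    and \<delta> :: real
    and w U_plus U_minus :: "nat \<Rightarrow> nat \<Rightarrow> nat \<Rightarrow> complex \<Rightarrow> complex Matrix.vec"
    and c :: "nat \<Rightarrow> nat \<Rightarrow> nat \<Rightarrow> nat \<Rightarrow> nat \<Rightarrow> nat \<Rightarrow> complex"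
  \<comment> \<open>the system\<close>
  assumes t_distinct: "inj_on t {1..p+1}"
    and t_not_collinear:
      "\<And>i j k. {i, j, k} \<subseteq> {1..p+1} \<Longrightarrow> i \<noteq> j \<Longrightarrow> j \<noteq> k \<Longrightarrow> i \<noteq> k \<Longrightarrow> \<not> collinear {t i, t j, t k}"
    and n_def: "\<And>i. i \<in> {1..p} \<Longrightarrow> n i = (\<Sum>k=1..r i. l i k)"
    and N_def: "N = (\<Sum>i=1..p. n i)"
    and T_def: "T = scalar_blocks p t n"
    and A_carrier: "A \<in> carrier_mat N N"
    and A_blocks: "\<And>i. i \<in> {1..p} \<Longrightarrow>
      diag_submat A (\<Sum>i'=1..<i. n i') (n i) = scalar_blocks (r i) (lam i) (l i)"
    and P_carrier: "P \<in> carrier_mat N N" "Q \<in> carrier_mat N N"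
    and P_inverse: "inverts_mat P Q" "inverts_mat Q P"
    and A'_def: "A' = Q * A * P"
    and A'_diag: "A' = scalar_blocks q \<mu> m"
  \<comment> \<open>genericity\<close>
    and "\<And>i k. i \<in> {1..p} \<Longrightarrow> k \<in> {1..r i} \<Longrightarrow> lam i k \<notin> \<int>"
    and "\<And>i k h. i \<in> {1..p} \<Longrightarrow> k \<in> {1..r i} \<Longrightarrow> h \<in> {1..r i} \<Longrightarrow> k \<noteq> h \<Longrightarrow> lam i k - lam i h \<notin> \<int>"
    and "\<And>k. k \<in> {1..q} \<Longrightarrow> \<mu> k \<notin> \<int>"
    and "\<And>k h. k \<in> {1..q} \<Longrightarrow> h \<in> {1..q} \<Longrightarrow> k \<noteq> h \<Longrightarrow> \<mu> k - \<mu> h \<notin> \<int>"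
    and "\<And>i k h. i \<in> {1..p} \<Longrightarrow> k \<in> {1..r i} \<Longrightarrow> h \<in> {1..q} \<Longrightarrow> lam i k - \<mu> h \<notin> \<int>"
    and "\<rho>\<^sub>1 \<notin> \<int>" "\<rho>\<^sub>2 \<notin> \<int>" "\<rho>\<^sub>1 - \<rho>\<^sub>2 \<notin> \<int>"
    and "\<And>i k. i \<in> {1..p} \<Longrightarrow> k \<in> {1..r i} \<Longrightarrow> \<rho>\<^sub>1 - lam i k \<notin> \<int> \<and> \<rho>\<^sub>2 - lam i k \<notin> \<int>"
    and "\<And>k. k \<in> {1..q} \<Longrightarrow> \<rho>\<^sub>1 - \<mu> k \<notin> \<int> \<and> \<rho>\<^sub>2 - \<mu> k \<notin> \<int>"
  \<comment> \<open>arguments and sectors\<close>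
    and \<theta>_arg: "\<And>i. i \<in> {1..p} \<Longrightarrow> is_Arg (t i - t (p+1)) (\<theta> i)"
    and \<theta>_mono: "strict_mono_on {1..p} \<theta>" "\<theta> p < \<theta> 1 + 2 * pi"
    and \<theta>_last: "\<theta> p < \<theta> (p+1)" "\<theta> (p+1) < \<theta> 1 + 2 * pi"
    and \<theta>_zero: "\<theta> 0 = \<theta> (p+1) - 2 * pi"
    and \<delta>_small: "0 < \<delta>" "\<And>i. i \<le> p \<Longrightarrow> 2 * \<delta> < \<theta> (i+1) - \<theta> i"
  \<comment> \<open>the underlying system and its connection coefficients\<close>
    and t'_def: "\<And>i. i \<in> {1..p} \<Longrightarrow> t' i = \<eta>\<^sub>0 + 1 / (t i - t (p+1))"
    and T'_def: "T' = scalar_blocks p t' n"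
    and \<theta>'_def: "\<And>i. i \<in> {1..p} \<Longrightarrow> \<theta>' i = - \<theta> i"
    and w: "\<And>i k h. i \<in> {1..p} \<Longrightarrow> k \<in> {1..r i} \<Longrightarrow> h \<in> {1..l i k} \<Longrightarrow>
      local_solution N T' (underlying_A N A 0) (t' i) (lam i k) (pos n l i k h)
        {\<theta>' i - 2 * pi<..<\<theta>' i} (slit_plane p \<eta>\<^sub>0 t') (slit_plane p \<eta>\<^sub>0 t') (w i k h)"
    and c: "\<And>\<nu> i k h. \<nu> \<in> {1..p} \<Longrightarrow> i \<in> {1..p} \<Longrightarrow> \<nu> \<noteq> i \<Longrightarrow> k \<in> {1..r i} \<Longrightarrow> h \<in> {1..l i k} \<Longrightarrow>
      connection_relation N (slit_plane p \<eta>\<^sub>0 t') (t' \<nu>) (r \<nu>) (l \<nu>)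
        (\<lambda>k' h'. c \<nu> k' h' i k h) (w \<nu>) (w i k h)"
  \<comment> \<open>the two branches of the local solutions of the rank \<open>2N\<close> system:
      \<open>U_plus i\<close> has its branch on \<open>sector_plus i\<close>, \<open>U_minus i\<close> on \<open>sector_minus i\<close>\<close>
    and U_plus: "\<And>i k h. i \<in> {1..<p} \<Longrightarrow> k \<in> {1..r i} \<Longrightarrow> h \<in> {1..l i k} \<Longrightarrow>
      local_solution (2*N) (ext_T N T (t (p+1))) (ext_A N A P Q A' \<rho>\<^sub>1 \<rho>\<^sub>2)
        (t i) (lam i k) (pos n l i k h) {\<theta> i<..<\<theta> i + pi}
        (sector_plus (t (p+1)) \<theta> \<delta> i)
        (sector_plus (t (p+1)) \<theta> \<delta> i \<union> sector_minus (t (p+1)) \<theta> \<delta> (i+1)) (U_plus i k h)"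
    and U_minus: "\<And>i k h. i \<in> {2..p} \<Longrightarrow> k \<in> {1..r i} \<Longrightarrow> h \<in> {1..l i k} \<Longrightarrow>
      local_solution (2*N) (ext_T N T (t (p+1))) (ext_A N A P Q A' \<rho>\<^sub>1 \<rho>\<^sub>2)
        (t i) (lam i k) (pos n l i k h) {\<theta> i - pi<..<\<theta> i}
        (sector_minus (t (p+1)) \<theta> \<delta> i)
        (sector_minus (t (p+1)) \<theta> \<delta> i \<union> sector_plus (t (p+1)) \<theta> \<delta> (i-1)) (U_minus i k h)"
  shows "(\<forall>i\<in>{1..<p}. \<forall>k\<in>{1..r i}. \<forall>h\<in>{1..l i k}.
      connection_relation (2*N)
        (sector_plus (t (p+1)) \<theta> \<delta> i \<union> sector_minus (t (p+1)) \<theta> \<delta> (i+1))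
        (t (i+1)) (r (i+1)) (l (i+1))
        (\<lambda>k' h'. (exp (pi * \<i> * lam i k)
                    * pow_arg (\<theta> i) (t i - t (p+1)) (2 * lam i k - \<rho>\<^sub>1 - \<rho>\<^sub>2))
                 / (exp (pi * \<i> * lam (i+1) k')
                    * pow_arg (\<theta> (i+1)) (t (i+1) - t (p+1)) (2 * lam (i+1) k' - \<rho>\<^sub>1 - \<rho>\<^sub>2))
                 * c (i+1) k' h' i k h)
        (U_minus (i+1)) (U_plus i k h))
    \<and> (\<forall>i\<in>{2..p}. \<forall>k\<in>{1..r i}. \<forall>h\<in>{1..l i k}.
      connection_relation (2*N)
        (sector_minus (t (p+1)) \<theta> \<delta> i \<union> sector_plus (t (p+1)) \<theta> \<delta> (i-1))
        (t (i-1)) (r (i-1)) (l (i-1))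
        (\<lambda>k' h'. (exp (pi * \<i> * lam i k)
                    * pow_arg (\<theta> i) (t i - t (p+1)) (2 * lam i k - \<rho>\<^sub>1 - \<rho>\<^sub>2))
                 / (exp (pi * \<i> * lam (i-1) k')
                    * pow_arg (\<theta> (i-1)) (t (i-1) - t (p+1)) (2 * lam (i-1) k' - \<rho>\<^sub>1 - \<rho>\<^sub>2))
                 * c (i-1) k' h' i k h)
        (U_plus (i-1)) (U_minus i k h))"
proof -

  \<comment> \<open>The data of the theorem in the logarithmic coordinate\<close>
  define t\<^sub>0 where "t\<^sub>0 = t (p + 1)"
  \<comment> \<open>Minus the logarithm of t_i - t0 with the argument theta_i; both t_i and t'_i
    correspond to the point y = z i.\<close>
  define z where "z = (\<lambda>i. - Complex (ln (norm (t i - t\<^sub>0))) (\<theta> i))"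
  define b where "b = block_of n"
  define \<tau> where "\<tau> = (\<lambda>j. exp (z (b j)))"
  \<comment> \<open>The ratio between the given solution at t_i and the lift of the solution at
    t'_i. A connection coefficient is therefore multiplied by the quotient of two such
    numbers.\<close>
  define K where "K = (\<lambda>i k. exp (pi * \<i> * lam i k) * pow_arg (\<theta> i) (t i - t\<^sub>0) (2 * lam i k - \<rho>\<^sub>1 - \<rho>\<^sub>2))"
  have gen_lam: "lam i k \<notin> \<int>" if "i \<in> {1..p}" "k \<in> {1..r i}" for i k by (rule assms(14)[OF that])
  have gen_diff: "lam i k - lam i h \<notin> \<int>" if "i \<in> {1..p}" "k \<in> {1..r i}" "h \<in> {1..r i}" "k \<noteq> h" for i k h by (rule assms(15)[OF that])
  have gen_mu: "\<mu> k \<notin> \<int>" if "k \<in> {1..q}" for k by (rule assms(16)[OF that])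

  have ne: "t i - t\<^sub>0 \<noteq> 0" if "i \<in> {1..p}" for i
    using inj_onD[OF t_distinct, of i "p + 1"] that by (auto simp: t\<^sub>0_def)
  have exp_mz: "exp (- z i) = t i - t\<^sub>0" if i: "i \<in> {1..p}" for i
  proof -
    have "exp (- z i) = of_real (norm (t i - t\<^sub>0)) * exp (\<i> * of_real (\<theta> i))"
      using ne[OF i] by (simp add: z_def Complex_eq exp_add exp_of_real)
    then show ?thesis using \<theta>_arg[OF i] by (simp add: is_Arg_def t\<^sub>0_def)
  qed
  have t_eq: "t i = t\<^sub>0 + exp (- z i)" if "i \<in> {1..p}" for i using exp_mz[OF that] by simp
  have exp_z: "exp (z i) = 1 / (t i - t\<^sub>0)" if "i \<in> {1..p}" for i
    unfolding exp_mz[OF that, symmetric] by (simp add: exp_minus field_simps)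
  have t'_eq: "t' i = \<eta>\<^sub>0 + exp (z i)" if "i \<in> {1..p}" for i
    using t'_def[OF that] exp_z[OF that] by (simp add: t\<^sub>0_def)
  have Im_z: "Im (z i) = - \<theta> i" for i by (simp add: z_def)
  have K_eq: "K i k = exp (pi * \<i> * lam i k + (2 * lam i k - \<rho>\<^sub>1 - \<rho>\<^sub>2) * (- z i))" for i k
    by (simp add: K_def pow_arg_def z_def exp_add)
  have K_nz: "K i k \<noteq> 0" for i k by (simp add: K_eq)

  have PQ: "P * Q = 1\<^sub>m N" and QP: "Q * P = 1\<^sub>m N"
    using P_inverse P_carrier by (auto simp: inverts_mat_def)
  have \<tau>_nz: "\<tau> j \<noteq> 0" for j by (simp add: \<tau>_def)
  have blk: "b j \<in> {1..p}" if "j < N" for j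
    unfolding b_def by (rule block_of_bounds(1)) (use that N_def in simp)
  have \<tau>_iff: "\<tau> j = exp (z i) \<longleftrightarrow> b j = i" if "j < N" "i \<in> {1..p}" for i j
  proof
    assume "\<tau> j = exp (z i)"
    then have "t (b j) = t i"
      using exp_z[OF blk[OF that(1)]] exp_z[OF that(2)] ne[OF blk[OF that(1)]] ne[OF that(2)]
      by (simp add: \<tau>_def)
    then show "b j = i" using inj_onD[OF t_distinct, of "b j" i] blk[OF that(1)] that(2) by simp
  qed (simp add: \<tau>_def)
  have T: "T \<in> carrier_mat N N" "\<And>i j. i < N \<Longrightarrow> j < N \<Longrightarrow> T $$ (i, j) = (if i = j then t (b i) else 0)"
    unfolding T_def N_def b_def by (rule scalar_blocks_entries(1), rule scalar_blocks_entries(2))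
  have T': "T' \<in> carrier_mat N N" "\<And>i j. i < N \<Longrightarrow> j < N \<Longrightarrow> T' $$ (i, j) = (if i = j then t' (b i) else 0)"
    unfolding T'_def N_def b_def by (rule scalar_blocks_entries(1), rule scalar_blocks_entries(2))
  have A_block: "\<exists>k'\<in>{1..r i}. A $$ (j, k) = (if j = k then lam i k' else 0)"
    if jk: "j < N" "k < N" "b j = i" "b k = i" for i j k
  proof -
    have i: "i \<in> {1..p}" using blk[OF jk(1)] jk(3) by simp
    define s where "s = (\<Sum>i'=1..<i. n i')"
    have sj: "s \<le> j" "j < s + n i" and sk: "s \<le> k" "k < s + n i"
      using block_of_bounds(2,3)[of j n p] block_of_bounds(2,3)[of k n p] jk N_def by (simp_all add: b_def s_def)
    have nl: "j - s < (\<Sum>k=1..r i. l i k)" "k - s < (\<Sum>k=1..r i. l i k)" using sj sk n_def[OF i] by auto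
    have "A $$ (j, k) = diag_submat A s (n i) $$ (j - s, k - s)"
      using sj sk by (simp add: diag_submat_def)
    also have "\<dots> = scalar_blocks (r i) (lam i) (l i) $$ (j - s, k - s)"
      unfolding s_def A_blocks[OF i] ..
    also have "\<dots> = (if j - s = k - s then lam i (block_of (l i) (j - s)) else 0)"
      by (rule scalar_blocks_entries(2)[OF nl])
    also have "(j - s = k - s) = (j = k)" using sj sk by auto
    finally show ?thesis using block_of_bounds(1)[OF nl(1)] by blast
  qed
  have uA: "underlying_A N A 0 = A"
    unfolding underlying_A_def using A_carrier by (intro eq_matI) auto
  have inv: "\<exists>B\<in>carrier_mat N N. B * (A + of_nat (Suc s) \<cdot>\<^sub>m 1\<^sub>m N) = 1\<^sub>m N \<and> (A + of_nat (Suc s) \<cdot>\<^sub>m 1\<^sub>m N) * B = 1\<^sub>m N" for s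
  proof (rule shifted_inverse[OF A_carrier P_carrier PQ QP])
    show "Q * A * P = scalar_blocks q \<mu> m" using A'_def A'_diag by simp
    show "\<mu> k + of_nat (Suc s) \<noteq> 0" if "k \<in> {1..q}" for k
    proof
      assume "\<mu> k + of_nat (Suc s) = 0"
      then have "\<mu> k = - of_nat (Suc s)" by (simp add: add_eq_0_iff2)
      then show False using gen_mu[OF that] by (metis Ints_minus Ints_of_nat)
    qed
  qed
  have A'_eq: "A' = Q * A * P" by (rule A'_def)

  let ?Text = "ext_T N T t\<^sub>0" and ?Aext = "ext_A N A P Q (Q * A * P) \<rho>\<^sub>1 \<rho>\<^sub>2"
  have Text: "?Text \<in> carrier_mat (2 * N) (2 * N)"
    "\<And>i j. i < 2 * N \<Longrightarrow> j < 2 * N \<Longrightarrow> ?Text $$ (i, j) = (if i = j then (if i < N then t (b i) else t\<^sub>0) else 0)"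
    using T by (auto simp: ext_T_def)
  have Aext: "?Aext \<in> carrier_mat (2 * N) (2 * N)"
    using ext_A_carrier[of A N "Q * A * P" P Q \<rho>\<^sub>1 \<rho>\<^sub>2] A_carrier P_carrier by (simp add: mult_2)

  \<comment> \<open>Both claims at once: \<open>m\<^sub>0\<close> is the smaller one of two
    neighbouring indices, and \<open>pair\<close> tells which of them carries the solution to be
    continued. \<open>F\<close> is the plus branch at \<open>m\<^sub>0\<close> and the minus branch
    at \<open>m\<^sub>0 + 1\<close>, on their common sector.\<close>
  have key: "connection_relation (2 * N) (sector t\<^sub>0 (\<theta> m\<^sub>0) (\<theta> (m\<^sub>0 + 1))) (t \<nu>) (r \<nu>) (l \<nu>)
      (\<lambda>k' h'. K i k / K \<nu> k' * c \<nu> k' h' i k h) (F \<nu>) (F i k h)"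
    if m\<^sub>0: "m\<^sub>0 \<in> {1..<p}" and pair: "i = m\<^sub>0 \<and> \<nu> = m\<^sub>0 + 1 \<or> i = m\<^sub>0 + 1 \<and> \<nu> = m\<^sub>0"
      and k: "k \<in> {1..r i}" and h: "h \<in> {1..l i k}"
      and F: "\<And>e k h. e = m\<^sub>0 \<or> e = m\<^sub>0 + 1 \<Longrightarrow> k \<in> {1..r e} \<Longrightarrow> h \<in> {1..l e k} \<Longrightarrow>
        local_solution (2 * N) ?Text ?Aext (t e) (lam e k) (pos n l e k h)
          (if e = m\<^sub>0 then {\<theta> e<..<\<theta> e + pi} else {\<theta> e - pi<..<\<theta> e})
          (if e = m\<^sub>0 then sector_plus t\<^sub>0 \<theta> \<delta> m\<^sub>0 else sector_minus t\<^sub>0 \<theta> \<delta> (m\<^sub>0 + 1))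
          (sector t\<^sub>0 (\<theta> m\<^sub>0) (\<theta> (m\<^sub>0 + 1))) (F e k h)"
    for m\<^sub>0 i \<nu> k h and F :: "nat \<Rightarrow> nat \<Rightarrow> nat \<Rightarrow> complex \<Rightarrow> complex Matrix.vec"
  proof -
    \<comment> \<open>Im y is minus the argument of x - t0, so the larger angle gives the lower
      edge.\<close>
    define lo where "lo = - \<theta> (m\<^sub>0 + 1)"
    define hi where "hi = - \<theta> m\<^sub>0"
    define Y where "Y = {y. lo < Im y \<and> Im y < hi}"
    have mp: "m\<^sub>0 \<in> {1..p}" "m\<^sub>0 + 1 \<in> {1..p}" using m\<^sub>0 by auto
    have \<theta>_le: "\<theta> e \<le> \<theta> e'" if "e \<in> {1..p}" "e' \<in> {1..p}" "e \<le> e'" for e e'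
      using strict_mono_onD[OF \<theta>_mono(1) that(1,2)] that(3) by (cases "e = e'") auto
    have \<theta>m: "\<theta> m\<^sub>0 < \<theta> (m\<^sub>0 + 1)" using strict_mono_onD[OF \<theta>_mono(1) mp] by simp
    have \<theta>1: "\<theta> 1 \<le> \<theta> m\<^sub>0" "\<theta> (m\<^sub>0 + 1) \<le> \<theta> p" using mp by (auto intro!: \<theta>_le)
    have \<theta>gap: "\<theta> (m\<^sub>0 + 1) - \<theta> m\<^sub>0 < 2 * pi" using \<theta>1 \<theta>_mono(2) by linarith
    have ei: "i = m\<^sub>0 \<or> i = m\<^sub>0 + 1" and e\<nu>: "\<nu> = m\<^sub>0 \<or> \<nu> = m\<^sub>0 + 1" and i\<nu>: "\<nu> \<noteq> i" using pair by auto
    have ep: "e \<in> {1..p}" if "e = m\<^sub>0 \<or> e = m\<^sub>0 + 1" for e using that mp by auto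
    interpret strip Y "z i" "z \<nu>" lo hi
      by unfold_locales (use \<theta>m \<theta>gap pair in \<open>auto simp: Y_def lo_def hi_def Im_z\<close>)
    interpret nu: strip Y "z \<nu>" "z i" lo hi by (rule swap)
    have sideY: "side_domain Y (z e)" if "e = m\<^sub>0 \<or> e = m\<^sub>0 + 1" for e
      using that pair side_a nu.side_a by auto
    have low: "if e = m\<^sub>0 then Im y < Im (z e) else Im (z e) < Im y" if "e = m\<^sub>0 \<or> e = m\<^sub>0 + 1" "y \<in> Y" for e y
      using that \<theta>m by (auto simp: Y_def lo_def hi_def Im_z)
    obtain U g where U: "open U" "g holomorphic_on U" "open (sector t\<^sub>0 (\<theta> m\<^sub>0) (\<theta> (m\<^sub>0 + 1)))"
      "sector t\<^sub>0 (\<theta> m\<^sub>0) (\<theta> (m\<^sub>0 + 1)) \<subseteq> U"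
      and gx: "\<And>x. x \<in> sector t\<^sub>0 (\<theta> m\<^sub>0) (\<theta> (m\<^sub>0 + 1)) \<Longrightarrow> lo < Im (g x) \<and> Im (g x) < hi \<and> t\<^sub>0 + exp (- g x) = x"
      and xD: "\<And>y. lo < Im y \<Longrightarrow> Im y < hi \<Longrightarrow> t\<^sub>0 + exp (- y) \<in> sector t\<^sub>0 (\<theta> m\<^sub>0) (\<theta> (m\<^sub>0 + 1))"
      and gU: "\<And>y. lo \<le> Im y \<Longrightarrow> Im y \<le> hi \<Longrightarrow> t\<^sub>0 + exp (- y) \<in> U \<and> g (t\<^sub>0 + exp (- y)) = y"
      unfolding lo_def hi_def by (rule sector_strip[OF \<theta>m \<theta>gap, of t\<^sub>0]) blast
    let ?D = "sector t\<^sub>0 (\<theta> m\<^sub>0) (\<theta> (m\<^sub>0 + 1))" and ?S = "slit_plane p \<eta>\<^sub>0 t'"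
    \<comment> \<open>A point on a slit would have Im y equal to -theta_e up to 2 pi d. For d = 0
      the angle theta_e would lie strictly between two consecutive angles; for other d two angles
      would differ by more than 2 pi, although all of them lie within less than that.\<close>
    have slit: "\<eta>\<^sub>0 + exp y \<in> ?S" if y: "y \<in> Y" for y
    proof (rule ccontr)
      assume "\<not> ?thesis"
      then obtain e s where e: "e \<in> {1..p}" and s: "s \<ge> 1" "\<eta>\<^sub>0 + exp y = \<eta>\<^sub>0 + (t' e - \<eta>\<^sub>0) * of_real s"
        unfolding slit_plane_def by auto
      have "exp y = exp (z e + of_real (ln s))"
        using s t'_eq[OF e] by (simp add: exp_add exp_of_real)
      then obtain d :: int where "y = z e + of_real (ln s) + of_int (2 * d) * of_real pi * \<i>"
        unfolding exp_eq by auto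
      then have Im: "Im y = - \<theta> e + 2 * of_int d * pi" by (simp add: Im_z)
      have rng: "\<theta> m\<^sub>0 < \<theta> e - 2 * of_int d * pi" "\<theta> e - 2 * of_int d * pi < \<theta> (m\<^sub>0 + 1)"
        using y unfolding Y_def lo_def hi_def by (simp_all add: Im)
      have e1: "\<theta> 1 \<le> \<theta> e" "\<theta> e \<le> \<theta> p" using e by (auto intro!: \<theta>_le)
      show False
      proof (cases "d = 0")
        case True
        have "e \<le> m\<^sub>0 \<or> m\<^sub>0 + 1 \<le> e" by auto
        then show False using True rng \<theta>_le[OF e mp(1)] \<theta>_le[OF mp(2) e] by auto
      next
        case False
        then have "d \<ge> 1 \<or> d \<le> - 1" by linarith
        then show False
        proof
          assume "d \<ge> 1"
          then have "1 * pi \<le> of_int d * pi" by (intro mult_right_mono) auto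
          then show False using rng e1 \<theta>1 \<theta>_mono(2) by linarith
        next
          assume "d \<le> - 1"
          then have "of_int d * pi \<le> (- 1) * pi" by (intro mult_right_mono) auto
          then show False using rng e1 \<theta>1 \<theta>_mono(2) by linarith
        qed
      qed
    qed
    have opS: "open ?S" by (rule open_slit_plane) (simp add: t'_eq)
    define W where "W = (\<lambda>e k h j y. w e k h (\<eta>\<^sub>0 + exp y) $ j)"
    define V where "V = (\<lambda>e k h j y. F e k h (t\<^sub>0 + exp (- y)) $ j)"
    define c0 where "c0 = (\<lambda>e. if e = m\<^sub>0 then 0 else - 2 * of_real pi * \<i> :: complex)"
    define c1 where "c1 = (\<lambda>e. if e = m\<^sub>0 then of_real pi * \<i> else - of_real pi * \<i> :: complex)"
    \<comment> \<open>The logarithms on the two sides are corrected differently at the lower and the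
      upper end, yet their discrepancy is pi i in both cases. This is the origin of the factor
      exp(pi i lambda), with the same sign in both claims.\<close>
    have c01: "c1 e = c0 e + of_real pi * \<i>" for e by (simp add: c0_def c1_def)
    have hw_ex: "\<exists>f. has_branch Y (z e) (lam e k) (W e k h j) f \<and>
        f (z e) = exp (lam e k * (z e + c0 e)) * (if j = pos n l e k h then 1 else 0)"
      if e: "e = m\<^sub>0 \<or> e = m\<^sub>0 + 1" and kh: "k \<in> {1..r e}" "h \<in> {1..l e k}" and j: "j < N" for e k h j
    proof -
      have "local_solution N T' A (\<eta>\<^sub>0 + exp (z e)) (lam e k) (pos n l e k h) {Im (z e) - 2 * pi<..<Im (z e)} ?S ?S (w e k h)"
        using w[OF ep[OF e] kh] unfolding uA t'_eq[OF ep[OF e]] \<theta>'_def[OF ep[OF e]] Im_z .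
      from underlying_branch[OF this, of Y "e = m\<^sub>0" j] show ?thesis
        using low[OF e] slit j unfolding W_def c0_def by (metis (no_types, lifting))
    qed
    define hw where "hw = (\<lambda>e k h j. SOME f. has_branch Y (z e) (lam e k) (W e k h j) f \<and>
        f (z e) = exp (lam e k * (z e + c0 e)) * (if j = pos n l e k h then 1 else 0))"
    have hw: "has_branch Y (z e) (lam e k) (W e k h j) (hw e k h j) \<and>
        hw e k h j (z e) = exp (lam e k * (z e + c0 e)) * (if j = pos n l e k h then 1 else 0)"
      if "e = m\<^sub>0 \<or> e = m\<^sub>0 + 1" "k \<in> {1..r e}" "h \<in> {1..l e k}" "j < N" for e k h j
      unfolding hw_def by (rule someI_ex[OF hw_ex[OF that]])
    have hv_ex: "\<exists>f. has_branch Y (z e) (lam e k) (V e k h j) f \<and>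
        f (z e) = exp (lam e k * (- z e + c1 e)) * (if j = pos n l e k h then 1 else 0)"
      if e: "e = m\<^sub>0 \<or> e = m\<^sub>0 + 1" and kh: "k \<in> {1..r e}" "h \<in> {1..l e k}" and j: "j < 2 * N" for e k h j
    proof -
      let ?B = "if e = m\<^sub>0 then sector_plus t\<^sub>0 \<theta> \<delta> m\<^sub>0 else sector_minus t\<^sub>0 \<theta> \<delta> (m\<^sub>0 + 1)"
      \<comment> \<open>Within this distance of \<open>z e\<close> the argument of x - t0 cannot
        leave the half sector on which the branch at t_e is prescribed.\<close>
      define d where "d = min pi (\<theta> (m\<^sub>0 + 1) - \<theta> m\<^sub>0 - \<delta>)"
      have d: "0 < d" "d \<le> pi" "d \<le> \<theta> (m\<^sub>0 + 1) - \<theta> m\<^sub>0 - \<delta>"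
        using \<delta>_small(1) \<delta>_small(2)[of m\<^sub>0] mp by (auto simp: d_def)
      have B: "t\<^sub>0 + exp (- y) \<in> ?B" if y: "y \<in> Y" "y \<in> ball (z e) d" for y
      proof -
        have "\<bar>Im y - Im (z e)\<bar> < d" using y(2) abs_Im_le_cmod[of "y - z e"] by (simp add: dist_norm norm_minus_commute)
        then have r: "- Im y < \<theta> e + d" "\<theta> e - d < - Im y" by (simp_all add: Im_z)
        have a: "is_Arg (exp (- y)) (- Im y)" using pow_arg_exp(1)[of "- y" "exp (- y)"] by simp
        have y': "\<theta> m\<^sub>0 < - Im y" "- Im y < \<theta> (m\<^sub>0 + 1)" using y(1) by (auto simp: Y_def lo_def hi_def)
        show ?thesis
        proof (cases "e = m\<^sub>0")
          case True
          then have "- Im y < min (\<theta> (m\<^sub>0 + 1) - \<delta>) (\<theta> m\<^sub>0 + pi)" using r d by auto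
          then show ?thesis using True a y' by (auto simp: sector_plus_def sector_def)
        next
          case False
          then have em: "e = m\<^sub>0 + 1" using e by simp
          then have "max (\<theta> (m\<^sub>0 + 1 - 1) + \<delta>) (\<theta> (m\<^sub>0 + 1) - pi) < - Im y" using r d by auto
          then show ?thesis using False a y' by (auto simp: sector_minus_def sector_def)
        qed
      qed
      have I_eq: "(if e = m\<^sub>0 then {\<theta> e<..<\<theta> e + pi} else {\<theta> e - pi<..<\<theta> e}) =
          (if e = m\<^sub>0 then {- Im (z e)<..<- Im (z e) + pi} else {- Im (z e) - pi<..<- Im (z e)})" by (simp add: Im_z)
      have FF: "local_solution (2 * N) ?Text ?Aext (t\<^sub>0 + exp (- z e)) (lam e k) (pos n l e k h)
          (if e = m\<^sub>0 then {- Im (z e)<..<- Im (z e) + pi} else {- Im (z e) - pi<..<- Im (z e)}) ?B ?D (F e k h)"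
        using F[OF e kh] unfolding t_eq[OF ep[OF e]] I_eq .
      obtain f where "has_branch Y (z e) (lam e k) (\<lambda>y. F e k h (t\<^sub>0 + exp (- y)) $ j) f"
        "f (z e) = exp (lam e k * (- z e + (if e = m\<^sub>0 then of_real pi * \<i> else - of_real pi * \<i>))) * (if j = pos n l e k h then 1 else 0)"
        by (rule extended_branch[OF FF, where Y = Y and d = d and j = j, OF low[OF e] d(1) B j])
      then show ?thesis unfolding V_def c1_def by blast
    qed
    define hv where "hv = (\<lambda>e k h j. SOME f. has_branch Y (z e) (lam e k) (V e k h j) f \<and>
        f (z e) = exp (lam e k * (- z e + c1 e)) * (if j = pos n l e k h then 1 else 0))"
    have hv: "has_branch Y (z e) (lam e k) (V e k h j) (hv e k h j) \<and>
        hv e k h j (z e) = exp (lam e k * (- z e + c1 e)) * (if j = pos n l e k h then 1 else 0)"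
      if "e = m\<^sub>0 \<or> e = m\<^sub>0 + 1" "k \<in> {1..r e}" "h \<in> {1..l e k}" "j < 2 * N" for e k h j
      unfolding hv_def by (rule someI_ex[OF hv_ex[OF that]])
    have germ: "germ N \<tau> A Y (z e) (lam e k) (hw e k h) (W e k h)"
      if e: "e = m\<^sub>0 \<or> e = m\<^sub>0 + 1" and kh: "k \<in> {1..r e}" "h \<in> {1..l e k}" for e k h
    proof -
      have sol: "solves_on N T' A ?S (w e k h)"
        using w[OF ep[OF e] kh] unfolding uA local_solution_def by (rule conjunct1)
      have "euler_system N (\<lambda>j y. 1 - \<tau> j * exp (- y)) A Y (\<lambda>j y. w e k h (\<eta>\<^sub>0 + exp y) $ j)"
      proof (rule euler_system_compose[OF sol T'(1) A_carrier T'(2) opS open_Y, where x' = exp])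
        show "\<eta>\<^sub>0 + exp y \<in> ?S \<and> ((\<lambda>y. \<eta>\<^sub>0 + exp y) has_field_derivative exp y) (at y)" if "y \<in> Y" for y
          using slit[OF that] by (auto intro!: derivative_eq_intros)
        show "(1 - \<tau> j * exp (- y)) * exp y = \<eta>\<^sub>0 + exp y - t' (b j)" if "j < N" for j y
          using t'_eq[OF blk[OF that]] by (simp add: \<tau>_def exp_minus field_simps)
      qed
      then show ?thesis using hw[OF e kh] gen_lam[OF ep[OF e] kh(1)] unfolding germ_def W_def by blast
    qed
    have eulV: "euler_system (2 * N) (ext_weight N \<tau>) ?Aext Y (V e k h)"
      if e: "e = m\<^sub>0 \<or> e = m\<^sub>0 + 1" and kh: "k \<in> {1..r e}" "h \<in> {1..l e k}" for e k h
    proof -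
      have sol: "solves_on (2 * N) ?Text ?Aext ?D (F e k h)"
        using F[OF e kh] unfolding local_solution_def by (rule conjunct1)
      show ?thesis
        unfolding V_def
      proof (rule euler_system_compose[OF sol Text(1) Aext Text(2) U(3) open_Y, where x' = "\<lambda>y. - exp (- y)"])
        show "t\<^sub>0 + exp (- y) \<in> ?D \<and> ((\<lambda>y. t\<^sub>0 + exp (- y)) has_field_derivative - exp (- y)) (at y)" if "y \<in> Y" for y
          using xD[of y] that by (auto simp: Y_def intro!: derivative_eq_intros)
        show "ext_weight N \<tau> j y * - exp (- y) = t\<^sub>0 + exp (- y) - (if j < N then t (b j) else t\<^sub>0)" if "j < 2 * N" for j y
        proof (cases "j < N")
          case True
          have "exp y / \<tau> j * exp (- y) = exp (- z (b j))" by (simp add: \<tau>_def exp_minus field_simps)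
          then show ?thesis using True exp_mz[OF blk[OF True]] by (simp add: ext_weight_def algebra_simps)
        qed (simp add: ext_weight_def)
      qed
    qed
    define I where "I = (SIGMA k':{1..r \<nu>}. {1..l \<nu> k'})"
    define C where "C = (\<lambda>(k', h'). c \<nu> k' h' i k h)"
    have I: "finite I" by (auto simp: I_def)
    have Isum: "(\<Sum>x\<in>I. f x) = (\<Sum>k'=1..r \<nu>. \<Sum>h'=1..l \<nu> k'. f (k', h'))" for f :: "nat \<times> nat \<Rightarrow> complex"
      unfolding I_def by (subst sum.Sigma) (auto simp: case_prod_unfold)
    have rel: "connected_at N Y (z \<nu>) I C (W i k h) (\<lambda>x. W \<nu> (fst x) (snd x))"
    proof -
      obtain X f where X: "open X" "t' \<nu> \<in> X" "\<forall>j<N. (\<lambda>x. f x $ j) holomorphic_on (?S \<union> X)"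
        "\<forall>x\<in>?S. \<forall>j<N. w i k h x $ j = (\<Sum>k'=1..r \<nu>. \<Sum>h'=1..l \<nu> k'. c \<nu> k' h' i k h * w \<nu> k' h' x $ j) + f x $ j"
        using c[OF ep[OF e\<nu>] ep[OF ei] i\<nu> k h] unfolding connection_relation_def by (elim exE conjE) (rule that; assumption)
      show ?thesis
        unfolding connected_at_def
      proof (intro exI conjI allI impI ballI)
        show "open ((\<lambda>y. \<eta>\<^sub>0 + exp y) -` X)"
          by (rule continuous_open_vimage[OF X(1)]) (auto intro!: continuous_intros)
        show "z \<nu> \<in> (\<lambda>y. \<eta>\<^sub>0 + exp y) -` X" using X(2) t'_eq[OF ep[OF e\<nu>]] by simp
        fix j assume j: "j < N"
        have "((\<lambda>x. f x $ j) \<circ> (\<lambda>y. \<eta>\<^sub>0 + exp y)) holomorphic_on Y \<union> (\<lambda>y. \<eta>\<^sub>0 + exp y) -` X"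
          by (rule holomorphic_on_compose_gen[OF _ X(3)[rule_format, OF j]]) (use slit in \<open>auto intro!: holomorphic_intros\<close>)
        then show "(\<lambda>y. f (\<eta>\<^sub>0 + exp y) $ j) holomorphic_on Y \<union> (\<lambda>y. \<eta>\<^sub>0 + exp y) -` X" by (simp add: o_def)
      next
        fix y j assume y: "y \<in> Y" and j: "j < N"
        show "W i k h j y = (\<Sum>x\<in>I. C x * W \<nu> (fst x) (snd x) j y) + f (\<eta>\<^sub>0 + exp y) $ j"
          unfolding Isum W_def C_def using X(4)[rule_format, OF slit[OF y] j] by simp
      qed
    qed
    \<comment> \<open>The same number of shifts has to serve all exponents occurring in the
      relation.\<close>
    obtain nn :: nat where nn: "\<forall>x\<in>insert (lam i k) ((\<lambda>x. lam \<nu> (fst x)) ` I). Re x + nn > 1"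
      using exists_nat_shift[of "insert (lam i k) ((\<lambda>x. lam \<nu> (fst x)) ` I)"] I by blast
    have I\<nu>: "fst x \<in> {1..r \<nu>}" "snd x \<in> {1..l \<nu> (fst x)}" if "x \<in> I" for x using that by (auto simp: I_def)
    have "\<exists>V\<^sub>0 V. lifted N \<tau> P Q A \<rho>\<^sub>1 \<rho>\<^sub>2 Y (z i) (lam i k) (hw i k h) V\<^sub>0 \<and>
        (\<forall>x\<in>I. lifted N \<tau> P Q A \<rho>\<^sub>1 \<rho>\<^sub>2 Y (z \<nu>) (lam \<nu> (fst x)) (hw \<nu> (fst x) (snd x)) (V x)) \<and>
        connected_at (2 * N) Y (z \<nu>) I C V\<^sub>0 V"
      by (rule connection_lift[OF P_carrier PQ QP \<tau>_nz I A_carrier inv germ[OF ei k h] _ germ[OF e\<nu> I\<nu>] _ rel])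
        (use nn in auto)
    then obtain V0 V1 where V0: "lifted N \<tau> P Q A \<rho>\<^sub>1 \<rho>\<^sub>2 Y (z i) (lam i k) (hw i k h) V0"
      and V1: "\<And>x. x \<in> I \<Longrightarrow> lifted N \<tau> P Q A \<rho>\<^sub>1 \<rho>\<^sub>2 Y (z \<nu>) (lam \<nu> (fst x)) (hw \<nu> (fst x) (snd x)) (V1 x)"
      and relV: "connected_at (2 * N) Y (z \<nu>) I C V0 V1" by blast
    \<comment> \<open>Any lift of the underlying solution is a multiple of the given solution, since
      the leading coefficients differ by the factor \<open>K e k\<close>.\<close>
    have match: "V e k h j y = K e k * V' j y"
      if e: "e = m\<^sub>0 \<or> e = m\<^sub>0 + 1" and kh: "k \<in> {1..r e}" "h \<in> {1..l e k}"
        and V': "lifted N \<tau> P Q A \<rho>\<^sub>1 \<rho>\<^sub>2 Y (z e) (lam e k) (hw e k h) V'" and j: "j < 2 * N" and y: "y \<in> Y" for e k h V' j y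
    proof (rule lifted_unique[OF sideY[OF e] connected_Y A_carrier \<tau>_nz P_carrier V' eulV[OF e kh] _ _ _ _ gen_lam[OF ep[OF e] kh(1)] j y])
      show "has_branch Y (z e) (lam e k) (V e k h j) (hv e k h j)" if "j < 2 * N" for j using hv[OF e kh that] by simp
      show "hv e k h j (z e) = K e k * (exp (- (\<rho>\<^sub>1 + \<rho>\<^sub>2) * z e) * hw e k h j (z e))" if "j < N" for j
      proof -
        \<comment> \<open>The left side is the exponent of the leading coefficient in x; the right
          side collects those of K, of the gauge factor and of the leading coefficient in zeta. The
          opposite signs of \<open>z e\<close> in the two coordinates produce 2 lambda, and the
          gauge factor accounts for -rho1 - rho2.\<close>
        have "lam e k * (- z e + c1 e) = (pi * \<i> * lam e k + (2 * lam e k - \<rho>\<^sub>1 - \<rho>\<^sub>2) * (- z e)) +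
            (- (\<rho>\<^sub>1 + \<rho>\<^sub>2) * z e + lam e k * (z e + c0 e))"
          unfolding c01 by (simp add: algebra_simps)
        then have "exp (lam e k * (- z e + c1 e)) = K e k * (exp (- (\<rho>\<^sub>1 + \<rho>\<^sub>2) * z e) * exp (lam e k * (z e + c0 e)))"
          unfolding K_eq by (simp only: exp_add)
        then show ?thesis using hv[OF e kh, of j] hw[OF e kh that] that by simp
      qed
      show "A $$ (j, j') = 0" if "j < N" "j' < N" "\<tau> j = exp (z e)" "\<tau> j' = exp (z e)" "j \<noteq> j'" for j j'
        using A_block[OF that(1,2), of e] \<tau>_iff[OF _ ep[OF e]] that by auto
      show "A $$ (j, j) = lam e k \<or> A $$ (j, j) - lam e k \<notin> \<int>" if jj: "j < N" "\<tau> j = exp (z e)" for j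
      proof -
        obtain k' where k': "k' \<in> {1..r e}" "A $$ (j, j) = lam e k'"
          using A_block[OF jj(1,1), of e] \<tau>_iff[OF jj(1) ep[OF e]] jj(2) by auto
        then show ?thesis using gen_diff[OF ep[OF e] k'(1) kh(1)] by (cases "k' = k") auto
      qed
    qed
    obtain X f where X: "open X" "z \<nu> \<in> X" "\<forall>j<2*N. f j holomorphic_on (Y \<union> X)"
      "\<forall>y\<in>Y. \<forall>j<2*N. V0 j y = (\<Sum>x\<in>I. C x * V1 x j y) + f j y"
      using relV unfolding connected_at_def by (elim exE conjE) (rule that; assumption)
    \<comment> \<open>\<open>U\<close> reaches across the edge of the sector that carries t_nu, so
      the preimage is a full neighbourhood of \<open>t \<nu>\<close>.\<close>
    define R where "R = U \<inter> g -` X"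
    show ?thesis
      unfolding connection_relation_def
    proof (intro exI conjI allI impI ballI)
      show "open R" unfolding R_def
        by (intro continuous_open_preimage holomorphic_on_imp_continuous_on[OF U(2)] U(1) X(1))
      have "lo \<le> Im (z \<nu>)" "Im (z \<nu>) \<le> hi" using pair \<theta>m by (auto simp: lo_def hi_def Im_z)
      from gU[OF this] show "t \<nu> \<in> R" using X(2) t_eq[OF ep[OF e\<nu>]] by (simp add: R_def)
    next
      fix j assume j: "j < 2 * N"
      have "(f j \<circ> g) holomorphic_on ?D \<union> R"
      proof (rule holomorphic_on_compose_gen[OF _ X(3)[rule_format, OF j]])
        show "g holomorphic_on ?D \<union> R" by (rule holomorphic_on_subset[OF U(2)]) (use U(4) in \<open>auto simp: R_def\<close>)
        show "g ` (?D \<union> R) \<subseteq> Y \<union> X" using gx by (auto simp: R_def Y_def)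
      qed
      then have "(\<lambda>x. K i k * f j (g x)) holomorphic_on ?D \<union> R" by (auto intro!: holomorphic_intros simp: o_def)
      then show "(\<lambda>x. vec (2 * N) (\<lambda>j. K i k * f j (g x)) $ j) holomorphic_on ?D \<union> R" using j by simp
    next
      fix x j assume x: "x \<in> ?D" and j: "j < 2 * N"
      have y: "g x \<in> Y" and xg: "t\<^sub>0 + exp (- g x) = x" using gx[OF x] by (auto simp: Y_def)
      have "F i k h x $ j = V i k h j (g x)" by (simp add: V_def xg)
      also have "\<dots> = K i k * V0 j (g x)" by (rule match[OF ei k h V0 j y])
      also have "\<dots> = (\<Sum>x'\<in>I. K i k * (C x' * V1 x' j (g x))) + K i k * f j (g x)"
        using X(4)[rule_format, OF y j] by (simp add: distrib_left sum_distrib_left)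
      also have "(\<Sum>x'\<in>I. K i k * (C x' * V1 x' j (g x))) =
          (\<Sum>x'\<in>I. K i k / K \<nu> (fst x') * C x' * F \<nu> (fst x') (snd x') x $ j)"
      proof (rule sum.cong[OF refl])
        fix x' assume x': "x' \<in> I"
        have "F \<nu> (fst x') (snd x') x $ j = K \<nu> (fst x') * V1 x' j (g x)"
          using match[OF e\<nu> I\<nu>[OF x'] V1[OF x'] j y] by (simp add: V_def xg)
        then show "K i k * (C x' * V1 x' j (g x)) = K i k / K \<nu> (fst x') * C x' * F \<nu> (fst x') (snd x') x $ j"
          using K_nz by simp
      qed
      finally show "F i k h x $ j = (\<Sum>k'=1..r \<nu>. \<Sum>h'=1..l \<nu> k'. K i k / K \<nu> k' * c \<nu> k' h' i k h * F \<nu> k' h' x $ j) +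
          vec (2 * N) (\<lambda>j. K i k * f j (g x)) $ j"
        using j by (simp add: Isum C_def)
    qed
  qed

  have union: "sector_plus t\<^sub>0 \<theta> \<delta> m\<^sub>0 \<union> sector_minus t\<^sub>0 \<theta> \<delta> (m\<^sub>0 + 1) = sector t\<^sub>0 (\<theta> m\<^sub>0) (\<theta> (m\<^sub>0 + 1))"
    if m\<^sub>0: "m\<^sub>0 \<in> {1..<p}" for m\<^sub>0
  proof -
    have "\<theta> 1 \<le> \<theta> m\<^sub>0"
      using strict_mono_onD[OF \<theta>_mono(1), of 1 m\<^sub>0] m\<^sub>0 by (cases "m\<^sub>0 = 1") auto
    moreover have "\<theta> (m\<^sub>0 + 1) \<le> \<theta> p"
      using strict_mono_onD[OF \<theta>_mono(1), of "m\<^sub>0 + 1" p] m\<^sub>0 by (cases "m\<^sub>0 + 1 = p") auto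
    ultimately have "\<theta> (m\<^sub>0 + 1) - \<theta> m\<^sub>0 < 2 * pi" using \<theta>_mono(2) by linarith
    then show ?thesis
      unfolding sector_plus_def sector_minus_def
      using sector_union[of \<delta> "\<theta> (m\<^sub>0 + 1)" "\<theta> m\<^sub>0" t\<^sub>0] \<delta>_small(1) \<delta>_small(2)[of m\<^sub>0] m\<^sub>0 by simp
  qed
  define F where "F = (\<lambda>m\<^sub>0 e. if e = m\<^sub>0 then U_plus e else U_minus e)"
  have F: "local_solution (2 * N) ?Text ?Aext (t e) (lam e k) (pos n l e k h)
          (if e = m\<^sub>0 then {\<theta> e<..<\<theta> e + pi} else {\<theta> e - pi<..<\<theta> e})
          (if e = m\<^sub>0 then sector_plus t\<^sub>0 \<theta> \<delta> m\<^sub>0 else sector_minus t\<^sub>0 \<theta> \<delta> (m\<^sub>0 + 1))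
          (sector t\<^sub>0 (\<theta> m\<^sub>0) (\<theta> (m\<^sub>0 + 1))) (F m\<^sub>0 e k h)"
    if m\<^sub>0: "m\<^sub>0 \<in> {1..<p}" and e: "e = m\<^sub>0 \<or> e = m\<^sub>0 + 1" and kh: "k \<in> {1..r e}" "h \<in> {1..l e k}" for m\<^sub>0 e k h
  proof (cases "e = m\<^sub>0")
    case True
    then show ?thesis
      using U_plus[of e k h] kh m\<^sub>0 union[OF m\<^sub>0] unfolding A'_eq t\<^sub>0_def[symmetric] by (simp add: F_def)
  next
    case False
    then have em: "e = m\<^sub>0 + 1" using e by simp
    have e2: "e \<in> {2..p}" using em m\<^sub>0 by auto
    show ?thesis
      using U_minus[OF e2 kh] union[OF m\<^sub>0] False unfolding A'_eq t\<^sub>0_def[symmetric] em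
      by (simp add: F_def Un_commute)
  qed
  show ?thesis
    unfolding t\<^sub>0_def[symmetric]
  proof (intro conjI ballI)
    fix i k h assume i: "i \<in> {1..<p}" and k: "k \<in> {1..r i}" and h: "h \<in> {1..l i k}"
    have "connection_relation (2 * N) (sector t\<^sub>0 (\<theta> i) (\<theta> (i + 1))) (t (i + 1)) (r (i + 1)) (l (i + 1))
        (\<lambda>k' h'. K i k / K (i + 1) k' * c (i + 1) k' h' i k h) (F i (i + 1)) (F i i k h)"
      by (rule key[OF i _ k h F[OF i]]) auto
    then show "connection_relation (2 * N)
        (sector_plus t\<^sub>0 \<theta> \<delta> i \<union> sector_minus t\<^sub>0 \<theta> \<delta> (i+1)) (t (i+1)) (r (i+1)) (l (i+1))
        (\<lambda>k' h'. (exp (pi * \<i> * lam i k) * pow_arg (\<theta> i) (t i - t\<^sub>0) (2 * lam i k - \<rho>\<^sub>1 - \<rho>\<^sub>2))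
                 / (exp (pi * \<i> * lam (i+1) k') * pow_arg (\<theta> (i+1)) (t (i+1) - t\<^sub>0) (2 * lam (i+1) k' - \<rho>\<^sub>1 - \<rho>\<^sub>2))
                 * c (i+1) k' h' i k h) (U_minus (i+1)) (U_plus i k h)"
      unfolding union[OF i] K_def F_def by simp
  next
    fix i k h assume i: "i \<in> {2..p}" and k: "k \<in> {1..r i}" and h: "h \<in> {1..l i k}"
    have i1: "i - 1 \<in> {1..<p}" "i - 1 + 1 = i" "i - 1 \<noteq> i" using i by auto
    have "connection_relation (2 * N) (sector t\<^sub>0 (\<theta> (i - 1)) (\<theta> (i - 1 + 1))) (t (i - 1)) (r (i - 1)) (l (i - 1))
        (\<lambda>k' h'. K i k / K (i - 1) k' * c (i - 1) k' h' i k h) (F (i - 1) (i - 1)) (F (i - 1) i k h)"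
      by (rule key[OF i1(1) _ k h F[OF i1(1)]]) (use i1 in auto)
    then show "connection_relation (2 * N)
        (sector_minus t\<^sub>0 \<theta> \<delta> i \<union> sector_plus t\<^sub>0 \<theta> \<delta> (i-1)) (t (i-1)) (r (i-1)) (l (i-1))
        (\<lambda>k' h'. (exp (pi * \<i> * lam i k) * pow_arg (\<theta> i) (t i - t\<^sub>0) (2 * lam i k - \<rho>\<^sub>1 - \<rho>\<^sub>2))
                 / (exp (pi * \<i> * lam (i-1) k') * pow_arg (\<theta> (i-1)) (t (i-1) - t\<^sub>0) (2 * lam (i-1) k' - \<rho>\<^sub>1 - \<rho>\<^sub>2))
                 * c (i-1) k' h' i k h) (U_plus (i-1)) (U_minus i k h)"
      using union[OF i1(1)] i1(2,3) unfolding K_def F_def by (simp add: Un_commute)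
  qed
qed

end
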